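(* Let $1\le p_0<\infty$ and let $T$ be a sublinear operator such that $$T:L^{p_0}(w)\longrightarrow L^{p_0,\infty}(w)$$ is bounded for every $w\in A_{p_0}$, with norm at most $\varphi(\|w\|_{A_{p_0}})$ for some locally bounded function $\varphi$. Then, for every rearrangement invariant Banach function space $X$ on $\mathbb R^n$ such that $1<p_X\le q_X<\infty$ and every $w\in A_{p_X}$, $$T:X(w)\longrightarrow X(w)$$ is bounded.
   Context: $\|g\|_{L^{p,\infty}(w)}=\sup_{y>0}y\,w(\{|g|>y\})^{1/p}$. $A_p$ is the Muckenhoupt class with $\|w\|_{A_p}=\sup_Q\big(\frac1{|Q|}\int_Qw\big)\big(\frac1{|Q|}\int_Qw^{-1/(p-1)}\big)^{p-1}$ for $1<p<\infty$ and $\|w\|_{A_1}=\sup_Q\big(\frac1{|Q|}\int_Qw\big)\|w^{-1}\|_{L^\infty(Q)}$. A function $\varphi$ on $(0,\infty)$ is locally bounded if $\sup_{0<t<K}\varphi(t)<\infty$ for every $K>0$. Rearrangement invariant Banach function spaces are in the sense of Bennett–Sharpley. $\bar X$ is the representation space of $X$ on $(0,\infty)$, so $\|f\|_X=\|f^*\|_{\bar X}$. The Boyd indices are $p_X=\lim_{t\to\infty}\frac{\log t}{\log h_X(t)}$ and $q_X=\lim_{t\to0^+}\frac{\log t}{\log h_X(t)}$, where $h_X(t)$ is the norm on $\bar X$ of the dilation operator $D_tf(s)=f(s/t)$. With $f_w^*$ the decreasing rearrangement of $f$ with respect to $w(x)\,dx$, $X(w)=\{f: f_w^*\in\bar X\}$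 with $\|f\|_{X(w)}=\|f_w^*\|_{\bar X}$. *)

theory Defs
  imports "HOL-Analysis.Analysis" "HOL-Probability.Essential_Supremum"
begin

text \<open>
  Scalar-valued functions take values in a type of class \<open>real_normed_field\<close>; up to isomorphism
  the only such fields are the reals and the complex numbers. Spaces of functions are given by
  \<open>ennreal\<close>-valued norms on measurable functions, and almost everywhere equal functions
  are not identified.
\<close>

text \<open>Real powers on \<open>[0,\<infinity>]\<close>; only meaningful for exponents \<open>a > 0\<close>.\<close>
definition epowr :: "ennreal \<Rightarrow> real \<Rightarrow> ennreal" where
  "epowr x a = (if x = \<infinity> then \<infinity> else ennreal (enn2real x powr a))"


subsection \<open>Weights and Muckenhoupt classes\<close>

definition cubes :: "'a::euclidean_space set set" where
  "cubes = {cbox a (a + l *\<^sub>R One) | a l. 0 < l}"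

definition weight :: "('a::euclidean_space \<Rightarrow> real) \<Rightarrow> bool" where
  "weight w \<longleftrightarrow> w \<in> borel_measurable lebesgue \<and> (AE x in lebesgue. 0 < w x) \<and>
     (\<forall>Q\<in>cubes. (\<integral>\<^sup>+x\<in>Q. ennreal (w x) \<partial>lebesgue) < \<infinity>)"

definition avg :: "'a::euclidean_space set \<Rightarrow> ('a \<Rightarrow> real) \<Rightarrow> ennreal" where
  "avg Q f = (\<integral>\<^sup>+x\<in>Q. ennreal (f x) \<partial>lebesgue) / emeasure lebesgue Q"

definition Ap_const :: "real \<Rightarrow> ('a::euclidean_space \<Rightarrow> real) \<Rightarrow> ennreal" where
  "Ap_const p w =
     (if p = 1 then SUP Q\<in>cubes. avg Q w * esssup (lebesgue_on Q) (\<lambda>x. ennreal (inverse (w x)))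
      else SUP Q\<in>cubes. avg Q w * epowr (avg Q (\<lambda>x. w x powr (- 1 / (p - 1)))) (p - 1))"

definition Ap :: "real \<Rightarrow> ('a::euclidean_space \<Rightarrow> real) set" where
  "Ap p = {w. weight w \<and> Ap_const p w < \<infinity>}"

definition weighted :: "('a::euclidean_space \<Rightarrow> real) \<Rightarrow> 'a measure" where
  "weighted w = density lebesgue (\<lambda>x. ennreal (w x))"

definition Lp_norm :: "real \<Rightarrow> 'a measure \<Rightarrow> ('a \<Rightarrow> 'b::real_normed_vector) \<Rightarrow> ennreal" where
  "Lp_norm p M f = epowr (\<integral>\<^sup>+x. ennreal (norm (f x) powr p) \<partial>M) (1 / p)"

definition weak_Lp_norm :: "real \<Rightarrow> 'a measure \<Rightarrow> ('a \<Rightarrow> 'b::real_normed_vector) \<Rightarrow> ennreal" where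
  "weak_Lp_norm p M g =
     (SUP y\<in>{0<..}. ennreal y * epowr (emeasure M {x \<in> space M. norm (g x) > y}) (1 / p))"


subsection \<open>Rearrangement invariant Banach function norms\<close>

text \<open>Bennett and Sharpley's Banach function norms. Only the values of \<open>\<rho>\<close> on measurable functions
  are relevant; the space \<open>X\<close> consists of all measurable \<open>f\<close> with \<open>\<rho> \<bar>f\<bar> < \<infinity>\<close>.\<close>
locale banach_function_norm =
  fixes M :: "'a measure" and \<rho> :: "('a \<Rightarrow> ennreal) \<Rightarrow> ennreal"
  assumes zero_iff: "f \<in> borel_measurable M \<Longrightarrow> \<rho> f = 0 \<longleftrightarrow> (AE x in M. f x = 0)"
    and scale: "f \<in> borel_measurable M \<Longrightarrow> 0 \<le> a \<Longrightarrow> \<rho> (\<lambda>x. ennreal a * f x) = ennreal a * \<rho> f"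
    and triangle: "f \<in> borel_measurable M \<Longrightarrow> g \<in> borel_measurable M \<Longrightarrow>
      \<rho> (\<lambda>x. f x + g x) \<le> \<rho> f + \<rho> g"
    and lattice: "f \<in> borel_measurable M \<Longrightarrow> g \<in> borel_measurable M \<Longrightarrow>
      (AE x in M. g x \<le> f x) \<Longrightarrow> \<rho> g \<le> \<rho> f"
    and fatou: "(\<And>n. F n \<in> borel_measurable M) \<Longrightarrow> f \<in> borel_measurable M \<Longrightarrow>
      (AE x in M. incseq (\<lambda>n. F n x) \<and> (\<lambda>n. F n x) \<longlonglongrightarrow> f x) \<Longrightarrow>
      incseq (\<lambda>n. \<rho> (F n)) \<and> (\<lambda>n. \<rho> (F n)) \<longlonglongrightarrow> \<rho> f"
    and finite_indicator: "E \<in> sets M \<Longrightarrow> emeasure M E < \<infinity> \<Longrightarrow> \<rho> (indicator E) < \<infinity>"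
    and local_integrable: "E \<in> sets M \<Longrightarrow> emeasure M E < \<infinity> \<Longrightarrow>
      \<exists>C>0. \<forall>f\<in>borel_measurable M. (\<integral>\<^sup>+x\<in>E. f x \<partial>M) \<le> ennreal C * \<rho> f"

definition distribution :: "'a measure \<Rightarrow> ('a \<Rightarrow> ennreal) \<Rightarrow> ennreal \<Rightarrow> ennreal" where
  "distribution M f s = emeasure M {x \<in> space M. f x > s}"

locale ri_banach_function_norm = banach_function_norm +
  assumes rearrangement_invariant:
    "f \<in> borel_measurable M \<Longrightarrow> g \<in> borel_measurable M \<Longrightarrow>
     (AE x in M. f x < \<infinity>) \<Longrightarrow> (AE x in M. g x < \<infinity>) \<Longrightarrow>
     distribution M f = distribution M g \<Longrightarrow> \<rho> f = \<rho> g"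

definition rearrangement :: "'a measure \<Rightarrow> ('a \<Rightarrow> ennreal) \<Rightarrow> real \<Rightarrow> ennreal" where
  "rearrangement M f t = Inf {s. distribution M f s \<le> ennreal t}"

abbreviation half_line :: "real measure" where
  "half_line \<equiv> lebesgue_on {0<..}"

text \<open>\<open>\<sigma>\<close> is the norm of the representation space of the space with norm \<open>\<rho>\<close>. It exists by
  the Luxemburg representation theorem, and it is unique because Lebesgue measure is nonatomic and
  infinite.\<close>
definition represents ::
  "((real \<Rightarrow> ennreal) \<Rightarrow> ennreal) \<Rightarrow> (('a::euclidean_space \<Rightarrow> ennreal) \<Rightarrow> ennreal) \<Rightarrow> bool" where
  "represents \<sigma> \<rho> \<longleftrightarrow> ri_banach_function_norm half_line \<sigma> \<and>
     (\<forall>f\<in>borel_measurable lebesgue. (AE x in lebesgue. f x < \<infinity>) \<longrightarrow>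
        \<rho> f = \<sigma> (rearrangement lebesgue f))"

definition dilation_norm :: "((real \<Rightarrow> ennreal) \<Rightarrow> ennreal) \<Rightarrow> real \<Rightarrow> ennreal" where
  "dilation_norm \<sigma> t = (SUP f\<in>{f \<in> borel_measurable half_line. \<sigma> f \<le> 1}. \<sigma> (\<lambda>s. f (s / t)))"

text \<open>For a rearrangement invariant norm the dilation norm is finite, at least \<open>1\<close> for \<open>t > 1\<close>
  and at most \<open>1\<close> for \<open>t < 1\<close>. The predicates below describe finite indices only. If an index is
  infinite, then either the quotient tends to infinity, or the logarithm in its denominator vanishes
  near the limit point; in the latter case division by \<open>0\<close> makes the quotient \<open>0\<close>, which is never
  the value of a finite index, as these are at least \<open>1\<close>.\<close>
definition has_lower_boyd_index :: "((real \<Rightarrow> ennreal) \<Rightarrow> ennreal) \<Rightarrow> real \<Rightarrow> bool" where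
  "has_lower_boyd_index \<sigma> p \<longleftrightarrow>
     ((\<lambda>t. ln t / ln (enn2real (dilation_norm \<sigma> t))) \<longlongrightarrow> p) at_top"

definition has_upper_boyd_index :: "((real \<Rightarrow> ennreal) \<Rightarrow> ennreal) \<Rightarrow> real \<Rightarrow> bool" where
  "has_upper_boyd_index \<sigma> q \<longleftrightarrow>
     ((\<lambda>t. ln t / ln (enn2real (dilation_norm \<sigma> t))) \<longlongrightarrow> q) (at_right 0)"

definition weighted_ri_norm ::
  "((real \<Rightarrow> ennreal) \<Rightarrow> ennreal) \<Rightarrow> ('a::euclidean_space \<Rightarrow> real) \<Rightarrow>
   ('a \<Rightarrow> 'b::real_normed_vector) \<Rightarrow> ennreal" where
  "weighted_ri_norm \<sigma> w f = \<sigma> (rearrangement (weighted w) (\<lambda>x. ennreal (norm (f x))))"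


subsection \<open>Sublinear operators\<close>

text \<open>The operator \<open>T\<close> is only meaningful on a linear space \<open>D\<close> of measurable functions.\<close>
definition sublinear_operator ::
  "('a::euclidean_space \<Rightarrow> 'b::{real_normed_field,second_countable_topology}) set \<Rightarrow>
   (('a \<Rightarrow> 'b) \<Rightarrow> ('a \<Rightarrow> 'b)) \<Rightarrow> bool" where
  "sublinear_operator D T \<longleftrightarrow>
     D \<subseteq> borel_measurable lebesgue \<and> (\<lambda>x. 0) \<in> D \<and>
     (\<forall>f\<in>D. \<forall>g\<in>D. (\<lambda>x. f x + g x) \<in> D) \<and> (\<forall>c. \<forall>f\<in>D. (\<lambda>x. c * f x) \<in> D) \<and>
     (\<forall>f\<in>D. T f \<in> borel_measurable lebesgue) \<and>
     (\<forall>f\<in>D. \<forall>g\<in>D. AE x in lebesgue. norm (T (\<lambda>x. f x + g x) x) \<le> norm (T f x) + norm (T g x)) \<and>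
     (\<forall>c. \<forall>f\<in>D. AE x in lebesgue. norm (T (\<lambda>x. c * f x) x) = norm c * norm (T f x))"

text \<open>\<open>T\<close> is defined on the whole space with norm \<open>N\<close>, and bounded from there into the space with
  norm \<open>N'\<close>, with operator norm at most \<open>C\<close>.\<close>
definition bounded_operator ::
  "('a::euclidean_space \<Rightarrow> 'b::{real_normed_field,second_countable_topology}) set \<Rightarrow>
   (('a \<Rightarrow> 'b) \<Rightarrow> ('a \<Rightarrow> 'b)) \<Rightarrow>
   (('a \<Rightarrow> 'b) \<Rightarrow> ennreal) \<Rightarrow> (('a \<Rightarrow> 'b) \<Rightarrow> ennreal) \<Rightarrow> real \<Rightarrow> bool" where
  "bounded_operator D T N N' C \<longleftrightarrow>
     (\<forall>f\<in>borel_measurable lebesgue. N f < \<infinity> \<longrightarrow> f \<in> D \<and> N' (T f) \<le> ennreal C * N f)"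

definition locally_bounded :: "(real \<Rightarrow> real) \<Rightarrow> bool" where
  "locally_bounded \<phi> \<longleftrightarrow> (\<forall>K>0. bdd_above (\<phi> ` {0<..<K}))"

end

theory Submission
  imports Defs
begin

text \<open>
  By the reverse Hoelder inequality \<open>w\<close> lies in \<open>A\<^sub>r\<close> for some \<open>r < p\<^sub>X\<close>, and trivially in
  \<open>A\<^sub>s\<close> for every \<open>s > q\<^sub>X\<close>. By extrapolation \<open>T\<close> is of weak type \<open>(r, r)\<close> and \<open>(s, s)\<close> with respect
  to \<open>w\<close>, and Boyd's interpolation argument gives the boundedness on \<open>X(w)\<close>.

  The extrapolation takes a single step from \<open>p\<^sub>0\<close> to any \<open>p > 1\<close>. For a set \<open>E\<close> on which
  \<open>\<bar>T f\<bar>\<close> exceeds \<open>y\<close>, the Rubio de Francia algorithm gives majorants \<open>H\<^sub>1\<close> of \<open>\<bar>f\<bar>\<close>, controlled in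
  \<open>L\<^sup>p(w)\<close>, and \<open>H\<^sub>2\<close> of \<open>w 1\<^sub>E\<close>, controlled in the dual space, with \<open>H\<^sub>1, H\<^sub>2\<close> in \<open>A\<^sub>1\<close>. Then
  \<open>u = H\<^sub>1 powr (1 - p\<^sub>0) * H\<^sub>2\<close> is an \<open>A\<close> weight for the exponent \<open>p\<^sub>0\<close> with controlled constant, and
  Hoelder's inequality bounds both \<open>\<integral> \<bar>f\<bar> powr p\<^sub>0 * u\<close> and the \<open>w\<close>-measure of \<open>E\<close>. The algorithm needs
  Muckenhoupt's theorem, which follows from the maximal theorem for doubling measures by Lerner's
  pointwise estimate.
\<close>


subsection \<open>Powers and integrals in [0,\<infinity>]\<close>

text \<open>The algorithm gives \<open>HL H x \<le> ennreal c * H x\<close> with a constant that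
  depends on the weight and the exponent only. So the constant of \<open>u\<close> stays below
  \<open>c1 powr (p0 - 1) * c2\<close> for all \<open>f\<close> and \<open>E\<close> at once, and
  one bound for \<open>\<phi>\<close> serves them all. No distinction between \<open>p\<close> below
  and above \<open>p0\<close> arises, because the power \<open>1 - p0\<close> of \<open>H1\<close>
  absorbs the difference of the exponents. Two degeneracies shape the statements. \<open>H1\<close>
  must not vanish, so \<open>f\<close> is first perturbed by a small multiple of the indicator of a
  cube. The last step of the extrapolation divides by a power of the mass of \<open>E\<close>, so
  level sets are cut off by cubes to make that mass finite. As \<open>T\<close> has a meaning on
  \<open>D\<close> only, each bound comes together with a proof of membership in \<open>D\<close>.
  There is no dyadic grid: the covering arguments use the Vitali lemma, and a cube of nearly maximal
  side replaces the maximal dyadic cube of a stopping time argument. Constants are generous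
  throughout, as only their existence matters.\<close>

lemma epowr_ennreal: "0 \<le> x \<Longrightarrow> epowr (ennreal x) a = ennreal (x powr a)"
  by (simp add: epowr_def)

lemma epowr_top [simp]: "epowr \<infinity> a = \<infinity>" "epowr top a = \<infinity>"
  by (simp_all add: epowr_def)

lemma epowr_0 [simp]: "epowr 0 a = 0"
  by (simp add: epowr_def)

lemma epowr_1 [simp]: "epowr 1 a = 1"
  by (simp add: epowr_def)

lemma epowr_one [simp]: "epowr x 1 = x"
  by (cases x) (auto simp: epowr_def)

lemma epowr_mono: "0 \<le> a \<Longrightarrow> x \<le> y \<Longrightarrow> epowr x a \<le> epowr y a"
  by (cases x; cases y) (auto simp: epowr_ennreal intro!: ennreal_leI powr_mono2 simp: top_unique)

lemma epowr_less: "0 < a \<Longrightarrow> x < y \<Longrightarrow> epowr x a < epowr y a"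
  by (cases x; cases y) (auto simp: epowr_ennreal intro!: ennreal_lessI powr_less_mono2 simp: ennreal_less_iff)

lemma epowr_mult: "0 < a \<Longrightarrow> epowr (x * y) a = epowr x a * epowr y a"
  by (cases x; cases y)
     (auto simp: epowr_ennreal ennreal_mult'[symmetric] powr_mult ennreal_top_mult ennreal_mult_top)

lemma epowr_epowr: "epowr (epowr x a) b = epowr x (a * b)"
  by (cases x) (auto simp: epowr_ennreal powr_powr)

text \<open>Holds for all real exponents because \<open>epowr\<close> fixes 0 and infinity whatever
  the exponent. In particular \<open>epowr x 0\<close> is 1 only for positive finite
  \<open>x\<close>, which matters later when \<open>p0 = 1\<close>.\<close>

lemma epowr_add: "epowr x a * epowr x b = epowr x (a + b)"
  by (cases x) (auto simp: epowr_ennreal powr_add ennreal_mult' ennreal_top_mult)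

lemma epowr_less_top [simp]: "epowr x a < \<infinity> \<longleftrightarrow> x < \<infinity>" "epowr x a < top \<longleftrightarrow> x < top"
  by (cases x; auto simp: epowr_ennreal)+

lemma epowr_eq_top [simp]: "epowr x a = top \<longleftrightarrow> x = top"
  by (cases x; auto simp: epowr_ennreal)

lemma epowr_eq_0 [simp]: "epowr x a = 0 \<longleftrightarrow> x = 0"
  by (cases x) (auto simp: epowr_ennreal)

lemma measurable_epowr [measurable]:
  assumes [measurable]: "f \<in> borel_measurable M"
  shows "(\<lambda>x. epowr (f x) a) \<in> borel_measurable M"
  unfolding epowr_def by measurable

lemma epowr_le_cancel: "0 < a \<Longrightarrow> epowr x a \<le> epowr y a \<Longrightarrow> x \<le> y"
  using epowr_less[of a y x] by (meson not_le)

lemma ennreal_le_suminf: "f k \<le> (\<Sum>k. f k :: ennreal)"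
proof -
  have "sum f {k} \<le> suminf f" by (intro sum_le_suminf) auto
  then show ?thesis by simp
qed

lemma epowr_add_le:
  assumes "0 < a" shows "epowr (x + y) a \<le> ennreal (2 powr a) * (epowr x a + epowr y a)"
proof -
  have "epowr (x + y) a \<le> epowr (2 * max x y) a"
    using assms by (intro epowr_mono) (auto simp: max_def mult_2 add_mono)
  also have "\<dots> = ennreal (2 powr a) * epowr (max x y) a"
    using assms epowr_ennreal[of 2 a] by (simp add: epowr_mult)
  also have "\<dots> \<le> ennreal (2 powr a) * (epowr x a + epowr y a)"
    by (intro mult_left_mono) (auto simp: max_def add_increasing add_increasing2)
  finally show ?thesis .
qed

section \<open>Inequalities of Young and Hoelder\<close>

lemma ennreal_young:
  assumes "0 < t" "t < 1"
  shows "epowr x t * epowr y (1 - t) \<le> ennreal t * x + ennreal (1 - t) * y"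
proof (cases "x = 0 \<or> y = 0 \<or> x = top \<or> y = top")
  case True
  then show ?thesis using assms by (auto simp: ennreal_mult_top)
next
  case False
  then obtain a b where ab: "x = ennreal a" "y = ennreal b" "0 < a" "0 < b"
    by (cases x; cases y) (auto simp: less_le)
  then have "a powr t * b powr (1-t) \<le> t * a + (1-t) * b"
    using assms by (intro Youngs_inequality_0) auto
  with ab assms show ?thesis
    by (simp add: epowr_ennreal ennreal_mult'[symmetric] ennreal_plus[symmetric] ennreal_leI del: ennreal_plus)
qed

text \<open>Stated with exponents \<open>t\<close> and \<open>1 - t\<close> for functions that are
  already raised to their powers, so that no conjugate exponent appears. In the main case Young's
  inequality is integrated after both integrals have been normalized to 1.\<close>

lemma nn_integral_Holder:
  assumes [measurable]: "F \<in> borel_measurable M" "G \<in> borel_measurable M" and t: "0 < t" "t < 1"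
  shows "(\<integral>\<^sup>+x. epowr (F x) t * epowr (G x) (1 - t) \<partial>M)
           \<le> epowr (\<integral>\<^sup>+x. F x \<partial>M) t * epowr (\<integral>\<^sup>+x. G x \<partial>M) (1 - t)"
proof -
  let ?A = "\<integral>\<^sup>+x. F x \<partial>M" and ?B = "\<integral>\<^sup>+x. G x \<partial>M"
  consider "?A = 0 \<or> ?B = 0" | "?A \<noteq> 0" "?B \<noteq> 0" "?A = top \<or> ?B = top" | "?A \<noteq> 0" "?B \<noteq> 0" "?A \<noteq> top" "?B \<noteq> top"
    by blast
  then show ?thesis
  proof cases
    case 1
    then have "AE x in M. F x = 0 \<or> G x = 0"
      by (auto simp: nn_integral_0_iff_AE)
    then have "(\<integral>\<^sup>+x. epowr (F x) t * epowr (G x) (1 - t) \<partial>M) = (\<integral>\<^sup>+x. 0 \<partial>M)"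
      by (intro nn_integral_cong_AE) (auto elim!: eventually_mono)
    then show ?thesis by simp
  next
    case 2
    then have "epowr ?A t * epowr ?B (1 - t) = top"
      by (auto simp: ennreal_mult_eq_top_iff)
    then show ?thesis by simp
  next
    case 3
    then obtain a b where ab: "?A = ennreal a" "?B = ennreal b" "0 < a" "0 < b"
      by (cases ?A; cases ?B) (auto simp: less_le)
    have *: "epowr (F x) t * epowr (G x) (1 - t) \<le>
       epowr ?A t * epowr ?B (1 - t) * (ennreal (t / a) * F x + ennreal ((1-t) / b) * G x)" for x
    proof -
      have F: "F x = ?A * (ennreal (1/a) * F x)" and G: "G x = ?B * (ennreal (1/b) * G x)"
        using ab by (simp_all add: mult.assoc[symmetric] ennreal_mult'[symmetric])
      have "epowr (F x) t * epowr (G x) (1 - t) =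
         epowr ?A t * epowr ?B (1 - t) * (epowr (ennreal (1/a) * F x) t * epowr (ennreal (1/b) * G x) (1-t))"
        using t by (subst F, subst G) (simp add: epowr_mult[of t] epowr_mult[of "1-t"] ac_simps del: ennreal_1)
      also have "\<dots> \<le> epowr ?A t * epowr ?B (1 - t) *
          (ennreal t * (ennreal (1/a) * F x) + ennreal (1-t) * (ennreal (1/b) * G x))"
        by (intro mult_left_mono ennreal_young t) auto
      finally show ?thesis using t ab by (simp add: mult.assoc[symmetric] ennreal_mult'[symmetric])
    qed
    have "(\<integral>\<^sup>+x. epowr (F x) t * epowr (G x) (1 - t) \<partial>M) \<le>
       (\<integral>\<^sup>+x. epowr ?A t * epowr ?B (1 - t) * (ennreal (t / a) * F x + ennreal ((1-t) / b) * G x) \<partial>M)"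
      by (intro nn_integral_mono *)
    also have "\<dots> = epowr ?A t * epowr ?B (1 - t) * (ennreal (t / a) * ?A + ennreal ((1-t) / b) * ?B)"
      by (simp add: nn_integral_cmult nn_integral_add)
    also have "ennreal (t / a) * ?A + ennreal ((1-t) / b) * ?B = 1"
      using ab t by (simp add: ennreal_mult'[symmetric] ennreal_plus[symmetric] del: ennreal_plus)
    finally show ?thesis by simp
  qed
qed

section \<open>Masses of sets and the layer cake formula\<close>

lemma sigma_finite_lebesgue: "sigma_finite_measure lebesgue"
proof
  obtain A :: "'a set set" where A: "countable A" "A \<subseteq> sets lborel" "\<Union>A = space lborel"
     "\<forall>a\<in>A. emeasure lborel a \<noteq> \<infinity>"
    using lborel.sigma_finite_countable by blast
  then show "\<exists>A::'a set set. countable A \<and> A \<subseteq> sets lebesgue \<and> \<Union> A = space lebesgue \<and> (\<forall>a\<in>A. emeasure lebesgue a \<noteq> \<infinity>)"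
    by (intro exI[of _ A]) auto
qed

interpretation lebesgue: sigma_finite_measure lebesgue
  by (rule sigma_finite_lebesgue)

abbreviation moment :: "('a::euclidean_space \<Rightarrow> ennreal) \<Rightarrow> real \<Rightarrow> ('a \<Rightarrow> ennreal) \<Rightarrow> ennreal" where
  "moment W p F \<equiv> \<integral>\<^sup>+x. W x * epowr (F x) p \<partial>lebesgue"

text \<open>The integral form keeps monotonicity for arbitrary sets, whereas \<open>emeasure\<close>
  is 0 on nonmeasurable ones. The covering arguments apply it to sets not known to be
  measurable.\<close>

definition mass :: "('a::euclidean_space \<Rightarrow> ennreal) \<Rightarrow> 'a set \<Rightarrow> ennreal" where
  "mass F A = (\<integral>\<^sup>+x\<in>A. F x \<partial>lebesgue)"

lemma mass_emeasure:
  "F \<in> borel_measurable lebesgue \<Longrightarrow> A \<in> sets lebesgue \<Longrightarrow> mass F A = emeasure (density lebesgue F) A"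
  by (simp add: mass_def emeasure_density)

lemma mass_mono_set: "A \<subseteq> B \<Longrightarrow> mass F A \<le> mass F B"
  unfolding mass_def by (intro nn_integral_mono mult_left_mono) (auto simp: indicator_def)

lemma mass_mono_AE: "AE x in lebesgue. x \<in> A \<longrightarrow> F x \<le> G x \<Longrightarrow> mass F A \<le> mass G A"
  unfolding mass_def by (intro nn_integral_mono_AE) (auto elim!: eventually_mono simp: indicator_def)

lemma mass_cong_AE: "AE x in lebesgue. x \<in> A \<longrightarrow> F x = G x \<Longrightarrow> mass F A = mass G A"
  unfolding mass_def by (intro nn_integral_cong_AE) (auto elim!: eventually_mono simp: indicator_def)

lemma mass_1: "A \<in> sets lebesgue \<Longrightarrow> mass (\<lambda>x. 1) A = emeasure lebesgue A"
  by (simp add: mass_def)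

lemma mass_const: "A \<in> sets lebesgue \<Longrightarrow> mass (\<lambda>x. c) A = c * emeasure lebesgue A"
  by (simp add: mass_def nn_integral_cmult)

lemma mass_cmult: "F \<in> borel_measurable lebesgue \<Longrightarrow> A \<in> sets lebesgue \<Longrightarrow> mass (\<lambda>x. c * F x) A = c * mass F A"
  by (simp add: mass_def nn_integral_cmult mult.assoc)

lemma mass_add: "F \<in> borel_measurable lebesgue \<Longrightarrow> G \<in> borel_measurable lebesgue \<Longrightarrow> A \<in> sets lebesgue \<Longrightarrow>
  mass (\<lambda>x. F x + G x) A = mass F A + mass G A"
  by (simp add: mass_def nn_integral_add distrib_right)

lemma mass_UN_countable:
  assumes "F \<in> borel_measurable lebesgue" "\<And>i. i \<in> I \<Longrightarrow> X i \<in> sets lebesgue" "countable I" "disjoint_family_on X I"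
  shows "mass F (\<Union>i\<in>I. X i) = (\<integral>\<^sup>+i. mass F (X i) \<partial>count_space I)"
proof -
  have "mass F (\<Union>i\<in>I. X i) = emeasure (density lebesgue F) (\<Union>i\<in>I. X i)"
    using assms by (intro mass_emeasure sets.countable_UN') auto
  also have "\<dots> = (\<integral>\<^sup>+i. emeasure (density lebesgue F) (X i) \<partial>count_space I)"
    using assms by (intro emeasure_UN_countable) auto
  also have "\<dots> = (\<integral>\<^sup>+i. mass F (X i) \<partial>count_space I)"
    using assms by (intro nn_integral_cong) (simp add: mass_emeasure)
  finally show ?thesis .
qed

lemma mass_UN_le:
  assumes [measurable]: "F \<in> borel_measurable lebesgue" and X: "\<And>i. i \<in> I \<Longrightarrow> X i \<in> sets lebesgue" and "countable I"
  shows "mass F (\<Union>i\<in>I. X i) \<le> (\<integral>\<^sup>+i. mass F (X i) \<partial>count_space I)"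
proof -
  have *: "indicator (\<Union>i\<in>I. X i) x \<le> ((\<integral>\<^sup>+ i. indicator (X i) x \<partial>count_space I) :: ennreal)" for x
  proof cases
    assume "x \<in> (\<Union>i\<in>I. X i)"
    then obtain i where i: "i \<in> I" "x \<in> X i" by auto
    have "(1::ennreal) = (\<integral>\<^sup>+ j. indicator {i} j \<partial>count_space I)"
      using i by (subst nn_integral_indicator) auto
    also have "\<dots> \<le> (\<integral>\<^sup>+ i. indicator (X i) x \<partial>count_space I)"
      using i by (intro nn_integral_mono) (auto simp: indicator_def)
    finally show ?thesis by (simp add: indicator_def)
  qed (simp)
  have "mass F (\<Union>i\<in>I. X i) \<le> (\<integral>\<^sup>+x. F x * (\<integral>\<^sup>+ i. indicator (X i) x \<partial>count_space I) \<partial>lebesgue)"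
    unfolding mass_def by (intro nn_integral_mono mult_left_mono *) auto
  also have "\<dots> = (\<integral>\<^sup>+x. (\<integral>\<^sup>+ i. F x * indicator (X i) x \<partial>count_space I) \<partial>lebesgue)"
    by (intro nn_integral_cong) (simp add: nn_integral_cmult)
  also have "\<dots> = (\<integral>\<^sup>+i. mass F (X i) \<partial>count_space I)"
    unfolding mass_def using X assms(3)
    by (subst nn_integral_count_space_nn_integral) auto
  finally show ?thesis .
qed

text \<open>At \<open>y = \<infinity>\<close> both sides are infinite.\<close>
lemma epowr_eq_nn_integral:
  assumes a: "0 < a"
  shows "epowr y a = (\<integral>\<^sup>+l. ennreal (a * l powr (a - 1)) * indicator {l. 0 < l \<and> ennreal l < y} l \<partial>lborel)"
proof -
  have fin: "ennreal (c powr a) = (\<integral>\<^sup>+l. ennreal (a * l powr (a - 1)) * indicator {l. 0 < l \<and> ennreal l < ennreal c} l \<partial>lborel)"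
    if c: "0 \<le> c" for c :: real
  proof -
    have "((\<lambda>x. a * x powr (a-1)) has_integral (a * (c powr (a - 1 + 1) / (a - 1 + 1)))) {0..c}"
      using a c by (intro has_integral_mult_right has_integral_powr_from_0) auto
    then have "integral\<^sup>N lborel (\<lambda>x. indicator {0..c} x * (a * x powr (a-1))) = a * (c powr (a - 1 + 1) / (a - 1 + 1))"
      using a by (intro nn_integral_has_integral_lebesgue) auto
    moreover have "integral\<^sup>N lborel (\<lambda>x. indicator {0..c} x * (a * x powr (a-1))) =
       (\<integral>\<^sup>+l. ennreal (a * l powr (a - 1)) * indicator {l. 0 < l \<and> ennreal l < ennreal c} l \<partial>lborel)"
      using AE_lborel_singleton[of 0] AE_lborel_singleton[of c]
      by (intro nn_integral_cong_AE) (auto elim!: eventually_mono simp: indicator_def ennreal_less_iff)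
    ultimately show ?thesis using a by simp
  qed
  show ?thesis
  proof (cases y)
    case (real c)
    then show ?thesis using fin[of c] by (simp add: epowr_ennreal)
  next
    case top
    have "ennreal r \<le> (\<integral>\<^sup>+l. ennreal (a * l powr (a - 1)) * indicator {l. 0 < l \<and> ennreal l < y} l \<partial>lborel)" if "0 \<le> r" for r
    proof -
      have "ennreal r = ennreal ((r powr (1/a)) powr a)"
        using a that by (simp add: powr_powr)
      also have "\<dots> \<le> (\<integral>\<^sup>+l. ennreal (a * l powr (a - 1)) * indicator {l. 0 < l \<and> ennreal l < y} l \<partial>lborel)"
        by (subst fin, simp) (intro nn_integral_mono, auto simp: indicator_def top)
      finally show ?thesis .
    qed
    note * = this
    have "(\<integral>\<^sup>+l. ennreal (a * l powr (a - 1)) * indicator {l. 0 < l \<and> ennreal l < y} l \<partial>lborel) = top" (is "?I = top")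
    proof (cases ?I)
      case (real r)
      then show ?thesis using *[of "r + 1"] by simp
    qed
    then show ?thesis using top by simp
  qed
qed

text \<open>Insert the integral representation of the power and exchange the integrals. The weight
  is a function, so that the formula can also be read backwards with a density such as
  \<open>F x * v x\<close>.\<close>

lemma layer_cake:
  fixes V G :: "'a::euclidean_space \<Rightarrow> ennreal"
  assumes [measurable]: "V \<in> borel_measurable lebesgue" "G \<in> borel_measurable lebesgue" and a: "0 < a"
  shows "(\<integral>\<^sup>+x. V x * epowr (G x) a \<partial>lebesgue) =
     (\<integral>\<^sup>+l. ennreal (a * l powr (a - 1)) * indicator {0<..} l * mass V {x. ennreal l < G x} \<partial>lborel)"
proof -
  interpret pair_sigma_finite lebesgue "lborel :: real measure" ..
  have "(\<integral>\<^sup>+x. V x * epowr (G x) a \<partial>lebesgue) =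
    (\<integral>\<^sup>+x. (\<integral>\<^sup>+l. V x * (ennreal (a * l powr (a - 1)) * indicator {l. 0 < l \<and> ennreal l < G x} l) \<partial>lborel) \<partial>lebesgue)"
    using a by (simp add: epowr_eq_nn_integral nn_integral_cmult)
  also have "\<dots> = (\<integral>\<^sup>+l. (\<integral>\<^sup>+x. V x * (ennreal (a * l powr (a - 1)) * indicator {l. 0 < l \<and> ennreal l < G x} l) \<partial>lebesgue) \<partial>lborel)"
    by (intro Fubini'[symmetric]) measurable
  also have "\<dots> = (\<integral>\<^sup>+l. ennreal (a * l powr (a - 1)) * indicator {0<..} l * mass V {x. ennreal l < G x} \<partial>lborel)"
  proof (intro nn_integral_cong)
    fix l
    have "(\<integral>\<^sup>+x. V x * (ennreal (a * l powr (a - 1)) * indicator {l. 0 < l \<and> ennreal l < G x} l) \<partial>lebesgue) =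
       (\<integral>\<^sup>+x. ennreal (a * l powr (a - 1)) * indicator {0<..} l * (V x * indicator {x. ennreal l < G x} x) \<partial>lebesgue)"
      by (intro nn_integral_cong) (auto simp: indicator_def ac_simps)
    also have "\<dots> = ennreal (a * l powr (a - 1)) * indicator {0<..} l * mass V {x. ennreal l < G x}"
      unfolding mass_def by (intro nn_integral_cmult) measurable
    finally show "(\<integral>\<^sup>+x. V x * (ennreal (a * l powr (a - 1)) * indicator {l. 0 < l \<and> ennreal l < G x} l) \<partial>lebesgue) =
      ennreal (a * l powr (a - 1)) * indicator {0<..} l * mass V {x. ennreal l < G x}" .
  qed
  finally show ?thesis .
qed

subsection \<open>Maximal functions for doubling measures\<close>

text \<open>As a simplification rule it turns \<open>emeasure lebesgue\<close> into \<open>emeasure lborel\<close> of a \<open>main_part\<close>.\<close>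
declare emeasure_completion [simp del]

lemma ennreal_le_divide_iff: "0 < B \<Longrightarrow> B < \<infinity> \<Longrightarrow> l \<le> A / B \<longleftrightarrow> l * B \<le> (A::ennreal)"
  by (cases l; cases A; cases B)
     (auto simp: divide_ennreal ennreal_mult'[symmetric] pos_le_divide_eq ennreal_top_mult top_unique ennreal_top_divide)

lemma ennreal_divide_le_iff: "0 < B \<Longrightarrow> B < \<infinity> \<Longrightarrow> A / B \<le> l \<longleftrightarrow> A \<le> l * (B::ennreal)"
  by (cases l; cases A; cases B)
     (auto simp: divide_ennreal ennreal_mult'[symmetric] pos_divide_le_eq ennreal_top_mult top_unique ennreal_top_divide)

section \<open>Cubes and the Vitali covering lemma\<close>

text \<open>Cubes are indexed by corner and side length, so that families of cubes become index sets
  and the side length can be bounded, as the covering lemma demands.\<close>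

definition cb :: "'a::euclidean_space \<times> real \<Rightarrow> 'a set" where
  "cb i = cbox (fst i) (fst i + snd i *\<^sub>R One)"

text \<open>The dilation factor is what the Vitali covering lemma costs, which is about Euclidean balls.\<close>
definition big :: "'a::euclidean_space \<times> real \<Rightarrow> 'a \<times> real" where
  "big i = (fst i - (5 * real DIM('a) * snd i) *\<^sub>R One, 10 * real DIM('a) * snd i)"

lemma cubes_cb: "cubes = {cb i | i. 0 < snd i}"
  unfolding cubes_def cb_def by auto

lemma cb_in_cubes: "0 < snd i \<Longrightarrow> cb i \<in> cubes"
  unfolding cubes_cb by blast

lemma cb_sets [measurable, simp]: "cb i \<in> sets lebesgue"
  by (simp add: cb_def)

lemma cubes_sets: "Q \<in> cubes \<Longrightarrow> Q \<in> sets lebesgue"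
  by (auto simp: cubes_cb)

lemma open_lebesgue: "open S \<Longrightarrow> S \<in> sets lebesgue"
  by (intro sets_completionI_sets) simp

lemma interior_sets [measurable]: "interior Q \<in> sets lebesgue"
  by (simp add: open_lebesgue)

lemma emeasure_cb: "0 \<le> snd i \<Longrightarrow> emeasure lebesgue (cb i :: 'a::euclidean_space set) = ennreal (snd i ^ DIM('a))"
  unfolding cb_def by (simp add: emeasure_completion emeasure_lborel_cbox_eq inner_simps)

lemma emeasure_cubes_pos: "Q \<in> cubes \<Longrightarrow> 0 < emeasure lebesgue Q"
  by (auto simp: cubes_cb emeasure_cb)

lemma emeasure_cubes_finite: "Q \<in> cubes \<Longrightarrow> emeasure lebesgue Q < \<infinity>"
  by (auto simp: cubes_cb emeasure_cb)

text \<open>The maximal function admits a cube only at its interior points; this lemma makes the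
  loss of the boundary harmless in integrals.\<close>

lemma AE_cube_interior: "Q \<in> cubes \<Longrightarrow> AE x in lebesgue. x \<in> Q \<longrightarrow> x \<in> interior Q"
proof -
  assume "Q \<in> cubes"
  then obtain a b where Q: "Q = cbox a b" by (auto simp: cubes_def)
  have "negligible (cbox a b - box a b)"
    by (rule negligible_frontier_interval)
  then have "cbox a b - box a b \<in> null_sets lebesgue"
    by (simp add: negligible_iff_null_sets)
  then show ?thesis
    unfolding Q by (intro AE_I'[of "cbox a b - box a b"]) (auto simp: interior_cbox)
qed

lemma cb_subset_cball: "cb i \<subseteq> cball (fst i) (real DIM('a) * snd i)" for i :: "'a::euclidean_space \<times> real"
proof
  fix x assume x: "x \<in> cb i"
  have "norm (x - fst i) \<le> (\<Sum>b\<in>Basis. \<bar>(x - fst i) \<bullet> b\<bar>)"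
    by (rule norm_le_l1)
  also have "\<dots> \<le> (\<Sum>b\<in>(Basis::'a set). snd i)"
    using x by (intro sum_mono) (auto simp: cb_def mem_box inner_simps abs_le_iff algebra_simps)
  finally show "x \<in> cball (fst i) (real DIM('a) * snd i)"
    by (simp add: dist_norm norm_minus_commute)
qed

lemma cball_subset_big: "cball (fst i) (5 * (real DIM('a) * snd i)) \<subseteq> cb (big i)" for i :: "'a::euclidean_space \<times> real"
proof
  fix x assume x: "x \<in> cball (fst i) (5 * (real DIM('a) * snd i))"
  have "\<bar>(x - fst i) \<bullet> b\<bar> \<le> 5 * real DIM('a) * snd i" if "b \<in> Basis" for b
    using Basis_le_norm[OF that, of "x - fst i"] x by (auto simp: dist_norm norm_minus_commute)
  note * = this
  show "x \<in> cb (big i)"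
    unfolding cb_def mem_box
  proof (intro ballI)
    fix b :: 'a assume b: "b \<in> Basis"
    show "fst (big i) \<bullet> b \<le> x \<bullet> b \<and> x \<bullet> b \<le> (fst (big i) + snd (big i) *\<^sub>R One) \<bullet> b"
      using *[OF b] b by (simp add: big_def inner_simps abs_le_iff algebra_simps)
  qed
qed

lemma cb_subset_big: "0 < snd i \<Longrightarrow> cb i \<subseteq> cb (big i)" for i :: "'a::euclidean_space \<times> real"
  by (rule order_trans[OF cb_subset_cball order_trans[OF subset_cball cball_subset_big]]) auto

lemma snd_big: "0 < snd i \<Longrightarrow> 0 < snd (big i)" for i :: "'a::euclidean_space \<times> real"
  by (simp add: big_def)

lemma emeasure_big: "0 < snd i \<Longrightarrow> emeasure lebesgue (cb (big i)) = ennreal ((10 * real DIM('a)) ^ DIM('a)) * emeasure lebesgue (cb i)"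
  for i :: "'a::euclidean_space \<times> real"
  by (subst (1 2) emeasure_cb) (auto simp: big_def power_mult_distrib ennreal_mult'[symmetric])

text \<open>Each cube lies in a ball around its corner. Disjoint balls contain disjoint cubes, and
  the balls of five times the radius lie in the cubes given by \<open>big\<close>.\<close>

lemma Vitali_cubes:
  fixes K :: "('a::euclidean_space \<times> real) set"
  assumes "\<And>i. i \<in> K \<Longrightarrow> 0 < snd i \<and> snd i \<le> B"
  obtains C where "countable C" "C \<subseteq> K" "disjoint_family_on cb C" "(\<Union>i\<in>K. cb i) \<subseteq> (\<Union>i\<in>C. cb (big i))"
proof -
  have 1: "0 < real DIM('a) * snd i \<and> real DIM('a) * snd i \<le> real DIM('a) * B" if "i \<in> K" for i
    using assms[OF that] by auto
  have 2: "(\<Union>i\<in>K. cb i) \<subseteq> (\<Union>i\<in>K. cball (fst i) (real DIM('a) * snd i))"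
    by (intro UN_mono cb_subset_cball order_refl)
  obtain C where C: "countable C" "C \<subseteq> K"
     "pairwise (\<lambda>i j. disjnt (cball (fst i) (real DIM('a) * snd i)) (cball (fst j) (real DIM('a) * snd j))) C"
     "(\<Union>i\<in>K. cb i) \<subseteq> (\<Union>i\<in>C. cball (fst i) (5 * (real DIM('a) * snd i)))"
    by (rule Vitali_covering_lemma_cballs[OF 2 1])
  have "disjoint_family_on cb C"
    unfolding disjoint_family_on_def
  proof (intro ballI impI)
    fix m n assume "m \<in> C" "n \<in> C" "m \<noteq> n"
    then have "disjnt (cball (fst m) (real DIM('a) * snd m)) (cball (fst n) (real DIM('a) * snd n))"
      using C(3) by (simp add: pairwise_def)
    then show "cb m \<inter> cb n = {}"
      using cb_subset_cball[of m] cb_subset_cball[of n] unfolding disjnt_def by blast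
  qed
  moreover have "(\<Union>i\<in>K. cb i) \<subseteq> (\<Union>i\<in>C. cb (big i))"
    by (rule order_trans[OF C(4)]) (intro UN_mono cball_subset_big order_refl)
  ultimately show ?thesis using that C by blast
qed

section \<open>Doubling densities and their maximal operators\<close>

text \<open>The dilation is \<open>big\<close> rather than a factor 2, so that \<open>D\<close> is
  directly the loss in a covering argument. Positive finite masses of cubes make the averages in
  \<open>maxop\<close> behave like real quotients.\<close>

definition doubling :: "real \<Rightarrow> ('a::euclidean_space \<Rightarrow> ennreal) \<Rightarrow> bool" where
  "doubling D v \<longleftrightarrow> v \<in> borel_measurable lebesgue \<and> (\<forall>Q\<in>cubes. 0 < mass v Q \<and> mass v Q < \<infinity>) \<and>
     (\<forall>i. 0 < snd i \<longrightarrow> mass v (cb (big i)) \<le> ennreal D * mass v (cb i))"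

text \<open>The case of Lebesgue measure is what the differentiation argument in
  \<open>AE_cube_average_gt\<close> uses.\<close>

lemma doubling_1: "doubling ((10 * real DIM('a)) ^ DIM('a)) (\<lambda>x::'a::euclidean_space. 1)"
  unfolding doubling_def
  by (auto simp: mass_1 emeasure_cubes_pos emeasure_cubes_finite[simplified] cubes_sets emeasure_big)

lemma doubling_cover:
  fixes K :: "('a::euclidean_space \<times> real) set"
  assumes v: "doubling D v" and K: "\<And>i. i \<in> K \<Longrightarrow> 0 < snd i \<and> snd i \<le> B" and S: "S \<subseteq> (\<Union>i\<in>K. cb i)"
  obtains C where "countable C" "C \<subseteq> K" "disjoint_family_on cb C"
    "mass v S \<le> ennreal D * (\<integral>\<^sup>+i. mass v (cb i) \<partial>count_space C)"
proof -
  obtain C where C: "countable C" "C \<subseteq> K" "disjoint_family_on cb C" "(\<Union>i\<in>K. cb i) \<subseteq> (\<Union>i\<in>C. cb (big i))"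
    using Vitali_cubes[OF K] by metis
  have [measurable]: "v \<in> borel_measurable lebesgue" using v by (simp add: doubling_def)
  have "mass v S \<le> mass v (\<Union>i\<in>C. cb (big i))"
    using S C by (intro mass_mono_set) auto
  also have "\<dots> \<le> (\<integral>\<^sup>+i. mass v (cb (big i)) \<partial>count_space C)"
    using C by (intro mass_UN_le) auto
  also have "\<dots> \<le> (\<integral>\<^sup>+i. ennreal D * mass v (cb i) \<partial>count_space C)"
    using v K C(2) by (intro nn_integral_mono) (auto simp: doubling_def)
  also have "\<dots> = ennreal D * (\<integral>\<^sup>+i. mass v (cb i) \<partial>count_space C)"
    by (intro nn_integral_cmult) simp
  finally show ?thesis using that C by blast
qed

text \<open>The uncentred maximal function with respect to the measure with density
  \<open>v\<close>. Because \<open>x\<close> has to be interior to the cube, superlevel sets are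
  unions of open sets, hence measurable.\<close>

definition maxop :: "('a::euclidean_space \<Rightarrow> ennreal) \<Rightarrow> ('a \<Rightarrow> ennreal) \<Rightarrow> 'a \<Rightarrow> ennreal" where
  "maxop v F x = (SUP Q\<in>{Q\<in>cubes. x \<in> interior Q}. mass (\<lambda>x. F x * v x) Q / mass v Q)"

lemma maxop_ge: "Q \<in> cubes \<Longrightarrow> x \<in> interior Q \<Longrightarrow> mass (\<lambda>x. F x * v x) Q / mass v Q \<le> maxop v F x"
  unfolding maxop_def by (intro SUP_upper) auto

lemma maxop_superlevel:
  "{x. l < maxop v F x} = (\<Union>Q\<in>{Q\<in>cubes. l < mass (\<lambda>x. F x * v x) Q / mass v Q}. interior Q)"
  by (auto simp: maxop_def less_SUP_iff)

lemma measurable_maxop [measurable]: "maxop v F \<in> borel_measurable lebesgue"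
proof -
  have "open {x. l < maxop v F x}" for l
    unfolding maxop_superlevel by auto
  then show ?thesis
    by (intro borel_measurableI_greater) (auto simp: open_lebesgue)
qed

text \<open>The average of a constant is that constant. This plays the part of the bound at the
  exponent infinity in the interpolation.\<close>

lemma maxop_le_add_const:
  assumes v: "doubling D v" and [measurable]: "G \<in> borel_measurable lebesgue" and FG: "\<And>x. F x \<le> G x + c"
  shows "maxop v F x \<le> maxop v G x + c"
  unfolding maxop_def
proof (intro SUP_least)
  fix Q assume Q: "Q \<in> {Q \<in> cubes. x \<in> interior Q}"
  have [measurable]: "v \<in> borel_measurable lebesgue" "Q \<in> sets lebesgue"
    and Qv: "0 < mass v Q" "mass v Q < \<infinity>"
    using v Q by (auto simp: doubling_def cubes_sets)
  have "mass (\<lambda>x. F x * v x) Q \<le> mass (\<lambda>x. G x * v x + c * v x) Q"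
    using FG by (intro mass_mono_AE) (auto simp: distrib_right[symmetric] intro!: mult_right_mono AE_I2)
  also have "\<dots> = mass (\<lambda>x. G x * v x) Q + c * mass v Q"
    by (subst mass_add) (auto simp: mass_cmult)
  also have "\<dots> \<le> (mass (\<lambda>x. G x * v x) Q / mass v Q + c) * mass v Q"
    using Qv ennreal_le_divide_iff[OF Qv, of "mass (\<lambda>x. G x * v x) Q / mass v Q" "mass (\<lambda>x. G x * v x) Q"]
    using ennreal_divide_le_iff[OF Qv, of "mass (\<lambda>x. G x * v x) Q" "mass (\<lambda>x. G x * v x) Q / mass v Q"]
    by (simp add: distrib_right)
  finally have "mass (\<lambda>x. F x * v x) Q / mass v Q \<le> mass (\<lambda>x. G x * v x) Q / mass v Q + c"
    by (subst ennreal_divide_le_iff[OF Qv])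
  also have "\<dots> \<le> (SUP Q\<in>{Q \<in> cubes. x \<in> interior Q}. mass (\<lambda>x. G x * v x) Q / mass v Q) + c"
    using Q by (intro add_right_mono SUP_upper)
  finally show "mass (\<lambda>x. F x * v x) Q / mass v Q \<le> (SUP Q\<in>{Q \<in> cubes. x \<in> interior Q}. mass (\<lambda>x. G x * v x) Q / mass v Q) + c" .
qed

text \<open>Select disjoint cubes among those with average above \<open>l\<close>; the doubling
  constant pays for the rest. The covering lemma needs bounded side lengths, so the superlevel set
  is exhausted by the sets \<open>\<Omega> n\<close> that come from cubes of side at most
  \<open>n\<close>.\<close>

lemma maxop_weak_type:
  assumes v: "doubling D v" and F: "F \<in> borel_measurable lebesgue"
  shows "l * mass v {x. l < maxop v F x} \<le> ennreal D * mass (\<lambda>x. F x * v x) UNIV"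
proof -
  have [measurable]: "v \<in> borel_measurable lebesgue" "F \<in> borel_measurable lebesgue"
    using v F by (auto simp: doubling_def)
  define K where "K n = {i. 0 < snd i \<and> snd i \<le> real n \<and> l < mass (\<lambda>x. F x * v x) (cb i) / mass v (cb i)}" for n
  define \<Omega> where "\<Omega> n = (\<Union>i\<in>K n. interior (cb i))" for n
  have un: "{x. l < maxop v F x} = (\<Union>n. \<Omega> n)"
  proof -
    have K: "\<exists>n. i \<in> K n" if "0 < snd i" "l < mass (\<lambda>x. F x * v x) (cb i) / mass v (cb i)" for i
      using that real_arch_simple[of "snd i"] by (auto simp: K_def)
    show ?thesis
      unfolding maxop_superlevel
    proof (intro equalityI UN_least)
      fix Q assume "Q \<in> {Q \<in> cubes. l < mass (\<lambda>x. F x * v x) Q / mass v Q}"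
      then obtain i where i: "0 < snd i" "Q = cb i" "l < mass (\<lambda>x. F x * v x) (cb i) / mass v (cb i)"
        unfolding cubes_cb by blast
      with K[OF i(1,3)] show "interior Q \<subseteq> (\<Union>n. \<Omega> n)"
        unfolding \<Omega>_def by auto
    next
      fix n
      show "\<Omega> n \<subseteq> (\<Union>Q\<in>{Q\<in>cubes. l < mass (\<lambda>x. F x * v x) Q / mass v Q}. interior Q)"
        unfolding \<Omega>_def by (intro UN_least UN_upper) (auto simp: K_def cb_in_cubes)
    qed
  qed
  have inc: "incseq \<Omega>"
    unfolding \<Omega>_def K_def by (intro monoI) fastforce
  have ms: "\<Omega> n \<in> sets lebesgue" for n
    unfolding \<Omega>_def by (intro open_lebesgue open_UN) auto
  have le: "l * mass v (\<Omega> n) \<le> ennreal D * mass (\<lambda>x. F x * v x) UNIV" for n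
  proof -
    obtain C where C: "countable C" "C \<subseteq> K n" "disjoint_family_on cb C"
       "mass v (\<Omega> n) \<le> ennreal D * (\<integral>\<^sup>+i. mass v (cb i) \<partial>count_space C)"
    proof (rule doubling_cover[OF v])
      show "\<And>i. i \<in> K n \<Longrightarrow> 0 < snd i \<and> snd i \<le> real n" by (auto simp: K_def)
      show "\<Omega> n \<subseteq> (\<Union>i\<in>K n. cb i)" unfolding \<Omega>_def by (intro UN_mono interior_subset order_refl)
    qed blast
    have "l * mass v (\<Omega> n) \<le> l * (ennreal D * (\<integral>\<^sup>+i. mass v (cb i) \<partial>count_space C))"
      using C by (intro mult_left_mono) auto
    also have "\<dots> = ennreal D * (\<integral>\<^sup>+i. l * mass v (cb i) \<partial>count_space C)"
      by (subst nn_integral_cmult) (auto simp: ac_simps)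
    also have "\<dots> \<le> ennreal D * (\<integral>\<^sup>+i. mass (\<lambda>x. F x * v x) (cb i) \<partial>count_space C)"
    proof (intro mult_left_mono nn_integral_mono)
      fix i assume "i \<in> space (count_space C)"
      then have i: "i \<in> K n" using C by auto
      then have "cb i \<in> cubes" by (auto simp: K_def cb_in_cubes)
      then have "0 < mass v (cb i)" "mass v (cb i) < \<infinity>" using v by (auto simp: doubling_def)
      note * = ennreal_le_divide_iff[OF this, of l "mass (\<lambda>x. F x * v x) (cb i)"]
      have "l \<le> mass (\<lambda>x. F x * v x) (cb i) / mass v (cb i)"
        using i unfolding K_def mem_Collect_eq by (blast intro: less_imp_le)
      then show "l * mass v (cb i) \<le> mass (\<lambda>x. F x * v x) (cb i)"
        unfolding * .
    qed simp
    also have "(\<integral>\<^sup>+i. mass (\<lambda>x. F x * v x) (cb i) \<partial>count_space C) = mass (\<lambda>x. F x * v x) (\<Union>i\<in>C. cb i)"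
      using C by (intro mass_UN_countable[symmetric]) auto
    also have "ennreal D * \<dots> \<le> ennreal D * mass (\<lambda>x. F x * v x) UNIV"
      by (intro mult_left_mono mass_mono_set) auto
    finally show ?thesis .
  qed
  have "mass v {x. l < maxop v F x} = (SUP n. mass v (\<Omega> n))"
    unfolding un using ms inc by (simp add: mass_emeasure SUP_emeasure_incseq image_subset_iff sets.countable_UN)
  then have "l * mass v {x. l < maxop v F x} = (SUP n. l * mass v (\<Omega> n))"
    by (simp add: SUP_mult_left_ennreal)
  also have "\<dots> \<le> ennreal D * mass (\<lambda>x. F x * v x) UNIV"
    by (intro SUP_least le)
  finally show ?thesis .
qed

text \<open>The part of \<open>F\<close> below height \<open>l\<close> adds at most \<open>l\<close>
  to the maximal function, so only the part above \<open>l\<close> enters the weak type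
  bound.\<close>

lemma maxop_weak_type_level:
  assumes v: "doubling D v" and [measurable]: "F \<in> borel_measurable lebesgue"
  shows "l * mass v {x. 2 * l < maxop v F x} \<le> ennreal D * mass (\<lambda>x. F x * v x) {x. l < F x}"
proof -
  define G where "G x = F x * indicator {x. l < F x} x" for x
  have [measurable]: "G \<in> borel_measurable lebesgue" unfolding G_def by measurable
  have "maxop v F x \<le> maxop v G x + l" for x
    using v by (rule maxop_le_add_const) (auto simp: G_def indicator_def)
  then have "{x. 2 * l < maxop v F x} \<subseteq> {x. l < maxop v G x}"
    by (auto simp: mult_2 ) (meson add_right_mono leD leI order.strict_trans2)
  then have "l * mass v {x. 2 * l < maxop v F x} \<le> l * mass v {x. l < maxop v G x}"
    by (intro mult_left_mono mass_mono_set) auto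
  also have "\<dots> \<le> ennreal D * mass (\<lambda>x. G x * v x) UNIV"
    by (rule maxop_weak_type[OF v]) measurable
  also have "mass (\<lambda>x. G x * v x) UNIV = mass (\<lambda>x. F x * v x) {x. l < F x}"
    unfolding mass_def G_def by (intro nn_integral_cong) (auto simp: indicator_def)
  finally show ?thesis .
qed

lemma measurable_mass_level:
  fixes V G :: "'a::euclidean_space \<Rightarrow> ennreal"
  assumes [measurable]: "V \<in> borel_measurable lebesgue" "G \<in> borel_measurable lebesgue"
  shows "(\<lambda>l. mass V {x. ennreal l < G x}) \<in> borel_measurable borel"
proof -
  have "(\<lambda>(l, x). if ennreal l < G x then V x else 0) \<in> borel_measurable (borel \<Otimes>\<^sub>M lebesgue)"
    by measurable
  then have "(\<lambda>l. \<integral>\<^sup>+x. (if ennreal l < G x then V x else 0) \<partial>lebesgue) \<in> borel_measurable borel"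
    by (intro lebesgue.borel_measurable_nn_integral) simp
  also have "(\<lambda>l. \<integral>\<^sup>+x. (if ennreal l < G x then V x else 0) \<partial>lebesgue) = (\<lambda>l. mass V {x. ennreal l < G x})"
    unfolding mass_def by (intro ext nn_integral_cong) (simp add: indicator_def)
  finally show ?thesis .
qed

text \<open>Marcinkiewicz interpolation: the layer cake formula turns the norm into an integral over
  levels, \<open>maxop_weak_type_level\<close> is applied at each level, and the formula is read
  backwards with density \<open>F x * v x\<close> and exponent \<open>q - 1\<close>.\<close>

theorem maxop_strong_type:
  assumes v: "doubling D v" and q: "1 < q"
  obtains C where "0 < C" "\<And>F. F \<in> borel_measurable lebesgue \<Longrightarrow>
     moment v q (maxop v F) \<le> ennreal C * moment v q F"
proof -
  define E where "E = max D 1"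
  have E: "doubling E v" "0 < E"
    using v unfolding doubling_def E_def
    by (auto intro: order_trans mult_right_mono ennreal_leI) (meson max.cobounded1 ennreal_leI mult_right_mono order_trans zero_le)
  have [measurable]: "v \<in> borel_measurable lebesgue" using v by (auto simp: doubling_def)
  \<comment> \<open>The power of 2 comes from halving the maximal function, \<open>E\<close> from
    the weak type bound, and \<open>q / (q - 1)\<close> is the ratio of the factors in the two layer
    cake formulas.\<close>
  define C where "C = 2 powr q * (E * q / (q - 1))"
  have half: "ennreal 2 * (ennreal (1/2) * y) = y" for y
    by (subst mult.assoc[symmetric], subst ennreal_mult'[symmetric]) auto
  have "moment v q (maxop v F) \<le> ennreal C * moment v q F"
    if F[measurable]: "F \<in> borel_measurable lebesgue" for F
  proof -
    have [measurable]: "(\<lambda>l. mass (\<lambda>x. F x * v x) {x. ennreal l < F x}) \<in> borel_measurable borel"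
      by (rule measurable_mass_level[of "\<lambda>x. F x * v x" F]) measurable
    have H: "(\<lambda>l. ennreal ((q - 1) * l powr (q - 1 - 1)) * indicator {0<..} l * mass (\<lambda>x. F x * v x) {x. ennreal l < F x}) \<in> borel_measurable lborel"
      by measurable
    have "moment v q (maxop v F) =
        (\<integral>\<^sup>+x. ennreal (2 powr q) * (v x * epowr (ennreal (1/2) * maxop v F x) q) \<partial>lebesgue)"
    proof (intro nn_integral_cong)
      fix x
      have "epowr (maxop v F x) q = epowr (ennreal 2 * (ennreal (1/2) * maxop v F x)) q"
        by (simp only: half)
      also have "\<dots> = ennreal (2 powr q) * epowr (ennreal (1/2) * maxop v F x) q"
        using q by (subst epowr_mult) (auto simp: epowr_ennreal simp del: ennreal_numeral)
      finally show "v x * epowr (maxop v F x) q = ennreal (2 powr q) * (v x * epowr (ennreal (1/2) * maxop v F x) q)"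
        by (simp add: ac_simps)
    qed
    also have "\<dots> = ennreal (2 powr q) * moment v q (\<lambda>x. ennreal (1/2) * maxop v F x)"
      by (intro nn_integral_cmult) measurable
    finally have 1: "moment v q (maxop v F) = \<dots>" .
    have "moment v q (\<lambda>x. ennreal (1/2) * maxop v F x) =
      (\<integral>\<^sup>+l. ennreal (q * l powr (q - 1)) * indicator {0<..} l * mass v {x. ennreal l < ennreal (1/2) * maxop v F x} \<partial>lborel)"
      using q by (intro layer_cake) auto
    also have "\<dots> \<le> (\<integral>\<^sup>+l. ennreal (E * q / (q - 1)) * (ennreal ((q - 1) * l powr (q - 1 - 1)) * indicator {0<..} l * mass (\<lambda>x. F x * v x) {x. ennreal l < F x}) \<partial>lborel)"
    proof (intro nn_integral_mono)
      fix l :: real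
      show "ennreal (q * l powr (q - 1)) * indicator {0<..} l * mass v {x. ennreal l < ennreal (1/2) * maxop v F x} \<le>
         ennreal (E * q / (q - 1)) * (ennreal ((q - 1) * l powr (q - 1 - 1)) * indicator {0<..} l * mass (\<lambda>x. F x * v x) {x. ennreal l < F x})"
      proof (cases "0 < l")
        case True
        have sub: "{x. ennreal l < ennreal (1/2) * maxop v F x} \<subseteq> {x. 2 * ennreal l < maxop v F x}"
        proof safe
          fix x assume "ennreal l < ennreal (1/2) * maxop v F x"
          then have "ennreal 2 * ennreal l < ennreal 2 * (ennreal (1/2) * maxop v F x)"
            by (intro ennreal_mult_strict_left_mono) auto
          then show "2 * ennreal l < maxop v F x"
            unfolding half by simp
        qed
        have "ennreal (q * l powr (q - 1)) * mass v {x. ennreal l < ennreal (1/2) * maxop v F x} =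
           ennreal (q * l powr (q - 1 - 1)) * (ennreal l * mass v {x. ennreal l < ennreal (1/2) * maxop v F x})"
          using True q by (simp add: mult.assoc[symmetric] ennreal_mult'[symmetric] powr_diff power2_eq_square)
        also have "\<dots> \<le> ennreal (q * l powr (q - 1 - 1)) * (ennreal l * mass v {x. 2 * ennreal l < maxop v F x})"
          by (intro mult_left_mono mass_mono_set sub) auto
        also have "\<dots> \<le> ennreal (q * l powr (q - 1 - 1)) * (ennreal E * mass (\<lambda>x. F x * v x) {x. ennreal l < F x})"
          by (intro mult_left_mono maxop_weak_type_level E) auto
        also have "\<dots> = ennreal (E * q / (q - 1)) * (ennreal ((q - 1) * l powr (q - 1 - 1)) * mass (\<lambda>x. F x * v x) {x. ennreal l < F x})"
        proof -
          have "q * l powr (q - 1 - 1) * E = E * q / (q - 1) * ((q - 1) * l powr (q - 1 - 1))"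
            using q by simp
          then have "ennreal (q * l powr (q - 1 - 1)) * ennreal E = ennreal (E * q / (q - 1)) * ennreal ((q - 1) * l powr (q - 1 - 1))"
            using q E by (simp only: ennreal_mult[symmetric] powr_ge_zero mult_nonneg_nonneg divide_nonneg_nonneg less_imp_le diff_ge_0_iff_ge less_trans[OF zero_less_one])
          then show ?thesis by (simp only: mult.assoc[symmetric])
        qed
        finally show ?thesis using True by simp
      qed simp
    qed
    also have "\<dots> = ennreal (E * q / (q - 1)) * (\<integral>\<^sup>+l. ennreal ((q - 1) * l powr (q - 1 - 1)) * indicator {0<..} l * mass (\<lambda>x. F x * v x) {x. ennreal l < F x} \<partial>lborel)"
      by (rule nn_integral_cmult[OF H])
    finally have 2: "moment v q (\<lambda>x. ennreal (1/2) * maxop v F x) \<le> \<dots>" .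
    have "(\<integral>\<^sup>+l. ennreal ((q - 1) * l powr (q - 1 - 1)) * indicator {0<..} l * mass (\<lambda>x. F x * v x) {x. ennreal l < F x} \<partial>lborel) =
       (\<integral>\<^sup>+x. (F x * v x) * epowr (F x) (q - 1) \<partial>lebesgue)"
      using q by (intro layer_cake[symmetric]) auto
    also have "\<dots> = moment v q F"
    proof (intro nn_integral_cong)
      fix x
      have "F x * epowr (F x) (q - 1) = epowr (F x) q"
        using epowr_add[of "F x" 1 "q - 1"] by simp
      then show "F x * v x * epowr (F x) (q - 1) = v x * epowr (F x) q"
        by (metis mult.assoc mult.commute)
    qed
    finally have "moment v q (\<lambda>x. ennreal (1/2) * maxop v F x) \<le>
        ennreal (E * q / (q - 1)) * moment v q F"
      using 2 by (simp only:)
    then show ?thesis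
      unfolding 1 C_def using q E by (subst ennreal_mult) (auto simp: mult.assoc intro: mult_left_mono)
  qed
  moreover have "0 < C" using q E by (simp add: C_def)
  ultimately show ?thesis using that by blast
qed

subsection \<open>Muckenhoupt's theorem\<close>

lemma ennreal_mult_le_cancel: "a * c \<le> b * c \<Longrightarrow> 0 < c \<Longrightarrow> c < \<infinity> \<Longrightarrow> a \<le> (b::ennreal)"
  using ennreal_mult_strict_right_mono[of b a c] by (auto simp: not_le[symmetric])

section \<open>Muckenhoupt weights together with their dual weights\<close>

text \<open>\<open>S\<close> is a version of the dual weight, the power \<open>- 1 / (p - 1)\<close>
  of \<open>W\<close>. It is a separate parameter tied to \<open>W\<close> almost everywhere, so
  that the two can change roles, and the \<open>A\<^sub>p\<close> condition is written without
  quotients.\<close>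

definition Ap_pair :: "real \<Rightarrow> real \<Rightarrow> ('a::euclidean_space \<Rightarrow> ennreal) \<Rightarrow> ('a \<Rightarrow> ennreal) \<Rightarrow> bool" where
  "Ap_pair p K W S \<longleftrightarrow> 1 < p \<and> 0 < K \<and> W \<in> borel_measurable lebesgue \<and> S \<in> borel_measurable lebesgue \<and>
     (AE x in lebesgue. W x * epowr (S x) (p - 1) = 1) \<and>
     (\<forall>Q\<in>cubes. mass W Q < \<infinity> \<and> mass S Q < \<infinity> \<and>
        mass W Q * epowr (mass S Q) (p - 1) \<le> ennreal K * epowr (emeasure lebesgue Q) p)"

lemma mass_cubes_pos:
  assumes Q: "Q \<in> cubes" and [measurable]: "F \<in> borel_measurable lebesgue" and F: "AE x in lebesgue. 0 < F x"
  shows "0 < mass F Q"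
proof (rule ccontr)
  have [measurable]: "Q \<in> sets lebesgue" using Q by (rule cubes_sets)
  assume "\<not> 0 < mass F Q"
  then have "AE x in lebesgue. F x * indicator Q x = 0"
    unfolding mass_def by (subst (asm) zero_less_iff_neq_zero) (simp add: nn_integral_0_iff_AE)
  with F have "AE x in lebesgue. x \<notin> Q"
    by eventually_elim (auto simp: indicator_def)
  then have "emeasure lebesgue Q = 0"
    by (subst AE_iff_measurable[symmetric, where P="\<lambda>x. x \<notin> Q"]) auto
  with emeasure_cubes_pos[OF Q] show False by simp
qed

context
  fixes p K and W S :: "'a::euclidean_space \<Rightarrow> ennreal"
  assumes ap: "Ap_pair p K W S"
begin

lemma Ap_pair_measurable: "W \<in> borel_measurable lebesgue" "S \<in> borel_measurable lebesgue"
  and Ap_pair_p: "1 < p" and Ap_pair_K: "0 < K"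
  and Ap_pair_AE: "AE x in lebesgue. W x * epowr (S x) (p - 1) = 1"
  and Ap_pair_finite: "Q \<in> cubes \<Longrightarrow> mass W Q < \<infinity>" "Q \<in> cubes \<Longrightarrow> mass S Q < \<infinity>"
  and Ap_pair_le: "Q \<in> cubes \<Longrightarrow> mass W Q * epowr (mass S Q) (p - 1) \<le> ennreal K * epowr (emeasure lebesgue Q) p"
  using ap by (auto simp: Ap_pair_def)

lemma Ap_pair_AE_pos: "AE x in lebesgue. 0 < W x \<and> W x < \<infinity> \<and> 0 < S x \<and> S x < \<infinity>"
  using Ap_pair_AE
proof eventually_elim
  case (elim x)
  then have 0: "W x \<noteq> 0" "S x \<noteq> 0" by auto
  then have "W x \<noteq> top" "S x \<noteq> top" using elim by (auto simp: ennreal_top_mult ennreal_mult_top)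
  with 0 show ?case by (simp add: zero_less_iff_neq_zero less_top[symmetric])
qed

lemma Ap_pair_AE_dual: "AE x in lebesgue. S x * epowr (W x) (1 / (p - 1)) = 1"
  using Ap_pair_AE
proof eventually_elim
  case (elim x)
  then have "epowr (W x * epowr (S x) (p - 1)) (1 / (p - 1)) = 1" by simp
  then show ?case using Ap_pair_p
    by (subst (asm) epowr_mult) (auto simp: epowr_epowr mult.commute)
qed

lemma Ap_pair_pos: "Q \<in> cubes \<Longrightarrow> 0 < mass W Q" "Q \<in> cubes \<Longrightarrow> 0 < mass S Q"
  using Ap_pair_AE_pos Ap_pair_measurable by (auto intro!: mass_cubes_pos elim: eventually_mono)

text \<open>Raise the condition to the power \<open>1 / (p - 1)\<close>, which is the conjugate
  exponent minus 1.\<close>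

lemma Ap_pair_dual: "Ap_pair (p / (p - 1)) (K powr (1 / (p - 1))) S W"
proof -
  have p: "1 < p" by (rule Ap_pair_p)
  have p': "p / (p - 1) - 1 = 1 / (p - 1)" "1 < p / (p - 1)"
    using p by (auto simp: field_simps)
  have "mass S Q * epowr (mass W Q) (1 / (p - 1)) \<le> ennreal (K powr (1 / (p - 1))) * epowr (emeasure lebesgue Q) (p / (p - 1))"
    if Q: "Q \<in> cubes" for Q
  proof -
    have "epowr (mass W Q * epowr (mass S Q) (p - 1)) (1 / (p - 1)) \<le> epowr (ennreal K * epowr (emeasure lebesgue Q) p) (1 / (p - 1))"
      using p by (intro epowr_mono Ap_pair_le Q) auto
    then show ?thesis
      using p Ap_pair_K by (simp add: epowr_mult epowr_epowr epowr_ennreal mult.commute)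
  qed
  then show ?thesis
    using p Ap_pair_K Ap_pair_finite Ap_pair_AE_dual Ap_pair_measurable unfolding Ap_pair_def p' by (auto intro: p'(2))
qed

text \<open>Hoelder's inequality for the factorization of 1 into \<open>epowr (W x) (1 / p)\<close>
  and \<open>epowr (S x) (1 - 1 / p)\<close>.\<close>

lemma Ap_pair_Holder:
  assumes [measurable]: "E \<in> sets lebesgue"
  shows "epowr (emeasure lebesgue E) p \<le> mass W E * epowr (mass S E) (p - 1)"
proof -
  note [measurable] = Ap_pair_measurable
  have p: "1 < p" by (rule Ap_pair_p)
  have "emeasure lebesgue E = (\<integral>\<^sup>+x. indicator E x \<partial>lebesgue)" by simp
  also have "\<dots> = (\<integral>\<^sup>+x. epowr (W x * indicator E x) (1 / p) * epowr (S x * indicator E x) (1 - 1 / p) \<partial>lebesgue)"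
  proof (rule nn_integral_cong_AE)
    show "AE x in lebesgue. indicator E x = epowr (W x * indicator E x) (1 / p) * epowr (S x * indicator E x) (1 - 1 / p)"
      using Ap_pair_AE
    proof eventually_elim
      case (elim x)
      then have "epowr (W x * epowr (S x) (p - 1)) (1 / p) = 1" by simp
      then have "epowr (W x) (1 / p) * epowr (S x) (1 - 1 / p) = 1"
        using p by (subst (asm) epowr_mult) (auto simp: epowr_epowr diff_divide_distrib)
      then show ?case by (auto simp: indicator_def)
    qed
  qed
  also have "\<dots> \<le> epowr (mass W E) (1 / p) * epowr (mass S E) (1 - 1 / p)"
    unfolding mass_def using p by (intro nn_integral_Holder) auto
  finally have "epowr (emeasure lebesgue E) p \<le> epowr (epowr (mass W E) (1 / p) * epowr (mass S E) (1 - 1 / p)) p"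
    using p by (intro epowr_mono) auto
  also have "\<dots> = mass W E * epowr (mass S E) (p - 1)"
    using p by (simp add: epowr_mult epowr_epowr left_diff_distrib)
  finally show ?thesis .
qed

text \<open>Hoelder's inequality on \<open>E\<close> against the \<open>A\<^sub>p\<close> condition
  on \<open>Q\<close>. It gives the doubling property, and it shows in the reverse Hoelder
  inequality that a subset of small \<open>W\<close>-mass has small Lebesgue measure.\<close>

lemma Ap_pair_strong_doubling:
  assumes Q: "Q \<in> cubes" and E: "E \<in> sets lebesgue" "E \<subseteq> Q"
  shows "epowr (emeasure lebesgue E) p * mass W Q \<le> ennreal K * epowr (emeasure lebesgue Q) p * mass W E"
proof -
  have "epowr (emeasure lebesgue E) p * mass W Q \<le> mass W E * epowr (mass S Q) (p - 1) * mass W Q"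
    using Ap_pair_p E
    by (intro mult_right_mono order_trans[OF Ap_pair_Holder] mult_left_mono epowr_mono mass_mono_set) auto
  also have "\<dots> = mass W E * (mass W Q * epowr (mass S Q) (p - 1))"
    by (simp add: ac_simps)
  also have "\<dots> \<le> mass W E * (ennreal K * epowr (emeasure lebesgue Q) p)"
    by (intro mult_left_mono Ap_pair_le Q) simp
  finally show ?thesis by (simp add: ac_simps)
qed

lemma Ap_pair_doubling: "doubling (K * ((10 * real DIM('a)) ^ DIM('a)) powr p) W"
proof -
  define c where "c = (10 * real DIM('a)) ^ DIM('a)"
  then have c: "0 \<le> c" by simp
  have "mass W (cb (big i)) \<le> ennreal (K * c powr p) * mass W (cb i)" if i: "0 < snd i" for i :: "'a \<times> real"
  proof -
    let ?e = "epowr (emeasure lebesgue (cb i)) p"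
    have "?e * mass W (cb (big i)) \<le> ennreal K * epowr (emeasure lebesgue (cb (big i))) p * mass W (cb i)"
      using i by (intro Ap_pair_strong_doubling cb_in_cubes snd_big cb_subset_big) auto
    also have "\<dots> = ennreal (K * c powr p) * mass W (cb i) * ?e"
      unfolding emeasure_big[OF i] c_def[symmetric] using Ap_pair_p Ap_pair_K c
      by (simp add: epowr_mult[of p] epowr_ennreal ennreal_mult ac_simps)
    finally have *: "mass W (cb (big i)) * ?e \<le> ennreal (K * c powr p) * mass W (cb i) * ?e"
      by (simp add: mult.commute)
    show ?thesis
      using emeasure_cubes_pos[OF cb_in_cubes[OF i]] emeasure_cubes_finite[OF cb_in_cubes[OF i]]
      by (intro ennreal_mult_le_cancel[OF *]) (auto simp: zero_less_iff_neq_zero)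
  qed
  then show ?thesis
    using Ap_pair_pos Ap_pair_finite Ap_pair_measurable by (auto simp: doubling_def c_def)
qed

end

lemma Ap_pair_of_Ap:
  fixes w :: "'a::euclidean_space \<Rightarrow> real"
  assumes p: "1 < p" and w: "w \<in> Ap p"
  shows "\<exists>K. Ap_pair p K (\<lambda>x. ennreal (w x)) (\<lambda>x. ennreal (w x powr (- 1 / (p - 1))))"
proof -
  let ?W = "\<lambda>x. ennreal (w x)" and ?S = "\<lambda>x. ennreal (w x powr (- 1 / (p - 1)))"
  have wt: "weight w" and fin: "Ap_const p w < \<infinity>" using w by (auto simp: Ap_def)
  have [measurable]: "w \<in> borel_measurable lebesgue" using wt by (simp add: weight_def)
  have pos: "AE x in lebesgue. 0 < w x" using wt by (simp add: weight_def)
  \<comment> \<open>The maximum with 1 secures \<open>0 < K\<close>.\<close>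
  define K where "K = max 1 (enn2real (Ap_const p w))"
  have "Ap_const p w = ennreal (enn2real (Ap_const p w))" using fin by simp
  also have "\<dots> \<le> ennreal K" by (rule ennreal_leI) (simp add: K_def)
  finally have K: "0 < K" "Ap_const p w \<le> ennreal K" by (simp_all add: K_def)
  have AE: "AE x in lebesgue. ?W x * epowr (?S x) (p - 1) = 1"
    using pos
  proof eventually_elim
    case (elim x)
    then have "w x * (w x powr (- 1 / (p - 1))) powr (p - 1) = 1"
      using p by (simp only: powr_powr) (simp add: powr_minus)
    with elim show ?case
      by (simp add: epowr_ennreal ennreal_mult'[symmetric])
  qed
  have fW: "mass ?W Q < \<infinity>" if "Q \<in> cubes" for Q
    using wt that by (simp add: weight_def mass_def)
  have le: "mass ?W Q / emeasure lebesgue Q * epowr (mass ?S Q / emeasure lebesgue Q) (p - 1) \<le> ennreal K" if Q: "Q \<in> cubes" for Q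
  proof -
    have "avg Q w * epowr (avg Q (\<lambda>x. w x powr (- 1 / (p - 1)))) (p - 1) \<le> Ap_const p w"
      using p Q by (auto simp: Ap_const_def intro: SUP_upper)
    then show ?thesis using K by (simp add: avg_def mass_def)
  qed
  have pW: "0 < mass ?W Q" if "Q \<in> cubes" for Q
    using pos by (intro mass_cubes_pos that) (auto elim: eventually_mono)
  \<comment> \<open>A weight is only assumed to be locally integrable itself. An infinite average of
    the dual weight would make the product infinite, because the average of \<open>w\<close> is
    positive.\<close>
  have fS: "mass ?S Q < \<infinity>" if Q: "Q \<in> cubes" for Q
  proof (rule ccontr)
    assume "\<not> mass ?S Q < \<infinity>"
    then have "mass ?S Q / emeasure lebesgue Q = top"
      using emeasure_cubes_finite[OF Q] by (simp add: less_top[symmetric] ennreal_top_divide)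
    moreover have "mass ?W Q / emeasure lebesgue Q \<noteq> 0"
      using pW[OF Q] emeasure_cubes_finite[OF Q] by auto
    ultimately show False using le[OF Q] by (simp add: ennreal_mult_top top_unique)
  qed
  have "mass ?W Q * epowr (mass ?S Q) (p - 1) \<le> ennreal K * epowr (emeasure lebesgue Q) p" if Q: "Q \<in> cubes" for Q
  proof -
    let ?q = "emeasure lebesgue Q"
    have q: "0 < ?q" "?q < \<infinity>" using emeasure_cubes_pos[OF Q] emeasure_cubes_finite[OF Q] by auto
    have dq: "a / ?q * ?q = a" for a
      using q ennreal_le_divide_iff[OF q, of "a / ?q" a] ennreal_divide_le_iff[OF q, of a "a / ?q"] by (intro antisym) auto
    have "mass ?W Q * epowr (mass ?S Q) (p - 1) = (mass ?W Q / ?q * ?q) * epowr (mass ?S Q / ?q * ?q) (p - 1)"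
      by (simp only: dq)
    also have "\<dots> = (mass ?W Q / ?q * epowr (mass ?S Q / ?q) (p - 1)) * (epowr ?q 1 * epowr ?q (p - 1))"
      using p by (simp add: epowr_mult[of "p - 1"] ac_simps)
    also have "\<dots> \<le> ennreal K * (epowr ?q 1 * epowr ?q (p - 1))"
      by (intro mult_right_mono le Q) simp
    also have "\<dots> = ennreal K * epowr ?q p"
      unfolding epowr_add by simp
    finally show ?thesis .
  qed
  note le' = this
  have "Ap_pair p K ?W ?S"
    unfolding Ap_pair_def using p K by (intro conjI ballI le' fW fS AE) auto
  then show ?thesis ..
qed

text \<open>The dual weight for \<open>r\<close> is a power of \<open>S\<close> with exponent below
  1, so Hoelder's inequality bounds its average by the same power of the average of
  \<open>S\<close>.\<close>

lemma Ap_pair_mono: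
  fixes W S :: "'a::euclidean_space \<Rightarrow> ennreal"
  assumes ap: "Ap_pair p K W S" and r: "p < r"
  shows "Ap_pair r K W (\<lambda>x. epowr (S x) ((p - 1) / (r - 1)))"
proof -
  let ?t = "(p - 1) / (r - 1)" let ?S = "\<lambda>x. epowr (S x) ?t"
  note [measurable] = Ap_pair_measurable[OF ap]
  have p: "1 < p" by (rule Ap_pair_p[OF ap])
  have t: "0 < ?t" "?t < 1" using p r by auto
  have H: "mass ?S Q \<le> epowr (mass S Q) ?t * epowr (emeasure lebesgue Q) (1 - ?t)" if Q: "Q \<in> cubes" for Q
  proof -
    have [measurable]: "Q \<in> sets lebesgue" using Q by (rule cubes_sets)
    have "mass ?S Q = (\<integral>\<^sup>+x. epowr (S x * indicator Q x) ?t * epowr (indicator Q x) (1 - ?t) \<partial>lebesgue)"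
      unfolding mass_def by (intro nn_integral_cong) (auto simp: indicator_def)
    also have "\<dots> \<le> epowr (mass S Q) ?t * epowr (\<integral>\<^sup>+x. indicator Q x \<partial>lebesgue) (1 - ?t)"
      unfolding mass_def using t by (intro nn_integral_Holder) auto
    finally show ?thesis by simp
  qed
  have le: "mass W Q * epowr (mass ?S Q) (r - 1) \<le> ennreal K * epowr (emeasure lebesgue Q) r" if Q: "Q \<in> cubes" for Q
  proof -
    let ?q = "emeasure lebesgue Q"
    have "mass W Q * epowr (mass ?S Q) (r - 1) \<le> mass W Q * epowr (epowr (mass S Q) ?t * epowr ?q (1 - ?t)) (r - 1)"
      using p r by (intro mult_left_mono epowr_mono H Q) auto
    also have "\<dots> = mass W Q * epowr (mass S Q) (p - 1) * epowr ?q (r - p)"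
    proof -
      have "?t * (r - 1) = p - 1" "(1 - ?t) * (r - 1) = r - p"
        using p r by (simp_all add: field_simps)
      then show ?thesis
        using p r by (simp only: epowr_mult[of "r - 1"] epowr_epowr mult.assoc less_trans[OF p r] diff_gt_0_iff_gt)
    qed
    also have "\<dots> \<le> ennreal K * epowr ?q p * epowr ?q (r - p)"
      by (intro mult_right_mono Ap_pair_le[OF ap] Q) simp
    also have "\<dots> = ennreal K * epowr ?q r"
      by (simp add: mult.assoc epowr_add)
    finally show ?thesis .
  qed
  have fin: "mass ?S Q < \<infinity>" if Q: "Q \<in> cubes" for Q
    using Ap_pair_finite[OF ap Q] emeasure_cubes_finite[OF Q]
    by (intro le_less_trans[OF H[OF Q]]) (auto simp: ennreal_mult_less_top)
  have ae: "AE x in lebesgue. W x * epowr (?S x) (r - 1) = 1"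
    using Ap_pair_AE[OF ap] p r by (simp add: epowr_epowr)
  show ?thesis
    unfolding Ap_pair_def using p r Ap_pair_K[OF ap]
    by (intro conjI ballI le fin ae Ap_pair_finite[OF ap]) auto
qed

section \<open>Weighted bounds for the Hardy-Littlewood maximal operator\<close>

abbreviation HL :: "('a::euclidean_space \<Rightarrow> ennreal) \<Rightarrow> 'a \<Rightarrow> ennreal" where
  "HL \<equiv> maxop (\<lambda>x. 1)"

lemma HL_ge: "Q \<in> cubes \<Longrightarrow> x \<in> interior Q \<Longrightarrow> mass F Q \<le> HL F x * emeasure lebesgue Q"
  using maxop_ge[of Q x F "\<lambda>x. 1"] ennreal_divide_le_iff[OF emeasure_cubes_pos[of Q] emeasure_cubes_finite[of Q]]
  by (simp add: mass_1 cubes_sets)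

lemma HL_least:
  "(\<And>Q. Q \<in> cubes \<Longrightarrow> x \<in> interior Q \<Longrightarrow> mass F Q \<le> c * emeasure lebesgue Q) \<Longrightarrow> HL F x \<le> c"
  unfolding maxop_def
  by (intro SUP_least) (auto simp: mass_1 cubes_sets ennreal_divide_le_iff emeasure_cubes_pos emeasure_cubes_finite[simplified])

text \<open>Lerner's pointwise estimate, which reduces Muckenhoupt's theorem to the maximal operators with
  respect to the measures with densities \<open>W\<close> and \<open>S\<close>.\<close>
lemma HL_pointwise:
  fixes W S :: "'a::euclidean_space \<Rightarrow> ennreal"
  assumes ap: "Ap_pair p K W S" and [measurable]: "F \<in> borel_measurable lebesgue"
  defines "G \<equiv> \<lambda>x. F x * epowr (W x) (1 / (p - 1))"
  defines "H \<equiv> \<lambda>x. epowr (maxop S G x) (p - 1) * epowr (S x) (p - 1)"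
  shows "epowr (HL F x) (p - 1) \<le> ennreal K * maxop W H x"
proof -
  note [measurable] = Ap_pair_measurable[OF ap]
  have p: "1 < p" by (rule Ap_pair_p[OF ap])
  have [measurable]: "G \<in> borel_measurable lebesgue" "H \<in> borel_measurable lebesgue"
    unfolding G_def H_def by measurable
  have "HL F x \<le> epowr (ennreal K * maxop W H x) (1 / (p - 1))"
  proof (rule HL_least)
    fix Q :: "'a set" assume Q: "Q \<in> cubes" and x: "x \<in> interior Q"
    let ?q = "emeasure lebesgue Q" and ?A = "mass F Q"
    have [measurable]: "Q \<in> sets lebesgue" using Q by (rule cubes_sets)
    have q: "0 < ?q" "?q < \<infinity>" using emeasure_cubes_pos[OF Q] emeasure_cubes_finite[OF Q] by auto
    have SQ: "0 < mass S Q" "mass S Q < \<infinity>" and WQ: "0 < mass W Q" "mass W Q < \<infinity>"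
      using Ap_pair_pos[OF ap Q] Ap_pair_finite[OF ap Q] by auto
    \<comment> \<open>\<open>B\<close> is the average of \<open>G\<close> over \<open>Q\<close> with
      respect to \<open>S\<close>, since \<open>G x * S x = F x\<close> almost everywhere. It
      therefore bounds \<open>maxop S G\<close> from below on the whole interior of
      \<open>Q\<close>.\<close>
    define B where "B = ?A / mass S Q"
    have A: "?A = B * mass S Q"
      using ennreal_le_divide_iff[OF SQ, of B ?A] ennreal_divide_le_iff[OF SQ, of ?A B]
      by (intro antisym) (auto simp: B_def)
    have "mass (\<lambda>x. G x * S x) Q = ?A"
      using Ap_pair_AE_dual[OF ap] unfolding G_def
      by (intro mass_cong_AE) (auto elim!: eventually_mono simp: mult.assoc mult.commute[of "epowr _ _"])
    then have B: "B \<le> maxop S G y" if "y \<in> interior Q" for y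
      using maxop_ge[OF Q that, of G S] by (simp add: B_def)
    \<comment> \<open>The constant lower bound is integrated over \<open>Q\<close>. Inserting
      \<open>W x * epowr (S x) (p - 1) = 1\<close> turns the Lebesgue integral into one with respect
      to \<open>W\<close>.\<close>
    have "epowr B (p - 1) * ?q = mass (\<lambda>x. epowr B (p - 1)) Q"
      by (simp add: mass_const)
    also have "\<dots> \<le> mass (\<lambda>x. H x * W x) Q"
    proof (rule mass_mono_AE)
      show "AE y in lebesgue. y \<in> Q \<longrightarrow> epowr B (p - 1) \<le> H y * W y"
        using Ap_pair_AE[OF ap] AE_cube_interior[OF Q]
      proof eventually_elim
        case (elim y)
        have "H y * W y = epowr (maxop S G y) (p - 1)"
          using elim(1) by (simp add: H_def mult.assoc mult.commute[of "epowr (S y) _"])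
        moreover have "epowr B (p - 1) \<le> epowr (maxop S G y) (p - 1)" if "y \<in> Q"
          using elim(2) that p by (intro epowr_mono B) auto
        ultimately show ?case by simp
      qed
    qed
    also have "\<dots> \<le> maxop W H x * mass W Q"
      using maxop_ge[OF Q x, of H W] ennreal_divide_le_iff[OF WQ] by simp
    finally have 1: "epowr B (p - 1) * ?q \<le> maxop W H x * mass W Q" .
    have "epowr ?A (p - 1) * ?q = (epowr B (p - 1) * ?q) * epowr (mass S Q) (p - 1)"
      unfolding A using p by (simp add: epowr_mult ac_simps)
    also have "\<dots> \<le> (maxop W H x * mass W Q) * epowr (mass S Q) (p - 1)"
      by (intro mult_right_mono 1) simp
    also have "\<dots> = maxop W H x * (mass W Q * epowr (mass S Q) (p - 1))"
      by (simp add: ac_simps)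
    also have "\<dots> \<le> maxop W H x * (ennreal K * epowr ?q p)"
      by (intro mult_left_mono Ap_pair_le[OF ap] Q) simp
    also have "\<dots> = (ennreal K * maxop W H x) * epowr ?q (p - 1) * ?q"
    proof -
      have "epowr ?q p = epowr ?q (p - 1) * ?q" using epowr_add[of ?q "p - 1" 1] by simp
      then show ?thesis by (simp only: ac_simps)
    qed
    finally have "epowr ?A (p - 1) \<le> (ennreal K * maxop W H x) * epowr ?q (p - 1)"
      by (rule ennreal_mult_le_cancel[OF _ q])
    then have "epowr (epowr ?A (p - 1)) (1 / (p - 1)) \<le> epowr ((ennreal K * maxop W H x) * epowr ?q (p - 1)) (1 / (p - 1))"
      using p by (intro epowr_mono) auto
    also have "\<dots> = epowr (ennreal K * maxop W H x) (1 / (p - 1)) * ?q"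
      using p by (subst epowr_mult) (auto simp: epowr_epowr)
    finally show "?A \<le> epowr (ennreal K * maxop W H x) (1 / (p - 1)) * ?q"
      using p by (simp add: epowr_epowr)
  qed
  then show ?thesis
    using p epowr_mono[of "p - 1" "HL F x" "epowr (ennreal K * maxop W H x) (1 / (p - 1))"]
    by (simp add: epowr_epowr)
qed

text \<open>Two strong type bounds are chained, one for \<open>W\<close> with exponent
  \<open>p'\<close> and one for \<open>S\<close> with exponent \<open>p\<close>. As
  \<open>(p - 1) * p' = p\<close> and \<open>W\<close>, \<open>S\<close> are dual, the
  \<open>p'\<close>-moment of \<open>H\<close> is exactly the \<open>p\<close>-moment of
  \<open>maxop S G\<close>, and that of \<open>G\<close> exactly that of \<open>F\<close>.\<close>

theorem HL_bounded_weighted: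
  fixes W S :: "'a::euclidean_space \<Rightarrow> ennreal"
  assumes ap: "Ap_pair p K W S"
  obtains C where "0 < C" "\<And>F. F \<in> borel_measurable lebesgue \<Longrightarrow>
     moment W p (HL F) \<le> ennreal C * moment W p F"
proof -
  note [measurable] = Ap_pair_measurable[OF ap]
  have p: "1 < p" by (rule Ap_pair_p[OF ap])
  define p' where "p' = p / (p - 1)"
  have p': "1 < p'" "(p - 1) * p' = p" and p'_eq: "p' = 1 + 1 / (p - 1)"
    using p by (auto simp: p'_def field_simps)
  obtain C1 where C1: "0 < C1" "\<And>F. F \<in> borel_measurable lebesgue \<Longrightarrow>
     moment W p' (maxop W F) \<le> ennreal C1 * moment W p' F"
    using maxop_strong_type[OF Ap_pair_doubling[OF ap] p'(1)] by metis
  obtain C2 where C2: "0 < C2" "\<And>F. F \<in> borel_measurable lebesgue \<Longrightarrow>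
     moment S p (maxop S F) \<le> ennreal C2 * moment S p F"
    using maxop_strong_type[OF Ap_pair_doubling[OF Ap_pair_dual[OF ap]] p] by metis
  show ?thesis
  proof (rule that[of "K powr p' * (C1 * C2)"])
    show "0 < K powr p' * (C1 * C2)" using C1 C2 Ap_pair_K[OF ap] by simp
    fix F :: "'a \<Rightarrow> ennreal" assume F[measurable]: "F \<in> borel_measurable lebesgue"
    define G where "G = (\<lambda>x. F x * epowr (W x) (1 / (p - 1)))"
    define H where "H = (\<lambda>x. epowr (maxop S G x) (p - 1) * epowr (S x) (p - 1))"
    have [measurable]: "G \<in> borel_measurable lebesgue" "H \<in> borel_measurable lebesgue"
      unfolding G_def H_def by measurable
    have pt: "W x * epowr (HL F x) p \<le> ennreal (K powr p') * (W x * epowr (maxop W H x) p')" for x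
    proof -
      have "epowr (HL F x) p = epowr (epowr (HL F x) (p - 1)) p'"
        by (simp add: epowr_epowr p')
      also have "\<dots> \<le> epowr (ennreal K * maxop W H x) p'"
        using HL_pointwise[OF ap F] p' by (intro epowr_mono) (auto simp: G_def H_def)
      also have "\<dots> = ennreal (K powr p') * epowr (maxop W H x) p'"
        using p' Ap_pair_K[OF ap] by (simp add: epowr_mult epowr_ennreal)
      finally have "W x * epowr (HL F x) p \<le> W x * (ennreal (K powr p') * epowr (maxop W H x) p')"
        by (rule mult_left_mono) simp
      then show ?thesis by (simp add: ac_simps)
    qed
    have "moment W p (HL F) \<le> (\<integral>\<^sup>+x. ennreal (K powr p') * (W x * epowr (maxop W H x) p') \<partial>lebesgue)"
      by (intro nn_integral_mono pt)
    also have "\<dots> = ennreal (K powr p') * moment W p' (maxop W H)"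
      by (intro nn_integral_cmult) measurable
    finally have 1: "moment W p (HL F) \<le> \<dots>" .
    have "moment W p' (maxop W H) \<le> ennreal C1 * moment W p' H"
      by (intro C1) measurable
    also have "moment W p' H = moment S p (maxop S G)"
    proof (intro nn_integral_cong_AE)
      show "AE x in lebesgue. W x * epowr (H x) p' = S x * epowr (maxop S G x) p"
        using Ap_pair_AE[OF ap]
      proof eventually_elim
        case (elim x)
        have "epowr (H x) p' = epowr (maxop S G x) p * epowr (S x) p"
          using p' by (simp add: H_def epowr_mult epowr_epowr)
        also have "epowr (S x) p = epowr (S x) (p - 1) * S x"
          using epowr_add[of "S x" "p - 1" 1] by simp
        finally show ?case using elim
          by (metis mult.assoc mult.commute mult_1)
      qed
    qed
    finally have 2: "moment W p' (maxop W H) \<le> ennreal C1 * moment S p (maxop S G)" .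
    have "moment S p (maxop S G) \<le> ennreal C2 * moment S p G"
      by (intro C2) measurable
    also have "moment S p G = moment W p F"
    proof (intro nn_integral_cong_AE)
      show "AE x in lebesgue. S x * epowr (G x) p = W x * epowr (F x) p"
        using Ap_pair_AE_dual[OF ap]
      proof eventually_elim
        case (elim x)
        have "epowr (G x) p = epowr (F x) p * epowr (W x) (p' * 1)"
          using p by (simp add: G_def epowr_mult epowr_epowr p'_def)
        also have "epowr (W x) (p' * 1) = epowr (W x) (1 / (p - 1)) * W x"
          using epowr_add[of "W x" "1 / (p - 1)" 1] by (simp add: p'_eq add.commute)
        finally show ?case using elim
          by (metis mult.assoc mult.commute mult_1)
      qed
    qed
    finally have 3: "moment S p (maxop S G) \<le> ennreal C2 * moment W p F" .
    have "moment W p (HL F) \<le> ennreal (K powr p') * (ennreal C1 * (ennreal C2 * moment W p F))"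
      using 2 3 by (intro order_trans[OF 1] mult_left_mono order_trans[OF 2]) auto
    then show "moment W p (HL F) \<le> ennreal (K powr p' * (C1 * C2)) * moment W p F"
      using C1 C2 by (simp add: ennreal_mult mult.assoc)
  qed
qed

subsection \<open>The reverse Hoelder inequality\<close>

lemma mass_mono_set_AE: "AE x in lebesgue. x \<in> A \<longrightarrow> x \<in> B \<Longrightarrow> mass F A \<le> mass F B"
  unfolding mass_def by (intro nn_integral_mono_AE) (auto elim!: eventually_mono simp: indicator_def)

section \<open>Averages over small cubes and stopping cubes\<close>

lemma small_cube:
  fixes x :: "'a::euclidean_space"
  assumes "open U" "x \<in> U"
  obtains i where "0 < snd i" "snd i \<le> 1" "x \<in> interior (cb i)" "cb i \<subseteq> U"
proof -
  obtain e where e: "0 < e" "ball x e \<subseteq> U" using assms by (auto simp: open_contains_ball)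
  \<comment> \<open>Two points of the cube are at most \<open>2 * DIM('a) * d\<close> apart, through
    its corner; the factor 3 makes this strictly less than \<open>e\<close>.\<close>
  define d where "d = min 1 (e / (3 * real DIM('a)))"
  have d: "0 < d" "d \<le> 1" using e by (auto simp: d_def)
  have "3 * real DIM('a) * d \<le> 3 * real DIM('a) * (e / (3 * real DIM('a)))"
    by (intro mult_left_mono) (auto simp: d_def)
  then have Nd: "3 * (real DIM('a) * d) \<le> e" by (simp add: mult.assoc)
  have Npos: "0 < real DIM('a) * d" using d by simp
  define i where "i = (x - (d/2) *\<^sub>R One, d)"
  have si: "snd i = d" by (simp add: i_def)
  have xi: "x \<in> interior (cb i)"
    using d by (simp add: cb_def i_def interior_cbox mem_box inner_simps)
  have sub: "cb i \<subseteq> U"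
  proof
    fix y assume "y \<in> cb i"
    then have "y \<in> cball (fst i) (real DIM('a) * snd i)" by (rule subsetD[OF cb_subset_cball])
    then have "dist (fst i) y \<le> real DIM('a) * d" by (simp only: mem_cball si)
    moreover have "x \<in> cball (fst i) (real DIM('a) * snd i)"
      by (rule subsetD[OF cb_subset_cball subsetD[OF interior_subset xi]])
    then have "dist (fst i) x \<le> real DIM('a) * d" by (simp only: mem_cball si)
    ultimately have "dist x y < e"
      using Nd Npos dist_triangle3[of x y "fst i"] by linarith
    then show "y \<in> U" using e by auto
  qed
  show ?thesis using that[of i] d xi sub by (simp add: i_def)
qed

lemma cb_subset_cb_iff:
  fixes i j :: "'a::euclidean_space \<times> real"
  assumes "0 < snd i"
  shows "cb i \<subseteq> cb j \<longleftrightarrow> (\<forall>b\<in>Basis. fst j \<bullet> b \<le> fst i \<bullet> b \<and> fst i \<bullet> b + snd i \<le> fst j \<bullet> b + snd j)"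
  using assms unfolding cb_def by (auto simp: subset_box inner_simps)

lemma cb_subset_snd_le:
  fixes i j :: "'a::euclidean_space \<times> real"
  assumes "0 < snd i" "cb i \<subseteq> cb j" shows "snd i \<le> snd j"
proof -
  obtain b :: 'a where "b \<in> Basis" using nonempty_Basis by blast
  then show ?thesis using assms by (auto simp: cb_subset_cb_iff dest!: bspec[of _ _ b])
qed

text \<open>A substitute for the dyadic parent. In each coordinate the interval is extended
  downwards as far as \<open>cb j\<close> permits but at most by its length, and the remaining
  length goes upwards.\<close>

lemma double_cube:
  fixes i j :: "'a::euclidean_space \<times> real"
  assumes i: "0 < snd i" and sub: "cb i \<subseteq> cb j" and le: "2 * snd i \<le> snd j"
  obtains k where "snd k = 2 * snd i" "cb i \<subseteq> cb k" "cb k \<subseteq> cb j"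
proof
  define k where "k = ((\<Sum>b\<in>Basis. max (fst j \<bullet> b) (fst i \<bullet> b - snd i) *\<^sub>R b), 2 * snd i)"
  have fk: "fst k \<bullet> b = max (fst j \<bullet> b) (fst i \<bullet> b - snd i)" if "b \<in> Basis" for b
    using that by (simp add: k_def)
  show sk: "snd k = 2 * snd i" by (simp add: k_def)
  have "fst j \<bullet> b \<le> fst i \<bullet> b \<and> fst i \<bullet> b + snd i \<le> fst j \<bullet> b + snd j" if "b \<in> Basis" for b
    using sub that unfolding cb_subset_cb_iff[OF i] by blast
  note b = this
  show "cb i \<subseteq> cb k"
    unfolding cb_subset_cb_iff[OF i]
  proof
    fix b :: 'a assume "b \<in> Basis"
    with b[OF this] fk[OF this] i show "fst k \<bullet> b \<le> fst i \<bullet> b \<and> fst i \<bullet> b + snd i \<le> fst k \<bullet> b + snd k"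
      unfolding sk by linarith
  qed
  have k0: "0 < snd k" using i sk by simp
  show "cb k \<subseteq> cb j"
    unfolding cb_subset_cb_iff[OF k0]
  proof
    fix b :: 'a assume "b \<in> Basis"
    with b[OF this] fk[OF this] i le show "fst j \<bullet> b \<le> fst k \<bullet> b \<and> fst k \<bullet> b + snd k \<le> fst j \<bullet> b + snd j"
      unfolding sk by linarith
  qed
qed

text \<open>The half of Lebesgue's differentiation theorem that is needed, without local
  integrability of \<open>F\<close>. Cover the exceptional set efficiently by cubes inside
  \<open>Q\<close>: their averages are at most \<open>l\<close>, although \<open>F\<close> exceeds
  \<open>l + \<eta>\<close> on almost all of their union. This is only possible if the set is
  null.\<close>

lemma AE_cube_average_gt:
  fixes F :: "'a::euclidean_space \<Rightarrow> ennreal"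
  assumes Q: "Q \<in> cubes" and F[measurable]: "F \<in> borel_measurable lebesgue" and l: "0 \<le> l"
  shows "AE x in lebesgue. x \<in> Q \<longrightarrow> ennreal l < F x \<longrightarrow>
     (\<exists>P\<in>cubes. P \<subseteq> Q \<and> x \<in> interior P \<and> ennreal l * emeasure lebesgue P < mass F P)"
proof -
  have Qs[measurable]: "Q \<in> sets lebesgue" using Q by (rule cubes_sets)
  define \<Omega> where "\<Omega> = (\<Union>P\<in>{P\<in>cubes. P \<subseteq> Q \<and> ennreal l * emeasure lebesgue P < mass F P}. interior P)"
  have "open \<Omega>" unfolding \<Omega>_def by auto
  then have [measurable]: "\<Omega> \<in> sets lebesgue" by (rule open_lebesgue)
  define A where "A \<eta> = {x \<in> interior Q. ennreal (l + \<eta>) < F x} - \<Omega>" for \<eta>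
  have Am[measurable]: "A \<eta> \<in> sets lebesgue" for \<eta>
    unfolding A_def by measurable
  have null: "emeasure lebesgue (A \<eta>) = 0" if \<eta>: "0 < \<eta>" for \<eta>
  proof -
    define D where "D = (10 * real DIM('a)) ^ DIM('a)"
    have D: "0 < D" by (simp add: D_def)
    have "emeasure lebesgue (A \<eta>) \<le> 0 + ennreal e" if e: "0 < e" for e
    proof -
      \<comment> \<open>Makes the final bound \<open>D * (l + \<eta>) * \<epsilon> / \<eta>\<close>
        equal to \<open>e\<close>.\<close>
      define \<epsilon> where "\<epsilon> = e * \<eta> / (D * (l + \<eta>))"
      have \<epsilon>: "0 < \<epsilon>" using e \<eta> l D by (simp add: \<epsilon>_def add_nonneg_pos)
      obtain T where T: "open T" "A \<eta> \<subseteq> T" "T - A \<eta> \<in> lmeasurable" "emeasure lebesgue (T - A \<eta>) < ennreal \<epsilon>"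
        using sets_lebesgue_outer_open[OF Am \<epsilon>] by metis
      define U where "U = T \<inter> interior Q"
      have U: "open U" "A \<eta> \<subseteq> U" "U \<subseteq> Q"
        using T interior_subset[of Q] by (auto simp: U_def A_def)
      define K where "K = {i. 0 < snd i \<and> snd i \<le> 1 \<and> cb i \<subseteq> U \<and> A \<eta> \<inter> interior (cb i) \<noteq> {}}"
      have cov: "A \<eta> \<subseteq> (\<Union>i\<in>K. cb i)"
      proof
        fix x assume x: "x \<in> A \<eta>"
        with U have "x \<in> U" by auto
        with U(1) obtain i where i: "0 < snd i" "snd i \<le> 1" "x \<in> interior (cb i)" "cb i \<subseteq> U"
          by (rule small_cube)
        then have "i \<in> K" using x by (auto simp: K_def)
        then show "x \<in> (\<Union>i\<in>K. cb i)" using i interior_subset[of "cb i"] by auto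
      qed
      obtain C where C: "countable C" "C \<subseteq> K" "disjoint_family_on cb C"
        "mass (\<lambda>x. 1) (A \<eta>) \<le> ennreal D * (\<integral>\<^sup>+i. mass (\<lambda>x. 1) (cb i) \<partial>count_space C)"
        using doubling_cover[OF doubling_1 _ cov, of 1] unfolding D_def K_def by blast
      define V where "V = (\<Union>i\<in>C. cb i)"
      have [measurable]: "V \<in> sets lebesgue"
        unfolding V_def using C by (intro sets.countable_UN') auto
      have VU: "V \<subseteq> U" using C by (auto simp: V_def K_def)
      have mV: "emeasure lebesgue V = (\<integral>\<^sup>+i. emeasure lebesgue (cb i) \<partial>count_space C)"
        unfolding V_def using C by (intro emeasure_UN_countable) auto
      have 1: "emeasure lebesgue (A \<eta>) \<le> ennreal D * emeasure lebesgue V"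
        using C(4) by (simp add: mV mass_1)
      have "ennreal (l + \<eta>) * emeasure lebesgue (V \<inter> A \<eta>) = mass (\<lambda>x. ennreal (l + \<eta>)) (V \<inter> A \<eta>)"
        by (simp add: mass_const)
      also have "\<dots> \<le> mass F (V \<inter> A \<eta>)"
        by (intro mass_mono_AE AE_I2) (auto simp: A_def)
      also have "\<dots> \<le> mass F V" by (intro mass_mono_set) auto
      also have "\<dots> = (\<integral>\<^sup>+i. mass F (cb i) \<partial>count_space C)"
        unfolding V_def using C by (intro mass_UN_countable) auto
      also have "\<dots> \<le> (\<integral>\<^sup>+i. ennreal l * emeasure lebesgue (cb i) \<partial>count_space C)"
      proof (intro nn_integral_mono)
        fix i assume "i \<in> space (count_space C)"
        then have "i \<in> K" using C by auto
        then obtain x where x: "x \<in> A \<eta>" "x \<in> interior (cb i)" and i: "0 < snd i" "cb i \<subseteq> U"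
          by (auto simp: K_def)
        \<comment> \<open>\<open>\<Omega>\<close> contains the interior of every cube in
          \<open>Q\<close> with average above \<open>l\<close>, so a cube with an interior point
          outside \<open>\<Omega>\<close> has average at most \<open>l\<close>.\<close>
        from x(1) have "x \<notin> \<Omega>" by (simp add: A_def)
        with x(2) i U(3) have "\<not> ennreal l * emeasure lebesgue (cb i) < mass F (cb i)"
          by (auto simp: \<Omega>_def cb_in_cubes)
        then show "mass F (cb i) \<le> ennreal l * emeasure lebesgue (cb i)" by simp
      qed
      also have "\<dots> = ennreal l * emeasure lebesgue V"
        unfolding mV by (intro nn_integral_cmult) simp
      finally have 2: "ennreal (l + \<eta>) * emeasure lebesgue (V \<inter> A \<eta>) \<le> ennreal l * emeasure lebesgue V" .
      have "emeasure lebesgue V = emeasure lebesgue (V \<inter> A \<eta>) + emeasure lebesgue (V - A \<eta>)"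
        by (subst plus_emeasure) (auto intro!: arg_cong[where f="emeasure lebesgue"])
      also have "emeasure lebesgue (V - A \<eta>) \<le> emeasure lebesgue (T - A \<eta>)"
        using VU T(3) by (intro emeasure_mono) (auto simp: U_def)
      finally have 3: "emeasure lebesgue V \<le> emeasure lebesgue (V \<inter> A \<eta>) + ennreal \<epsilon>"
        using T(4) by (meson add_left_mono less_imp_le order_trans)
      have "emeasure lebesgue V \<le> emeasure lebesgue Q"
        using VU U by (intro emeasure_mono) auto
      then have "emeasure lebesgue V < \<infinity>"
        using emeasure_cubes_finite[OF Q] by auto
      then obtain m where m: "emeasure lebesgue V = ennreal m" "0 \<le> m"
        by (cases "emeasure lebesgue V") auto
      have "emeasure lebesgue (V \<inter> A \<eta>) \<le> ennreal m" unfolding m(1)[symmetric] by (intro emeasure_mono) auto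
      then obtain a where a: "emeasure lebesgue (V \<inter> A \<eta>) = ennreal a" "0 \<le> a"
        by (cases "emeasure lebesgue (V \<inter> A \<eta>)") (auto simp: top_unique)
      have "(l + \<eta>) * a \<le> l * m"
        using 2 l \<eta> m a by (simp add: ennreal_mult[symmetric] del: ennreal_plus)
      moreover have "m \<le> a + \<epsilon>"
        using 3 m a \<epsilon> by (simp add: ennreal_plus[symmetric] del: ennreal_plus)
      then have "(l + \<eta>) * m \<le> (l + \<eta>) * (a + \<epsilon>)" using l \<eta> by (intro mult_left_mono) auto
      ultimately have "\<eta> * m \<le> (l + \<eta>) * \<epsilon>" by (simp add: algebra_simps)
      also have "(l + \<eta>) * \<epsilon> = \<eta> * (e / D)" using l \<eta> by (simp add: \<epsilon>_def)
      finally have "m \<le> e / D" using \<eta> by (rule mult_left_le_imp_le)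
      then have "D * m \<le> e" using D by (simp add: field_simps)
      then show ?thesis
        using 1 m D by (simp add: ennreal_mult[symmetric]) (meson ennreal_leI order_trans)
    qed
    then have "emeasure lebesgue (A \<eta>) \<le> 0" by (rule ennreal_le_epsilon)
    then show ?thesis by simp
  qed
  \<comment> \<open>Countably many gaps \<open>\<eta>\<close> exhaust the condition
    \<open>ennreal l < F x\<close>.\<close>
  have "AE x in lebesgue. \<forall>n. x \<notin> A (inverse (real (Suc n)))"
    unfolding AE_all_countable
  proof
    fix n
    have "A (inverse (real (Suc n))) \<in> null_sets lebesgue" by (auto intro!: null)
    then show "AE x in lebesgue. x \<notin> A (inverse (real (Suc n)))" by (rule AE_not_in)
  qed
  then show ?thesis using AE_cube_interior[OF Q]
  proof eventually_elim
    case (elim x)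
    show ?case
    proof (intro impI)
      assume x: "x \<in> Q" "ennreal l < F x"
      have "\<exists>n. ennreal (l + inverse (real (Suc n))) < F x"
      proof (cases "F x")
        case (real r)
        then have "0 < r - l" using x l by (simp add: ennreal_less_iff)
        then obtain n where "inverse (real (Suc n)) < r - l" using reals_Archimedean by blast
        then show ?thesis using real l by (intro exI[of _ n]) (simp add: ennreal_less_iff del: ennreal_plus)
      qed auto
      with elim x have "x \<in> \<Omega>" by (auto simp: A_def)
      then show "\<exists>P\<in>cubes. P \<subseteq> Q \<and> x \<in> interior P \<and> ennreal l * emeasure lebesgue P < mass F P"
        by (auto simp: \<Omega>_def)
    qed
  qed
qed

text \<open>Among the cubes between \<open>P\<close> and \<open>cb j\<close> with average above
  \<open>l\<close>, take one of nearly maximal side. A cube of twice its side has average at most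
  \<open>l\<close>, hence its own average is at most \<open>2 ^ DIM('a) * l\<close>.\<close>

lemma stopping_cube:
  fixes F :: "'a::euclidean_space \<Rightarrow> ennreal"
  assumes j: "0 < snd j" and le: "mass F (cb j) \<le> ennreal l * emeasure lebesgue (cb j)" and l: "0 \<le> l"
    and P: "P \<in> cubes" "P \<subseteq> cb j" "ennreal l * emeasure lebesgue P < mass F P"
  obtains i where "0 < snd i" "P \<subseteq> cb i" "cb i \<subseteq> cb j" "ennreal l * emeasure lebesgue (cb i) < mass F (cb i)"
    "mass F (cb i) \<le> ennreal (2 ^ DIM('a) * l) * emeasure lebesgue (cb i)"
proof -
  define I where "I = {i. 0 < snd i \<and> P \<subseteq> cb i \<and> cb i \<subseteq> cb j \<and> ennreal l * emeasure lebesgue (cb i) < mass F (cb i)}"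
  obtain i0 where i0: "0 < snd i0" "P = cb i0" using P(1) by (auto simp: cubes_cb)
  have i0I: "i0 \<in> I" using P i0 by (simp add: I_def)
  then have ne: "snd ` I \<noteq> {}" by blast
  have bdd: "bdd_above (snd ` I)"
    by (rule bdd_aboveI[of _ "snd j"]) (auto simp: I_def intro: cb_subset_snd_le[of _ j])
  define s where "s = Sup (snd ` I)"
  have up: "snd i \<le> s" if "i \<in> I" for i
    unfolding s_def using that by (intro cSup_upper bdd) auto
  \<comment> \<open>The supremum need not be attained; half of it is enough for the doubled cube to
    lie outside \<open>I\<close>.\<close>
  from up[OF i0I] i0 have "s / 2 < s" by linarith
  then obtain i where i: "i \<in> I" "s / 2 < snd i"
    using less_cSup_iff[OF ne bdd, of "s / 2"] by (auto simp: s_def)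
  have pos: "0 < snd i" using i by (simp add: I_def)
  have big: "mass F (cb i) \<le> ennreal (2 ^ DIM('a) * l) * emeasure lebesgue (cb i)"
    if k: "0 < snd k" "snd k \<le> 2 * snd i" "cb i \<subseteq> cb k" "mass F (cb k) \<le> ennreal l * emeasure lebesgue (cb k)" for k
  proof -
    have "mass F (cb i) \<le> mass F (cb k)" using k by (intro mass_mono_set)
    also have "\<dots> \<le> ennreal l * emeasure lebesgue (cb k)" by fact
    also have "snd k ^ DIM('a) \<le> (2 * snd i) ^ DIM('a)"
      using k by (intro power_mono) auto
    then have "ennreal l * emeasure lebesgue (cb k) \<le> ennreal l * ennreal ((2 * snd i) ^ DIM('a))"
      using k by (intro mult_left_mono) (simp_all add: emeasure_cb ennreal_leI)
    also have "\<dots> = ennreal (2 ^ DIM('a) * l) * emeasure lebesgue (cb i)"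
      using pos l by (simp add: emeasure_cb ennreal_mult[symmetric] power_mult_distrib ac_simps)
    finally show ?thesis .
  qed
  have "mass F (cb i) \<le> ennreal (2 ^ DIM('a) * l) * emeasure lebesgue (cb i)"
  proof (cases "2 * snd i \<le> snd j")
    case True
    obtain k where k: "snd k = 2 * snd i" "cb i \<subseteq> cb k" "cb k \<subseteq> cb j"
      using double_cube[OF pos _ True] i by (auto simp: I_def)
    have "k \<notin> I" using up[of k] i k by auto
    then have "mass F (cb k) \<le> ennreal l * emeasure lebesgue (cb k)"
      using k pos i by (auto simp: I_def not_less)
    with k pos show ?thesis by (intro big[of k]) auto
  next
    \<comment> \<open>The doubled cube would not fit, but then \<open>cb j\<close> itself is a
      larger cube of less than twice the side, with average at most \<open>l\<close>.\<close>
    case False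
    with j le i show ?thesis by (intro big[of j]) (auto simp: I_def)
  qed
  with i show ?thesis by (intro that[of i]) (auto simp: I_def)
qed

section \<open>Level sets, reverse Hoelder inequality and openness of the \<open>A\<^sub>p\<close>
  condition\<close>

text \<open>Stopping cubes cover almost all of the set where \<open>W\<close> exceeds
  \<open>l\<close>. On each of them the mass of \<open>W\<close> is comparable to \<open>l\<close>
  times the volume, and \<open>W\<close> exceeds \<open>\<gamma> * l\<close> on at least half of the
  cube. A disjoint subfamily then gives the estimate.\<close>

lemma reverse_Holder_level:
  fixes W S :: "'a::euclidean_space \<Rightarrow> ennreal"
  assumes ap: "Ap_pair p K W S"
  obtains C \<gamma> where "0 < C" "0 < \<gamma>" "\<gamma> \<le> 1" "\<And>Q l. Q \<in> cubes \<Longrightarrow> 0 < l \<Longrightarrow>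
    mass W Q \<le> ennreal l * emeasure lebesgue Q \<Longrightarrow>
    mass W {x\<in>Q. ennreal l < W x} \<le> ennreal (C * l) * emeasure lebesgue {x\<in>Q. ennreal (\<gamma> * l) < W x}"
proof -
  note [measurable] = Ap_pair_measurable[OF ap]
  have p: "1 < p" and K: "0 < K" by (rule Ap_pair_p[OF ap] Ap_pair_K[OF ap])+
  obtain D where D: "doubling D W" "0 \<le> D" using Ap_pair_doubling[OF ap] K by fastforce
  \<comment> \<open>So small that \<open>K * \<gamma> \<le> (1/2) powr p\<close>, which forces the
    set where \<open>W\<close> is at most \<open>\<gamma> * l\<close> to have at most half the
    volume of the cube.\<close>
  define \<gamma> where "\<gamma> = min 1 ((1/2) powr p / K)"
  have \<gamma>: "0 < \<gamma>" "\<gamma> \<le> 1" using K by (auto simp: \<gamma>_def)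
  have "K * \<gamma> \<le> K * ((1/2) powr p / K)" using K by (intro mult_left_mono) (auto simp: \<gamma>_def)
  then have K\<gamma>: "K * \<gamma> \<le> (1/2) powr p" using K by simp
  have half: "emeasure lebesgue P \<le> 2 * emeasure lebesgue {x\<in>P. ennreal (\<gamma> * l) < W x}"
    if P: "P \<in> cubes" and l: "0 < l" and gt: "ennreal l * emeasure lebesgue P < mass W P" for P l
  proof -
    let ?P = "emeasure lebesgue P"
    have [measurable]: "P \<in> sets lebesgue" using P by (rule cubes_sets)
    \<comment> \<open>As the average of \<open>W\<close> over \<open>P\<close> exceeds
      \<open>l\<close>, this set carries at most the fraction \<open>\<gamma>\<close> of the mass of
      \<open>W\<close>; \<open>Ap_pair_strong_doubling\<close> translates this into volume.\<close>
    define E where "E = {x\<in>P. W x \<le> ennreal (\<gamma> * l)}"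
    have [measurable]: "E \<in> sets lebesgue" unfolding E_def by measurable
    have EP: "E \<subseteq> P" by (auto simp: E_def)
    have "mass W E \<le> mass (\<lambda>x. ennreal (\<gamma> * l)) E"
      by (intro mass_mono_AE AE_I2) (auto simp: E_def)
    also have "\<dots> = ennreal (\<gamma> * l) * emeasure lebesgue E" by (simp add: mass_const)
    also have "\<dots> \<le> ennreal (\<gamma> * l) * ?P" using EP by (intro mult_left_mono emeasure_mono) auto
    also have "\<dots> = ennreal \<gamma> * (ennreal l * ?P)" using \<gamma> l by (simp add: ennreal_mult mult.assoc)
    also have "\<dots> \<le> ennreal \<gamma> * mass W P" using gt by (intro mult_left_mono) auto
    finally have 1: "mass W E \<le> ennreal \<gamma> * mass W P" .
    have "epowr (emeasure lebesgue E) p * mass W P \<le> ennreal K * epowr ?P p * mass W E"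
      using P EP by (intro Ap_pair_strong_doubling[OF ap]) auto
    also have "\<dots> \<le> ennreal K * epowr ?P p * (ennreal \<gamma> * mass W P)"
      by (intro mult_left_mono 1) simp
    also have "\<dots> = (ennreal (K * \<gamma>) * epowr ?P p) * mass W P"
      using K \<gamma> by (simp add: ennreal_mult ac_simps)
    finally have "epowr (emeasure lebesgue E) p \<le> ennreal (K * \<gamma>) * epowr ?P p"
      by (rule ennreal_mult_le_cancel[OF _ Ap_pair_pos(1)[OF ap P] Ap_pair_finite(1)[OF ap P]])
    also have "\<dots> \<le> ennreal ((1/2) powr p) * epowr ?P p"
      by (intro mult_right_mono ennreal_leI K\<gamma>) simp
    also have "\<dots> = epowr (ennreal (1/2) * ?P) p"
      using p by (subst epowr_mult) (auto simp: epowr_ennreal simp del: ennreal_half)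
    finally have 2: "emeasure lebesgue E \<le> ennreal (1/2) * ?P"
      by (rule epowr_le_cancel[of p, rotated]) (use p in linarith)
    have "?P = emeasure lebesgue E + emeasure lebesgue {x\<in>P. ennreal (\<gamma> * l) < W x}"
      by (subst plus_emeasure) (auto simp: E_def not_le intro!: arg_cong[where f="emeasure lebesgue"])
    with 2 have 3: "?P \<le> ennreal (1/2) * ?P + emeasure lebesgue {x\<in>P. ennreal (\<gamma> * l) < W x}"
      by (metis add_right_mono)
    obtain q where q: "?P = ennreal q" "0 \<le> q" using emeasure_cubes_finite[OF P] by (cases ?P) auto
    show ?thesis
    proof (cases "emeasure lebesgue {x\<in>P. ennreal (\<gamma> * l) < W x}")
      case (real r)
      then have "ennreal q \<le> ennreal (1/2 * q + r)"
        using 3 q by (simp add: ennreal_mult'[symmetric] ennreal_plus[symmetric] del: ennreal_half ennreal_plus)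
      then have "q \<le> 1/2 * q + r" using q real by (subst (asm) ennreal_le_iff) auto
      then have "ennreal q \<le> ennreal (2 * r)" by (intro ennreal_leI) simp
      then show ?thesis using q real by (simp add: ennreal_mult')
    qed (simp add: ennreal_mult_top)
  qed
  \<comment> \<open>\<open>D\<close> is the cost of the covering, raised by 1 for positivity, the
    power of 2 comes from the stopping cubes, and the last 2 from \<open>half\<close>.\<close>
  define C where "C = (D + 1) * 2 ^ DIM('a) * 2"
  show ?thesis
  proof (rule that[of C \<gamma>])
    show "0 < C" using D by (simp add: C_def)
    fix Q :: "'a set" and l :: real
    assume Q: "Q \<in> cubes" and l: "0 < l" and le: "mass W Q \<le> ennreal l * emeasure lebesgue Q"
    obtain j where j: "0 < snd j" "Q = cb j" using Q by (auto simp: cubes_cb)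
    have [measurable]: "Q \<in> sets lebesgue" using Q by (rule cubes_sets)
    define I where "I = {i. 0 < snd i \<and> cb i \<subseteq> Q \<and> ennreal l * emeasure lebesgue (cb i) < mass W (cb i) \<and>
       mass W (cb i) \<le> ennreal (2 ^ DIM('a) * l) * emeasure lebesgue (cb i)}"
    have "AE x in lebesgue. x \<in> {x\<in>Q. ennreal l < W x} \<longrightarrow> x \<in> (\<Union>i\<in>I. cb i)"
      using AE_cube_average_gt[OF Q Ap_pair_measurable(1)[OF ap] less_imp_le[OF l]]
    proof eventually_elim
      case (elim x)
      show ?case
      proof
        assume "x \<in> {x\<in>Q. ennreal l < W x}"
        then obtain P where P: "P \<in> cubes" "P \<subseteq> Q" "x \<in> interior P" "ennreal l * emeasure lebesgue P < mass W P"
          using elim by auto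
        obtain i where "0 < snd i" "P \<subseteq> cb i" "cb i \<subseteq> cb j" "ennreal l * emeasure lebesgue (cb i) < mass W (cb i)"
          "mass W (cb i) \<le> ennreal (2 ^ DIM('a) * l) * emeasure lebesgue (cb i)"
          using stopping_cube[OF j(1), of W l P] le l P j by auto
        moreover from this have "i \<in> I" using j by (simp add: I_def)
        ultimately show "x \<in> (\<Union>i\<in>I. cb i)" using P(3) interior_subset[of P] by blast
      qed
    qed
    then have "mass W {x\<in>Q. ennreal l < W x} \<le> mass W (\<Union>i\<in>I. cb i)"
      by (rule mass_mono_set_AE)
    moreover obtain B where B: "countable B" "B \<subseteq> I" "disjoint_family_on cb B"
      "mass W (\<Union>i\<in>I. cb i) \<le> ennreal D * (\<integral>\<^sup>+i. mass W (cb i) \<partial>count_space B)"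
    proof (rule doubling_cover[OF D(1) _ order_refl])
      show "0 < snd i \<and> snd i \<le> snd j" if "i \<in> I" for i
        using that j cb_subset_snd_le[of i j] by (auto simp: I_def)
    qed blast
    moreover have "(\<integral>\<^sup>+i. mass W (cb i) \<partial>count_space B) \<le>
       ennreal (2 ^ DIM('a) * l * 2) * emeasure lebesgue {x\<in>Q. ennreal (\<gamma> * l) < W x}"
    proof -
      have "(\<integral>\<^sup>+i. mass W (cb i) \<partial>count_space B) \<le>
        (\<integral>\<^sup>+i. ennreal (2 ^ DIM('a) * l * 2) * emeasure lebesgue {x\<in>cb i. ennreal (\<gamma> * l) < W x} \<partial>count_space B)"
      proof (intro nn_integral_mono)
        fix i assume "i \<in> space (count_space B)"
        then have i: "0 < snd i" "ennreal l * emeasure lebesgue (cb i) < mass W (cb i)"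
          "mass W (cb i) \<le> ennreal (2 ^ DIM('a) * l) * emeasure lebesgue (cb i)"
          using B(2) by (auto simp: I_def)
        note i(3)
        also have "ennreal (2 ^ DIM('a) * l) * emeasure lebesgue (cb i) \<le>
            ennreal (2 ^ DIM('a) * l) * (2 * emeasure lebesgue {x\<in>cb i. ennreal (\<gamma> * l) < W x})"
          by (intro mult_left_mono half cb_in_cubes i l) simp
        also have "\<dots> = ennreal (2 ^ DIM('a) * l * 2) * emeasure lebesgue {x\<in>cb i. ennreal (\<gamma> * l) < W x}"
          using l by (subst (2) ennreal_mult) (auto simp: mult.assoc)
        finally show "mass W (cb i) \<le> \<dots>" .
      qed
      also have "\<dots> = ennreal (2 ^ DIM('a) * l * 2) * (\<integral>\<^sup>+i. emeasure lebesgue {x\<in>cb i. ennreal (\<gamma> * l) < W x} \<partial>count_space B)"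
        by (intro nn_integral_cmult) simp
      also have "(\<integral>\<^sup>+i. emeasure lebesgue {x\<in>cb i. ennreal (\<gamma> * l) < W x} \<partial>count_space B) =
          emeasure lebesgue (\<Union>i\<in>B. {x\<in>cb i. ennreal (\<gamma> * l) < W x})"
      proof (intro emeasure_UN_countable[symmetric])
        show "disjoint_family_on (\<lambda>i. {x\<in>cb i. ennreal (\<gamma> * l) < W x}) B"
          using B(3) unfolding disjoint_family_on_def by blast
        show "{x\<in>cb i. ennreal (\<gamma> * l) < W x} \<in> sets lebesgue" for i :: "'a \<times> real"
          by measurable
        show "countable B" by (rule B)
      qed
      finally have "(\<integral>\<^sup>+i. mass W (cb i) \<partial>count_space B) \<le> ennreal (2 ^ DIM('a) * l * 2) * emeasure lebesgue (\<Union>i\<in>B. {x\<in>cb i. ennreal (\<gamma> * l) < W x})" .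
      also have "\<dots> \<le> ennreal (2 ^ DIM('a) * l * 2) * emeasure lebesgue {x\<in>Q. ennreal (\<gamma> * l) < W x}"
        using B(2) by (intro mult_left_mono emeasure_mono) (auto simp: I_def)
      finally show ?thesis .
    qed
    ultimately have "mass W {x\<in>Q. ennreal l < W x} \<le> ennreal D * (ennreal (2 ^ DIM('a) * l * 2) * emeasure lebesgue {x\<in>Q. ennreal (\<gamma> * l) < W x})"
      by (meson mult_left_mono order_trans zero_le)
    also have "\<dots> = ennreal (D * (2 ^ DIM('a) * l * 2)) * emeasure lebesgue {x\<in>Q. ennreal (\<gamma> * l) < W x}"
      using D l by (subst (2) ennreal_mult) (auto simp: mult.assoc)
    also have "\<dots> \<le> ennreal (C * l) * emeasure lebesgue {x\<in>Q. ennreal (\<gamma> * l) < W x}"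
      using D l by (intro mult_right_mono ennreal_leI) (auto simp: C_def algebra_simps)
    finally show "mass W {x\<in>Q. ennreal l < W x} \<le> ennreal (C * l) * emeasure lebesgue {x\<in>Q. ennreal (\<gamma> * l) < W x}" .
  qed (use \<gamma> in auto)
qed

lemma ennreal_absorb_half: "I \<le> A + ennreal (1/2) * I \<Longrightarrow> I < \<infinity> \<Longrightarrow> I \<le> 2 * (A::ennreal)"
proof (cases I; cases A)
  fix r s assume *: "I \<le> A + ennreal (1/2) * I" "0 \<le> r" "I = ennreal r" "0 \<le> s" "A = ennreal s"
  have "ennreal s + ennreal (1/2) * ennreal r = ennreal (s + 1/2 * r)"
    using * by (subst ennreal_mult[symmetric], simp, simp, subst ennreal_plus) auto
  then have "ennreal r \<le> ennreal (s + 1/2 * r)" using * by (simp only:)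
  then have "r \<le> s + 1/2 * r" using * by (subst (asm) ennreal_le_iff) auto
  then have "ennreal r \<le> ennreal (2 * s)" by (intro ennreal_leI) simp
  then show ?thesis using * by (simp add: ennreal_mult)
qed (auto simp: ennreal_mult_top)

text \<open>Integrate the level estimate against \<open>\<delta> * l powr (\<delta> - 1)\<close>
  over the levels above the average. The right side is a small multiple of the integral to be
  bounded, and for small \<open>\<delta>\<close> it is absorbed into the left side.\<close>

theorem reverse_Holder:
  fixes W S :: "'a::euclidean_space \<Rightarrow> ennreal"
  assumes ap: "Ap_pair p K W S"
  obtains \<delta> where "0 < \<delta>" "\<And>Q. Q \<in> cubes \<Longrightarrow>
    mass (\<lambda>x. epowr (W x) (1 + \<delta>)) Q * epowr (emeasure lebesgue Q) \<delta> \<le> 2 * epowr (mass W Q) (1 + \<delta>)"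
proof -
  note [measurable] = Ap_pair_measurable[OF ap]
  obtain C \<gamma> where C: "0 < C" "0 < \<gamma>" "\<gamma> \<le> 1" and level: "\<And>Q l. Q \<in> cubes \<Longrightarrow> 0 < l \<Longrightarrow>
    mass W Q \<le> ennreal l * emeasure lebesgue Q \<Longrightarrow>
    mass W {x\<in>Q. ennreal l < W x} \<le> ennreal (C * l) * emeasure lebesgue {x\<in>Q. ennreal (\<gamma> * l) < W x}"
    using reverse_Holder_level[OF ap] by blast
  \<comment> \<open>\<open>\<delta> \<le> 1\<close> allows
    \<open>(1/\<gamma>) powr (1 + \<delta>)\<close> to be replaced by
    \<open>(1/\<gamma>) powr 2\<close>; the other bound then brings the factor in front of the
    absorbed term down to 1/2.\<close>
  define \<delta> where "\<delta> = min 1 (\<gamma>\<^sup>2 / (2 * C))"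
  have \<delta>: "0 < \<delta>" "\<delta> \<le> 1" using C by (auto simp: \<delta>_def)
  define e where "e = C * \<delta> / (1 + \<delta>)"
  have e0: "0 < e" using C \<delta> by (simp add: e_def)
  have "C * \<delta> \<le> C * (\<gamma>\<^sup>2 / (2 * C))" using C by (intro mult_left_mono) (auto simp: \<delta>_def)
  moreover have "e \<le> C * \<delta>" using C \<delta> by (simp add: e_def divide_le_eq_1 field_simps)
  ultimately have "e \<le> \<gamma>\<^sup>2 / 2" using C by simp
  moreover have "(1/\<gamma>) powr (1 + \<delta>) \<le> (1/\<gamma>) powr 2" using C \<delta> by (intro powr_mono) auto
  ultimately have "e * (1/\<gamma>) powr (1 + \<delta>) \<le> \<gamma>\<^sup>2 / 2 * (1/\<gamma>) powr 2"
    using C e0 by (intro mult_mono) auto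
  also have "\<dots> = 1/2" using C by (simp add: power2_eq_square)
  finally have e: "e * (1/\<gamma>) powr (1 + \<delta>) \<le> 1/2" .
  have main: "mass (\<lambda>x. epowr (W x) (1 + \<delta>)) Q * epowr (emeasure lebesgue Q) \<delta> \<le> 2 * epowr (mass W Q) (1 + \<delta>)"
    if Q: "Q \<in> cubes" for Q
  proof -
    let ?q = "emeasure lebesgue Q"
    have [measurable]: "Q \<in> sets lebesgue" using Q by (rule cubes_sets)
    obtain q where q: "?q = ennreal q" "0 < q"
      using emeasure_cubes_pos[OF Q] emeasure_cubes_finite[OF Q] by (cases ?q) auto
    obtain M where M: "mass W Q = ennreal M" "0 < M"
      using Ap_pair_pos(1)[OF ap Q] Ap_pair_finite(1)[OF ap Q] by (cases "mass W Q") auto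
    \<comment> \<open>The average of \<open>W\<close> over \<open>Q\<close>, which is the lowest
      level at which the estimate \<open>level\<close> applies.\<close>
    define m where "m = M / q"
    have m: "0 < m" "M = m * q" using q M by (auto simp: m_def)
    define A where "A = mass W Q * epowr (ennreal m) \<delta>"
    define V where "V = (\<lambda>x. W x * indicator Q x)"
    \<comment> \<open>Absorption needs a finite integral, so one factor is truncated at height
      \<open>n\<close>; the bound for \<open>I n\<close> does not depend on
      \<open>n\<close>.\<close>
    define G where "G n x = min (W x) (ennreal (real n))" for n x
    define I where "I n = (\<integral>\<^sup>+x. V x * epowr (G n x) \<delta> \<partial>lebesgue)" for n
    have [measurable]: "V \<in> borel_measurable lebesgue" "G n \<in> borel_measurable lebesgue" for n
      unfolding V_def G_def by measurable
    have I_le: "I n \<le> 2 * A" for n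
    proof (rule ennreal_absorb_half)
      have "I n \<le> (\<integral>\<^sup>+x. V x * epowr (ennreal (real n)) \<delta> \<partial>lebesgue)"
        unfolding I_def using \<delta> by (intro nn_integral_mono mult_left_mono epowr_mono) (auto simp: G_def)
      also have "\<dots> = mass W Q * epowr (ennreal (real n)) \<delta>"
        unfolding mass_def V_def by (intro nn_integral_multc) measurable
      also have "\<dots> < \<infinity>" using M by (auto simp: ennreal_mult_less_top)
      finally show "I n < \<infinity>" .
      \<comment> \<open>For \<open>l < real n\<close> the function \<open>G2\<close> exceeds
        \<open>l\<close> exactly where \<open>W\<close> exceeds \<open>\<gamma> * l\<close>. Since
        \<open>G2\<close> is at most \<open>G n\<close> divided by \<open>\<gamma>\<close>, its
        integral leads back to \<open>I n\<close>.\<close>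
      define G2 where "G2 = (\<lambda>x. min (ennreal (1/\<gamma>) * W x) (ennreal (real n)))"
      have [measurable]: "G2 \<in> borel_measurable lebesgue" unfolding G2_def by measurable
      let ?h = "\<lambda>l. ennreal ((1 + \<delta>) * l powr ((1 + \<delta>) - 1)) * indicator {0<..} l * mass (indicator Q) {x. ennreal l < G2 x}"
      \<comment> \<open>Below \<open>m\<close> the total mass is a sufficient bound, between
        \<open>m\<close> and \<open>n\<close> the estimate \<open>level\<close> applies, and above
        \<open>n\<close> the truncated set is empty.\<close>
      have pw: "ennreal (\<delta> * l powr (\<delta> - 1)) * indicator {0<..} l * mass V {x. ennreal l < G n x} \<le>
        mass W Q * (ennreal (\<delta> * l powr (\<delta> - 1)) * indicator {l. 0 < l \<and> ennreal l < ennreal m} l) + ennreal e * ?h l" for l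
      proof (cases "0 < l")
        case l: True
        consider "l < m" | "m \<le> l" "l < real n" | "real n \<le> l" by linarith
        then show ?thesis
        proof cases
          case 1
          have "mass V {x. ennreal l < G n x} \<le> mass V UNIV" by (intro mass_mono_set) auto
          also have "\<dots> = mass W Q" by (simp add: mass_def V_def)
          finally have "ennreal (\<delta> * l powr (\<delta> - 1)) * mass V {x. ennreal l < G n x} \<le> ennreal (\<delta> * l powr (\<delta> - 1)) * mass W Q"
            by (rule mult_left_mono) simp
          moreover have "ennreal l < ennreal m" using 1 l by (simp add: ennreal_less_iff)
          ultimately show ?thesis using l by (simp add: mult.commute add_increasing2)
        next
          case 2
          have "mass V {x. ennreal l < G n x} = mass W {x\<in>Q. ennreal l < W x}"
            unfolding mass_def using 2 l
            by (intro nn_integral_cong) (auto simp: V_def G_def indicator_def ennreal_less_iff)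
          also have "\<dots> \<le> ennreal (C * l) * emeasure lebesgue {x\<in>Q. ennreal (\<gamma> * l) < W x}"
          proof (rule level[OF Q l])
            have "m * q \<le> l * q" using 2 q by simp
            then show "mass W Q \<le> ennreal l * ?q"
              using l q m M by (simp add: ennreal_mult[symmetric] ennreal_leI)
          qed
          also have "emeasure lebesgue {x\<in>Q. ennreal (\<gamma> * l) < W x} = mass (indicator Q) {x. ennreal l < G2 x}"
          proof -
            have "ennreal l < ennreal (1/\<gamma>) * W x \<longleftrightarrow> ennreal (\<gamma> * l) < W x" for x
            proof (cases "W x")
              case (real r)
              then have "ennreal (1/\<gamma>) * W x = ennreal (1/\<gamma> * r)" using C by (simp add: ennreal_mult[symmetric])
              then show ?thesis using real C l by (simp add: ennreal_less_iff field_simps)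
            qed (use C in \<open>simp add: ennreal_mult_top\<close>)
            then have *: "{x\<in>Q. ennreal (\<gamma> * l) < W x} = {x. ennreal l < G2 x} \<inter> Q"
              using 2 l by (auto simp: G2_def ennreal_less_iff)
            have "mass (indicator Q) {x. ennreal l < G2 x} = (\<integral>\<^sup>+x. indicator ({x. ennreal l < G2 x} \<inter> Q) x \<partial>lebesgue)"
              unfolding mass_def by (intro nn_integral_cong) (auto simp: indicator_def)
            also have "\<dots> = emeasure lebesgue ({x. ennreal l < G2 x} \<inter> Q)"
              by (intro nn_integral_indicator) measurable
            finally show ?thesis unfolding * ..
          qed
          finally have "ennreal (\<delta> * l powr (\<delta> - 1)) * mass V {x. ennreal l < G n x} \<le>
             ennreal (\<delta> * l powr (\<delta> - 1)) * (ennreal (C * l) * mass (indicator Q) {x. ennreal l < G2 x})"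
            by (rule mult_left_mono) simp
          also have "\<dots> = ennreal (\<delta> * l powr (\<delta> - 1) * (C * l)) * mass (indicator Q) {x. ennreal l < G2 x}"
            using \<delta> C l by (subst ennreal_mult) (auto simp: mult.assoc)
          also have "\<delta> * l powr (\<delta> - 1) * (C * l) = e * ((1 + \<delta>) * l powr ((1 + \<delta>) - 1))"
            using \<delta> l by (simp add: e_def powr_diff field_simps)
          also have "ennreal (e * ((1 + \<delta>) * l powr ((1 + \<delta>) - 1))) * mass (indicator Q) {x. ennreal l < G2 x} = ennreal e * ?h l"
            using e0 \<delta> l by (subst ennreal_mult) (auto simp: mult.assoc)
          finally show ?thesis using l by (simp add: add_increasing)
        next
          case 3
          then have "{x. ennreal l < G n x} = {}"
            by (auto simp: G_def not_less intro!: order_trans[OF min.cobounded2] ennreal_leI)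
          then show ?thesis by (simp add: mass_def)
        qed
      qed simp
      have "I n = (\<integral>\<^sup>+l. ennreal (\<delta> * l powr (\<delta> - 1)) * indicator {0<..} l * mass V {x. ennreal l < G n x} \<partial>lborel)"
        unfolding I_def using \<delta> by (intro layer_cake) auto
      also have "\<dots> \<le> (\<integral>\<^sup>+l. mass W Q * (ennreal (\<delta> * l powr (\<delta> - 1)) * indicator {l. 0 < l \<and> ennreal l < ennreal m} l) + ennreal e * ?h l \<partial>lborel)"
        by (intro nn_integral_mono pw)
      also have "\<dots> = (\<integral>\<^sup>+l. mass W Q * (ennreal (\<delta> * l powr (\<delta> - 1)) * indicator {l. 0 < l \<and> ennreal l < ennreal m} l) \<partial>lborel) + (\<integral>\<^sup>+l. ennreal e * ?h l \<partial>lborel)"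
      proof (rule nn_integral_add)
        have [measurable]: "(\<lambda>l. mass (indicator Q) {x. ennreal l < G2 x}) \<in> borel_measurable borel"
          by (rule measurable_mass_level[of "indicator Q" G2]) measurable
        show "(\<lambda>l. ennreal e * ?h l) \<in> borel_measurable lborel"
          by measurable
      qed measurable
      also have "(\<integral>\<^sup>+l. mass W Q * (ennreal (\<delta> * l powr (\<delta> - 1)) * indicator {l. 0 < l \<and> ennreal l < ennreal m} l) \<partial>lborel) = A"
        unfolding A_def epowr_eq_nn_integral[OF \<delta>(1)] by (intro nn_integral_cmult) measurable
      also have "(\<integral>\<^sup>+l. ennreal e * ?h l \<partial>lborel) = ennreal e * (\<integral>\<^sup>+l. ?h l \<partial>lborel)"
      proof (rule nn_integral_cmult)
        have [measurable]: "(\<lambda>l. mass (indicator Q) {x. ennreal l < G2 x}) \<in> borel_measurable borel"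
          by (rule measurable_mass_level[of "indicator Q" G2]) measurable
        show "?h \<in> borel_measurable lborel"
          by measurable
      qed
      also have "(\<integral>\<^sup>+l. ?h l \<partial>lborel) = (\<integral>\<^sup>+x. indicator Q x * epowr (G2 x) (1 + \<delta>) \<partial>lebesgue)"
        using \<delta> by (intro layer_cake[symmetric]) auto
      finally have 1: "I n \<le> A + ennreal e * (\<integral>\<^sup>+x. indicator Q x * epowr (G2 x) (1 + \<delta>) \<partial>lebesgue)" .
      have "(\<integral>\<^sup>+x. indicator Q x * epowr (G2 x) (1 + \<delta>) \<partial>lebesgue) \<le> (\<integral>\<^sup>+x. ennreal ((1/\<gamma>) powr (1 + \<delta>)) * (V x * epowr (G n x) \<delta>) \<partial>lebesgue)"
      proof (intro nn_integral_mono)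
        fix x
        have "ennreal (real n) \<le> ennreal (1/\<gamma>) * ennreal (real n)"
          using C by (subst ennreal_mult[symmetric]) (auto intro!: ennreal_leI mult_left_le_one_le simp: field_simps)
        then have "G2 x \<le> ennreal (1/\<gamma>) * G n x"
          by (auto simp: G2_def G_def min_def not_le intro: order_trans)
        then have "epowr (G2 x) (1 + \<delta>) \<le> epowr (ennreal (1/\<gamma>) * G n x) (1 + \<delta>)"
          using \<delta> by (intro epowr_mono) auto
        also have "\<dots> = ennreal ((1/\<gamma>) powr (1 + \<delta>)) * epowr (G n x) (1 + \<delta>)"
          using C \<delta> by (subst epowr_mult) (auto simp: epowr_ennreal)
        also have "epowr (G n x) (1 + \<delta>) = G n x * epowr (G n x) \<delta>"
          using epowr_add[of "G n x" 1 \<delta>] by simp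
        also have "ennreal ((1/\<gamma>) powr (1 + \<delta>)) * (G n x * epowr (G n x) \<delta>) \<le> ennreal ((1/\<gamma>) powr (1 + \<delta>)) * (W x * epowr (G n x) \<delta>)"
          by (intro mult_left_mono mult_right_mono) (auto simp: G_def)
        finally show "indicator Q x * epowr (G2 x) (1 + \<delta>) \<le> ennreal ((1/\<gamma>) powr (1 + \<delta>)) * (V x * epowr (G n x) \<delta>)"
          by (auto simp: V_def indicator_def)
      qed
      also have "\<dots> = ennreal ((1/\<gamma>) powr (1 + \<delta>)) * I n"
        unfolding I_def by (intro nn_integral_cmult) measurable
      finally have "ennreal e * (\<integral>\<^sup>+x. indicator Q x * epowr (G2 x) (1 + \<delta>) \<partial>lebesgue) \<le> ennreal e * (ennreal ((1/\<gamma>) powr (1 + \<delta>)) * I n)"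
        by (rule mult_left_mono) simp
      also have "\<dots> = ennreal (e * (1/\<gamma>) powr (1 + \<delta>)) * I n"
        using e0 by (subst ennreal_mult) (auto simp: mult.assoc)
      also have "\<dots> \<le> ennreal (1/2) * I n"
        by (intro mult_right_mono ennreal_leI e) simp
      finally have "ennreal e * (\<integral>\<^sup>+x. indicator Q x * epowr (G2 x) (1 + \<delta>) \<partial>lebesgue) \<le> ennreal (1/2) * I n" .
      then show "I n \<le> A + ennreal (1/2) * I n"
        by (intro order_trans[OF 1] add_left_mono)
    qed
    have "mass (\<lambda>x. epowr (W x) (1 + \<delta>)) Q \<le> (\<integral>\<^sup>+x. (SUP n. V x * epowr (G n x) \<delta>) \<partial>lebesgue)"
      unfolding mass_def
    proof (rule nn_integral_mono_AE)
      show "AE x in lebesgue. epowr (W x) (1 + \<delta>) * indicator Q x \<le> (SUP n. V x * epowr (G n x) \<delta>)"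
        using Ap_pair_AE_pos[OF ap]
      proof eventually_elim
        case (elim x)
        then obtain r where r: "W x = ennreal r" "0 \<le> r" by (cases "W x") auto
        obtain n where n: "r \<le> real n" using real_arch_simple by blast
        then have "G n x = W x" using r by (auto simp: G_def min_def ennreal_leI)
        moreover have "epowr (W x) (1 + \<delta>) = W x * epowr (W x) \<delta>"
          using epowr_add[of "W x" 1 \<delta>] by simp
        ultimately have "epowr (W x) (1 + \<delta>) * indicator Q x = V x * epowr (G n x) \<delta>"
          by (simp add: V_def ac_simps)
        then show ?case by (intro SUP_upper2[of n]) auto
      qed
    qed
    also have "\<dots> = (SUP n. I n)"
      unfolding I_def
    proof (rule nn_integral_monotone_convergence_SUP)
      show "incseq (\<lambda>n x. V x * epowr (G n x) \<delta>)"
        using \<delta> unfolding G_def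
        by (intro monoI le_funI mult_left_mono epowr_mono min.mono order_refl ennreal_leI) auto
    qed measurable
    also have "\<dots> \<le> 2 * A" by (intro SUP_least I_le)
    finally have "mass (\<lambda>x. epowr (W x) (1 + \<delta>)) Q * epowr ?q \<delta> \<le> 2 * A * epowr ?q \<delta>"
      by (rule mult_right_mono) simp
    also have "\<dots> = 2 * (mass W Q * epowr (ennreal m * ?q) \<delta>)"
      using \<delta> by (simp add: A_def epowr_mult mult.assoc)
    also have "ennreal m * ?q = mass W Q"
      using m q M by (simp add: ennreal_mult)
    also have "mass W Q * epowr (mass W Q) \<delta> = epowr (mass W Q) (1 + \<delta>)"
      using epowr_add[of "mass W Q" 1 \<delta>] by simp
    finally show ?thesis .
  qed
  show ?thesis by (rule that[OF \<delta>(1) main])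
qed

text \<open>The reverse Hoelder inequality for the dual weight \<open>S\<close> says that a power of
  \<open>S\<close> slightly above 1 still has controlled averages, and this power is the dual weight
  for a smaller exponent.\<close>

theorem Ap_pair_open:
  fixes W S :: "'a::euclidean_space \<Rightarrow> ennreal"
  assumes ap: "Ap_pair p K W S"
  obtains r K' S' where "1 < r" "r < p" "Ap_pair r K' W S'"
proof -
  note [measurable] = Ap_pair_measurable[OF ap]
  have p: "1 < p" and K: "0 < K" by (rule Ap_pair_p[OF ap] Ap_pair_K[OF ap])+
  obtain \<delta> where \<delta>: "0 < \<delta>" and RH: "\<And>Q. Q \<in> cubes \<Longrightarrow>
    mass (\<lambda>x. epowr (S x) (1 + \<delta>)) Q * epowr (emeasure lebesgue Q) \<delta> \<le> 2 * epowr (mass S Q) (1 + \<delta>)"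
    using reverse_Holder[OF Ap_pair_dual[OF ap]] by blast
  define S' where "S' = (\<lambda>x. epowr (S x) (1 + \<delta>))"
  have [measurable]: "S' \<in> borel_measurable lebesgue" unfolding S'_def by measurable
  \<comment> \<open>Makes \<open>epowr (S x) (1 + \<delta>)\<close> the dual weight for
    \<open>r\<close>: raised to \<open>r - 1\<close> it equals
    \<open>epowr (S x) (p - 1)\<close>.\<close>
  define r where "r = 1 + (p - 1) / (1 + \<delta>)"
  have r1: "(1 + \<delta>) * (r - 1) = p - 1" using \<delta> by (simp add: r_def)
  have r2: "\<delta> * (r - 1) = p - r" using r1 by (simp add: algebra_simps)
  have r: "1 < r" using p \<delta> by (simp add: r_def)
  have "0 < \<delta> * (r - 1)" using r \<delta> by simp
  then have rp: "r < p" unfolding r2 by simp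
  have fin: "mass S' Q < \<infinity>" if Q: "Q \<in> cubes" for Q
  proof (rule ccontr)
    assume "\<not> mass S' Q < \<infinity>"
    then have "mass S' Q * epowr (emeasure lebesgue Q) \<delta> = top"
      using emeasure_cubes_pos[OF Q] by (simp add: less_top[symmetric] ennreal_top_mult)
    moreover have "2 * epowr (mass S Q) (1 + \<delta>) < top"
      using Ap_pair_finite(2)[OF ap Q] by (simp add: ennreal_mult_less_top)
    ultimately show False using RH[OF Q] by (simp add: S'_def top_unique)
  qed
  have le: "mass W Q * epowr (mass S' Q) (r - 1) \<le> ennreal (2 powr (r - 1) * K) * epowr (emeasure lebesgue Q) r" if Q: "Q \<in> cubes" for Q
  proof -
    let ?q = "emeasure lebesgue Q"
    have q: "0 < epowr ?q (p - r)" "epowr ?q (p - r) < \<infinity>"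
      using emeasure_cubes_pos[OF Q] emeasure_cubes_finite[OF Q] by (auto simp: zero_less_iff_neq_zero)
    have "epowr (mass S' Q * epowr ?q \<delta>) (r - 1) \<le> epowr (ennreal 2 * epowr (mass S Q) (1 + \<delta>)) (r - 1)"
      using r RH[OF Q] by (intro epowr_mono) (auto simp: S'_def)
    then have "epowr (mass S' Q) (r - 1) * epowr ?q (p - r) \<le> ennreal (2 powr (r - 1)) * epowr (mass S Q) (p - 1)"
      using r by (simp add: epowr_mult[of "r - 1"] epowr_epowr r1 r2 epowr_ennreal del: ennreal_numeral)
    then have "mass W Q * (epowr (mass S' Q) (r - 1) * epowr ?q (p - r)) \<le> mass W Q * (ennreal (2 powr (r - 1)) * epowr (mass S Q) (p - 1))"
      by (rule mult_left_mono) simp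
    also have "\<dots> = ennreal (2 powr (r - 1)) * (mass W Q * epowr (mass S Q) (p - 1))"
      by (simp add: ac_simps)
    also have "\<dots> \<le> ennreal (2 powr (r - 1)) * (ennreal K * epowr ?q p)"
      by (intro mult_left_mono Ap_pair_le[OF ap] Q) simp
    also have "epowr ?q p = epowr ?q r * epowr ?q (p - r)"
      by (simp add: epowr_add)
    also have "ennreal (2 powr (r - 1)) * (ennreal K * (epowr ?q r * epowr ?q (p - r))) = ennreal (2 powr (r - 1) * K) * epowr ?q r * epowr ?q (p - r)"
      using K by (simp add: ennreal_mult mult.assoc)
    finally have "mass W Q * epowr (mass S' Q) (r - 1) * epowr ?q (p - r) \<le> ennreal (2 powr (r - 1) * K) * epowr ?q r * epowr ?q (p - r)"
      by (simp add: mult.assoc)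
    then show ?thesis by (rule ennreal_mult_le_cancel[OF _ q])
  qed
  have ae: "AE x in lebesgue. W x * epowr (S' x) (r - 1) = 1"
    using Ap_pair_AE[OF ap] by (simp add: S'_def epowr_epowr r1)
  have "Ap_pair r (2 powr (r - 1) * K) W S'"
    unfolding Ap_pair_def using r K by (intro conjI ballI le fin ae Ap_pair_finite(1)[OF ap]) auto
  then show ?thesis using that[of r _ S'] r rp by blast
qed

subsection \<open>The Rubio de Francia algorithm\<close>

text \<open>\<open>A\<close> is to be a bound for the norm of \<open>HL\<close>. The usual series
  has \<open>2 * A\<close> in place of \<open>4 * A\<close>; the additional \<open>(1/2) ^ k\<close>
  lets an elementary pointwise estimate replace Minkowski's inequality in
  \<open>rubio_norm_le\<close>.\<close>

definition rubio :: "real \<Rightarrow> ('a::euclidean_space \<Rightarrow> ennreal) \<Rightarrow> 'a \<Rightarrow> ennreal" where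
  "rubio A h x = (\<Sum>k. ennreal ((1 / (4 * A)) ^ k) * (HL ^^ k) h x)"

lemma measurable_HL_iterate [measurable]: "h \<in> borel_measurable lebesgue \<Longrightarrow> (HL ^^ k) h \<in> borel_measurable lebesgue"
  by (cases k) auto

lemma measurable_rubio [measurable]: "h \<in> borel_measurable lebesgue \<Longrightarrow> rubio A h \<in> borel_measurable lebesgue"
  unfolding rubio_def by measurable

lemma rubio_ge: "h x \<le> rubio A h x"
  using ennreal_le_suminf[of "\<lambda>k. ennreal ((1 / (4 * A)) ^ k) * (HL ^^ k) h x" 0] by (simp add: rubio_def)

text \<open>Applying \<open>HL\<close> term by term shifts the series by one index, at the price of
  \<open>4 * A\<close>. The estimate holds at every point, not only almost everywhere, which
  \<open>A1_pos\<close> depends on.\<close>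

lemma HL_rubio_le:
  assumes [measurable]: "h \<in> borel_measurable lebesgue" and A: "0 < A"
  shows "HL (rubio A h) x \<le> ennreal (4 * A) * rubio A h x"
proof (rule HL_least)
  fix Q :: "'a set" assume Q: "Q \<in> cubes" and x: "x \<in> interior Q"
  define c where "c k = ennreal ((1 / (4 * A)) ^ k)" for k
  define t where "t k = c k * (HL ^^ k) h x" for k
  have rubio: "rubio A h y = (\<Sum>k. c k * (HL ^^ k) h y)" for y
    by (simp add: rubio_def c_def)
  have c: "c k = ennreal (4 * A) * c (Suc k)" for k
    unfolding c_def using A by (subst ennreal_mult[symmetric]) auto
  have [measurable]: "Q \<in> sets lebesgue" using Q by (rule cubes_sets)
  have "mass (rubio A h) Q = (\<integral>\<^sup>+y. (\<Sum>k. c k * (HL ^^ k) h y * indicator Q y) \<partial>lebesgue)"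
    unfolding mass_def rubio by (intro nn_integral_cong) (simp add: ennreal_suminf_multc)
  also have "\<dots> = (\<Sum>k. (\<integral>\<^sup>+y. c k * (HL ^^ k) h y * indicator Q y \<partial>lebesgue))"
    by (intro nn_integral_suminf) measurable
  also have "\<dots> = (\<Sum>k. c k * mass ((HL ^^ k) h) Q)"
    unfolding mass_def by (simp add: mult.assoc nn_integral_cmult)
  also have "\<dots> \<le> (\<Sum>k. ennreal (4 * A) * emeasure lebesgue Q * t (Suc k))"
  proof (intro suminf_le summableI)
    fix k
    have "c k * mass ((HL ^^ k) h) Q \<le> c k * (HL ((HL ^^ k) h) x * emeasure lebesgue Q)"
      by (intro mult_left_mono HL_ge Q x) simp
    also have "\<dots> = ennreal (4 * A) * emeasure lebesgue Q * t (Suc k)"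
      unfolding t_def by (subst c) (simp add: ac_simps)
    finally show "c k * mass ((HL ^^ k) h) Q \<le> ennreal (4 * A) * emeasure lebesgue Q * t (Suc k)" .
  qed
  also have "\<dots> = ennreal (4 * A) * emeasure lebesgue Q * (\<Sum>k. t (Suc k))"
    by (rule ennreal_suminf_cmult)
  also have "\<dots> \<le> ennreal (4 * A) * emeasure lebesgue Q * rubio A h x"
  proof (intro mult_left_mono)
    have "rubio A h x = (\<Sum>k. t k)" by (simp add: rubio t_def)
    also have "\<dots> = (\<Sum>k. t (k + 1)) + (\<Sum>k<1. t k)" by (rule suminf_offset[OF summableI])
    finally show "(\<Sum>k. t (Suc k)) \<le> rubio A h x" by (simp add: add_increasing2)
  qed simp
  finally show "mass (rubio A h) Q \<le> ennreal (4 * A) * rubio A h x * emeasure lebesgue Q"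
    by (simp add: ac_simps)
qed

text \<open>Half of the decay is spent on the pointwise bound \<open>pt\<close>, the other half
  makes the moments of the \<open>b k\<close> summable.\<close>

lemma rubio_norm_le:
  assumes [measurable]: "h \<in> borel_measurable lebesgue" "W \<in> borel_measurable lebesgue" and A: "0 < A" and p: "1 \<le> p"
    and bound: "\<And>F. F \<in> borel_measurable lebesgue \<Longrightarrow>
     moment W p (HL F) \<le> ennreal (A powr p) * moment W p F"
  shows "moment W p (rubio A h) \<le> ennreal (2 powr p * 2) * moment W p h"
proof -
  let ?J = "\<integral>\<^sup>+x. W x * epowr (h x) p \<partial>lebesgue"
  have geo: "(\<Sum>k. ennreal ((1/2) ^ k)) = 2"
  proof -
    have "(\<Sum>k. ennreal ((1/2) ^ k)) = ennreal (\<Sum>k. (1/2) ^ k)"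
      by (intro suminf_ennreal2) (auto intro: summable_geometric)
    also have "(\<Sum>k. (1/2) ^ k) = (2::real)" by (subst suminf_geometric) auto
    finally show ?thesis by simp
  qed
  define b where "b k x = ennreal ((1 / (2 * A)) ^ k) * (HL ^^ k) h x" for k x
  have [measurable]: "b k \<in> borel_measurable lebesgue" for k unfolding b_def by measurable
  have pt: "epowr (rubio A h x) p \<le> ennreal (2 powr p) * (\<Sum>k. epowr (b k x) p)" for x
  proof -
    \<comment> \<open>The \<open>p\<close>-norm of the sequence of the \<open>b k x\<close>; it
      dominates every single term, and the weights \<open>(1/2) ^ k\<close> sum to 2.\<close>
    define s where "s = epowr (\<Sum>k. epowr (b k x) p) (1 / p)"
    have bs: "b k x \<le> s" for k
    proof -
      have "epowr (epowr (b k x) p) (1 / p) \<le> s"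
        unfolding s_def using p by (intro epowr_mono ennreal_le_suminf) auto
      then show ?thesis using p by (simp add: epowr_epowr)
    qed
    have "rubio A h x = (\<Sum>k. ennreal ((1/2) ^ k) * b k x)"
      unfolding rubio_def b_def using A
      by (intro suminf_cong) (simp add: mult.assoc[symmetric] ennreal_mult[symmetric] power_mult_distrib[symmetric] del: power_mult_distrib)
    also have "\<dots> \<le> (\<Sum>k. ennreal ((1/2) ^ k) * s)"
      by (intro suminf_le mult_left_mono bs summableI) simp
    also have "\<dots> = ennreal 2 * s"
      by (simp add: ennreal_suminf_multc geo)
    finally have "epowr (rubio A h x) p \<le> epowr (ennreal 2 * s) p"
      using p by (intro epowr_mono) auto
    also have "\<dots> = ennreal (2 powr p) * (\<Sum>k. epowr (b k x) p)"
      using p by (subst epowr_mult) (auto simp: epowr_ennreal s_def epowr_epowr simp del: ennreal_numeral)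
    finally show ?thesis .
  qed
  have it: "moment W p ((HL ^^ k) h) \<le> ennreal ((A powr p) ^ k) * ?J" for k
  proof (induction k)
    case (Suc k)
    have "moment W p ((HL ^^ Suc k) h) \<le> ennreal (A powr p) * moment W p ((HL ^^ k) h)"
      using bound[of "(HL ^^ k) h"] by simp
    also have "\<dots> \<le> ennreal (A powr p) * (ennreal ((A powr p) ^ k) * ?J)"
      by (intro mult_left_mono Suc) simp
    also have "\<dots> = ennreal ((A powr p) ^ Suc k) * ?J"
      by (simp add: ennreal_mult mult.assoc)
    finally show ?case .
  qed simp
  have term_le: "moment W p (b k) \<le> ennreal ((1/2) ^ k) * ?J" for k
  proof -
    let ?d = "((1 / (2 * A)) ^ k) powr p"
    have "moment W p (b k) = (\<integral>\<^sup>+x. ennreal ?d * (W x * epowr ((HL ^^ k) h x) p) \<partial>lebesgue)"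
    proof (intro nn_integral_cong)
      fix x
      have "epowr (b k x) p = ennreal ?d * epowr ((HL ^^ k) h x) p"
        unfolding b_def using p A by (subst epowr_mult) (auto simp: epowr_ennreal)
      then show "W x * epowr (b k x) p = ennreal ?d * (W x * epowr ((HL ^^ k) h x) p)"
        by (simp only: mult.left_commute)
    qed
    also have "\<dots> = ennreal ?d * moment W p ((HL ^^ k) h)"
      by (intro nn_integral_cmult) measurable
    also have "\<dots> \<le> ennreal ?d * (ennreal ((A powr p) ^ k) * ?J)"
      by (intro mult_left_mono it) simp
    also have "\<dots> = ennreal (?d * (A powr p) ^ k) * ?J"
      by (simp add: ennreal_mult mult.assoc)
    also have "?d * (A powr p) ^ k = ((1/2) powr p) ^ k"
    proof -
      have "?d = ((1 / (2 * A)) powr p) ^ k"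
        using A by (simp add: powr_power powr_realpow[symmetric] powr_powr mult.commute)
      then show ?thesis using A
        by (simp add: power_mult_distrib[symmetric] powr_mult[symmetric])
    qed
    also have "ennreal (((1/2) powr p) ^ k) * ?J \<le> ennreal ((1/2) ^ k) * ?J"
    proof (intro mult_right_mono ennreal_leI power_mono)
      show "(1/2) powr p \<le> (1/2 :: real)" using powr_mono'[of 1 p "1/2::real"] p by simp
    qed auto
    finally show ?thesis .
  qed
  have "moment W p (rubio A h) \<le> (\<integral>\<^sup>+x. ennreal (2 powr p) * (\<Sum>k. W x * epowr (b k x) p) \<partial>lebesgue)"
  proof (intro nn_integral_mono)
    fix x
    have "W x * epowr (rubio A h x) p \<le> W x * (ennreal (2 powr p) * (\<Sum>k. epowr (b k x) p))"
      by (intro mult_left_mono pt) simp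
    then show "W x * epowr (rubio A h x) p \<le> ennreal (2 powr p) * (\<Sum>k. W x * epowr (b k x) p)"
      by (simp add: ennreal_suminf_cmult mult.left_commute)
  qed
  also have "\<dots> = ennreal (2 powr p) * (\<integral>\<^sup>+x. (\<Sum>k. W x * epowr (b k x) p) \<partial>lebesgue)"
    by (intro nn_integral_cmult) measurable
  also have "(\<integral>\<^sup>+x. (\<Sum>k. W x * epowr (b k x) p) \<partial>lebesgue) = (\<Sum>k. \<integral>\<^sup>+x. W x * epowr (b k x) p \<partial>lebesgue)"
    by (intro nn_integral_suminf) measurable
  finally have 1: "moment W p (rubio A h) \<le> ennreal (2 powr p) * (\<Sum>k. \<integral>\<^sup>+x. W x * epowr (b k x) p \<partial>lebesgue)" .
  have "(\<Sum>k. \<integral>\<^sup>+x. W x * epowr (b k x) p \<partial>lebesgue) \<le> (\<Sum>k. ennreal ((1/2) ^ k) * ?J)"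
    by (intro suminf_le term_le summableI)
  also have "\<dots> = 2 * ?J" by (simp add: ennreal_suminf_multc geo)
  finally have "ennreal (2 powr p) * (\<Sum>k. \<integral>\<^sup>+x. W x * epowr (b k x) p \<partial>lebesgue) \<le> ennreal (2 powr p) * (2 * ?J)"
    by (rule mult_left_mono) simp
  with 1 show ?thesis by (auto simp: ennreal_mult mult.assoc intro: order_trans)
qed

text \<open>\<open>B\<close> and \<open>c\<close> are fixed before \<open>h\<close>. This uniformity
  is what keeps the constants of the weights in the extrapolation bounded.\<close>

theorem Rubio_de_Francia:
  fixes W S :: "'a::euclidean_space \<Rightarrow> ennreal"
  assumes ap: "Ap_pair p K W S"
  obtains B c where "0 < B" "0 < c" "\<And>h. h \<in> borel_measurable lebesgue \<Longrightarrow>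
    \<exists>H\<in>borel_measurable lebesgue. (\<forall>x. h x \<le> H x) \<and> (\<forall>x. HL H x \<le> ennreal c * H x) \<and>
      moment W p H \<le> ennreal B * moment W p h"
proof -
  note [measurable] = Ap_pair_measurable[OF ap]
  have p: "1 < p" by (rule Ap_pair_p[OF ap])
  obtain C where C: "0 < C" "\<And>F. F \<in> borel_measurable lebesgue \<Longrightarrow>
     moment W p (HL F) \<le> ennreal C * moment W p F"
    using HL_bounded_weighted[OF ap] by blast
  define A where "A = C powr (1 / p)"
  have A: "0 < A" "A powr p = C" using C p by (auto simp: A_def powr_powr)
  show ?thesis
  proof (rule that[of "2 powr p * 2" "4 * A"])
    fix h :: "'a \<Rightarrow> ennreal" assume h[measurable]: "h \<in> borel_measurable lebesgue"
    have "moment W p (rubio A h) \<le> ennreal (2 powr p * 2) * moment W p h"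
      using p A C by (intro rubio_norm_le) auto
    then show "\<exists>H\<in>borel_measurable lebesgue. (\<forall>x. h x \<le> H x) \<and> (\<forall>x. HL H x \<le> ennreal (4 * A) * H x) \<and>
      moment W p H \<le> ennreal (2 powr p * 2) * moment W p h"
      using A h HL_rubio_le[OF h A(1)] by (intro bexI[of _ "rubio A h"] conjI) (auto intro: rubio_ge)
  qed (use A in auto)
qed

text \<open>If \<open>H\<close> vanishes at \<open>x\<close>, so does \<open>HL H\<close>; then all
  cubes around \<open>x\<close> have mass 0, and these exhaust the space.\<close>

lemma A1_pos:
  fixes H :: "'a::euclidean_space \<Rightarrow> ennreal"
  assumes [measurable]: "H \<in> borel_measurable lebesgue" and le: "\<And>x. HL H x \<le> ennreal c * H x"
    and nz: "\<not> (AE x in lebesgue. H x = 0)"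
  shows "0 < H x"
proof (rule ccontr)
  assume "\<not> 0 < H x"
  then have 0: "HL H x = 0" using le[of x] by simp
  have "mass H (cb (x - (real n + 1) *\<^sub>R One, 2 * (real n + 1))) = 0" for n
  proof -
    let ?i = "(x - (real n + 1) *\<^sub>R One, 2 * (real n + 1))"
    have "x \<in> interior (cb ?i)"
      by (auto simp: cb_def interior_cbox mem_box inner_simps)
    then have "mass H (cb ?i) \<le> HL H x * emeasure lebesgue (cb ?i)"
      by (intro HL_ge cb_in_cubes) auto
    then show ?thesis using 0 by simp
  qed
  then have "AE y in lebesgue. \<forall>n. H y * indicator (cb (x - (real n + 1) *\<^sub>R One, 2 * (real n + 1))) y = 0"
    unfolding AE_all_countable mass_def by (subst (asm) nn_integral_0_iff_AE) auto
  then have "AE y in lebesgue. H y = 0"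
  proof eventually_elim
    case (elim y)
    obtain n where n: "norm (y - x) \<le> real n" using real_arch_simple by blast
    have "y \<in> cb (x - (real n + 1) *\<^sub>R One, 2 * (real n + 1))"
      unfolding cb_def mem_box
    proof
      fix b :: 'a assume b: "b \<in> Basis"
      have "\<bar>(y - x) \<bullet> b\<bar> \<le> real n" using Basis_le_norm[OF b, of "y - x"] n by linarith
      then show "fst (x - (real n + 1) *\<^sub>R One, 2 * (real n + 1)) \<bullet> b \<le> y \<bullet> b \<and>
        y \<bullet> b \<le> (fst (x - (real n + 1) *\<^sub>R One, 2 * (real n + 1)) + snd (x - (real n + 1) *\<^sub>R One, 2 * (real n + 1)) *\<^sub>R One) \<bullet> b"
        using b by (simp add: inner_simps abs_le_iff algebra_simps)
    qed
    with elim[rule_format, of n] show ?case by simp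
  qed
  with nz show False by simp
qed

subsection \<open>Extrapolation\<close>

text \<open>Local boundedness says nothing about \<open>\<phi> 0\<close>, while the argument that
  will be inserted is only known to be nonnegative. So the value at 0 enters the maximum
  separately.\<close>

lemma locally_bounded_bound:
  assumes "locally_bounded \<phi>"
  obtains M where "0 < M" "\<And>t. 0 \<le> t \<Longrightarrow> t \<le> K \<Longrightarrow> \<phi> t \<le> M"
proof -
  have "bdd_above (\<phi> ` {0<..<\<bar>K\<bar> + 1})" using assms by (auto simp: locally_bounded_def)
  then obtain b where "\<forall>y\<in>\<phi> ` {0<..<\<bar>K\<bar> + 1}. y \<le> b"
    unfolding bdd_above_def by (rule exE)
  then have b: "\<phi> t \<le> b" if "0 < t" "t < \<bar>K\<bar> + 1" for t
    using that by simp
  have "\<phi> t \<le> max 1 (max b (\<phi> 0))" if "0 \<le> t" "t \<le> K" for t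
    using b[of t] that by (cases "t = 0") (auto simp: le_max_iff_disj)
  then show ?thesis by (intro that[of "max 1 (max b (\<phi> 0))"]) auto
qed

text \<open>The easy half of Jones' factorization theorem.\<close>
lemma A1_factors_Ap:
  fixes H1 H2 :: "'a::euclidean_space \<Rightarrow> ennreal"
  assumes p0: "1 \<le> p0" and [measurable]: "H1 \<in> borel_measurable lebesgue" "H2 \<in> borel_measurable lebesgue"
    and pos: "\<And>x. 0 < H1 x" "\<And>x. 0 < H2 x"
    and fin: "AE x in lebesgue. H1 x < \<infinity>" "AE x in lebesgue. H2 x < \<infinity>"
    and c: "0 < c1" "0 < c2"
    and HL: "\<And>x. HL H1 x \<le> ennreal c1 * H1 x" "\<And>x. HL H2 x \<le> ennreal c2 * H2 x"
  defines "u \<equiv> \<lambda>x. enn2real (H1 x) powr (1 - p0) * enn2real (H2 x)"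
  shows "u \<in> Ap p0" "Ap_const p0 u \<le> ennreal (c1 powr (p0 - 1) * c2)"
proof -
  have um[measurable]: "u \<in> borel_measurable lebesgue" unfolding u_def by measurable
  have upos: "AE x in lebesgue. 0 < u x"
    using fin
  proof eventually_elim
    case (elim x)
    then have "0 < enn2real (H1 x)" "0 < enn2real (H2 x)"
      using pos[of x] by (auto simp: enn2real_positive_iff)
    then show ?case by (simp add: u_def)
  qed
  \<comment> \<open>\<open>a\<close> is the average of \<open>H\<close> over \<open>Q\<close>, as a
    real number, and the last conjunct is the \<open>A\<^sub>1\<close> condition. A point of the
    interior with a finite value of \<open>H\<close> shows that the average is finite.\<close>
  have avg_fin: "\<exists>a. mass H Q = ennreal (a * enn2real (emeasure lebesgue Q)) \<and> 0 < a \<and> (\<forall>x\<in>interior Q. H x < \<infinity> \<longrightarrow> a \<le> c * enn2real (H x))"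
    if Q: "Q \<in> cubes" and H[measurable]: "H \<in> borel_measurable lebesgue" and Hp: "\<And>x. 0 < H x" and Hf: "AE x in lebesgue. H x < \<infinity>" and c: "0 < c"
      and HLc: "\<And>x. HL H x \<le> ennreal c * H x"
    for Q H c
  proof -
    let ?q = "emeasure lebesgue Q"
    obtain q where q: "?q = ennreal q" "0 < q"
      using emeasure_cubes_pos[OF Q] emeasure_cubes_finite[OF Q] by (cases ?q) auto
    have le: "mass H Q \<le> ennreal c * H x * ?q" if "x \<in> interior Q" for x
      by (rule order_trans[OF HL_ge[OF Q that] mult_right_mono[OF HLc]]) simp
    have "\<exists>x\<in>interior Q. H x < \<infinity>"
    proof (rule ccontr)
      assume "\<not> (\<exists>x\<in>interior Q. H x < \<infinity>)"
      with Hf have "AE x in lebesgue. x \<notin> interior Q" by (auto elim!: eventually_mono)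
      with AE_cube_interior[OF Q] have "AE x in lebesgue. x \<notin> Q" by eventually_elim auto
      then have "?q = 0"
        using Q by (subst AE_iff_measurable[symmetric, where P="\<lambda>x. x \<notin> Q"]) (auto simp: cubes_sets)
      with q show False by simp
    qed
    then obtain x where x: "x \<in> interior Q" "H x < \<infinity>" by blast
    have "mass H Q < \<infinity>"
      using x q by (intro le_less_trans[OF le[OF x(1)]]) (auto simp: ennreal_mult_less_top)
    moreover have "0 < mass H Q" using Hp by (intro mass_cubes_pos Q) auto
    ultimately obtain m where m: "mass H Q = ennreal m" "0 < m" by (cases "mass H Q") auto
    have "m / q \<le> c * enn2real (H x)" if "x \<in> interior Q" "H x < \<infinity>" for x
    proof -
      note xQ = that
      obtain r where r: "H x = ennreal r" "0 \<le> r" using xQ(2) by (cases "H x") auto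
      have "ennreal m \<le> ennreal (c * r * q)"
        using le[OF xQ(1)] m q r c by (simp add: ennreal_mult)
      then have "m \<le> c * r * q" using r q c by (subst (asm) ennreal_le_iff) auto
      then show ?thesis using r q by (simp add: pos_divide_le_eq)
    qed
    then show ?thesis using m q by (intro exI[of _ "m / q"]) auto
  qed
  \<comment> \<open>In each estimate the function with the negative exponent is replaced by its
    lower bound on the cube, \<open>a / c1\<close> or \<open>b / c2\<close>, and the other one is
    averaged if it is present.\<close>
  have cube_bound: "avg Q u \<le> ennreal (c1 powr (p0 - 1) * a powr (1 - p0) * b)"
      "p0 \<noteq> 1 \<Longrightarrow> avg Q (\<lambda>x. u x powr (- 1 / (p0 - 1))) \<le> ennreal (a * (b / c2) powr (- 1 / (p0 - 1)))"
      "p0 = 1 \<Longrightarrow> esssup (lebesgue_on Q) (\<lambda>x. ennreal (inverse (u x))) \<le> ennreal (c2 / b)"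
    if Q: "Q \<in> cubes" and ab: "0 < a" "0 < b"
      "mass H1 Q = ennreal (a * enn2real (emeasure lebesgue Q))" "mass H2 Q = ennreal (b * enn2real (emeasure lebesgue Q))"
      "\<forall>x\<in>interior Q. H1 x < \<infinity> \<longrightarrow> a \<le> c1 * enn2real (H1 x)" "\<forall>x\<in>interior Q. H2 x < \<infinity> \<longrightarrow> b \<le> c2 * enn2real (H2 x)"
    for Q a b
  proof -
    let ?q = "emeasure lebesgue Q"
    have [measurable]: "Q \<in> sets lebesgue" using Q by (rule cubes_sets)
    obtain q where q: "?q = ennreal q" "0 < q"
      using emeasure_cubes_pos[OF Q] emeasure_cubes_finite[OF Q] by (cases ?q) auto
    have AE: "AE x in lebesgue. x \<in> Q \<longrightarrow> (\<exists>r s. H1 x = ennreal r \<and> H2 x = ennreal s \<and> 0 < r \<and> 0 < s \<and> a / c1 \<le> r \<and> b / c2 \<le> s \<and> u x = r powr (1 - p0) * s)"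
      using fin AE_cube_interior[OF Q]
    proof eventually_elim
      case (elim x)
      show ?case
      proof
        assume "x \<in> Q"
        with elim have x: "x \<in> interior Q" by simp
        obtain r where r: "H1 x = ennreal r" "0 \<le> r" using elim by (cases "H1 x") auto
        obtain s where s: "H2 x = ennreal s" "0 \<le> s" using elim by (cases "H2 x") auto
        have "0 < r" "0 < s" using pos[of x] r s by auto
        moreover have "a / c1 \<le> r" "b / c2 \<le> s"
          using ab(5,6) x elim r s c by (auto simp: pos_divide_le_eq mult.commute)
        ultimately show "\<exists>r s. H1 x = ennreal r \<and> H2 x = ennreal s \<and> 0 < r \<and> 0 < s \<and> a / c1 \<le> r \<and> b / c2 \<le> s \<and> u x = r powr (1 - p0) * s"
          using r s by (intro exI[of _ r] exI[of _ s]) (auto simp: u_def)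
      qed
    qed
    have "mass (\<lambda>x. ennreal (u x)) Q \<le> mass (\<lambda>x. ennreal (c1 powr (p0 - 1) * a powr (1 - p0)) * H2 x) Q"
    proof (rule mass_mono_AE)
      show "AE x in lebesgue. x \<in> Q \<longrightarrow> ennreal (u x) \<le> ennreal (c1 powr (p0 - 1) * a powr (1 - p0)) * H2 x"
        using AE
      proof eventually_elim
        case (elim x)
        show ?case
        proof
          assume "x \<in> Q"
          with elim obtain r s where rs: "H2 x = ennreal s" "0 < r" "0 < s" "a / c1 \<le> r" "u x = r powr (1 - p0) * s"
            by blast
          have "r powr (1 - p0) \<le> (a / c1) powr (1 - p0)"
            using p0 rs ab c by (intro powr_mono2') auto
          also have "\<dots> = c1 powr (p0 - 1) * a powr (1 - p0)"
            using ab c by (simp add: powr_divide powr_minus_divide[symmetric] field_simps powr_diff)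
          finally have "u x \<le> c1 powr (p0 - 1) * a powr (1 - p0) * s"
            using rs by (simp add: mult_right_mono)
          then show "ennreal (u x) \<le> ennreal (c1 powr (p0 - 1) * a powr (1 - p0)) * H2 x"
            using rs by (simp add: ennreal_mult[symmetric] ennreal_leI)
        qed
      qed
    qed
    also have "\<dots> = ennreal (c1 powr (p0 - 1) * a powr (1 - p0)) * ennreal (b * q)"
      using ab(4) q by (subst mass_cmult) auto
    also have "\<dots> = ennreal (c1 powr (p0 - 1) * a powr (1 - p0) * b) * ?q"
      using ab q by (simp add: ennreal_mult[symmetric] mult.assoc)
    finally show "avg Q u \<le> ennreal (c1 powr (p0 - 1) * a powr (1 - p0) * b)"
      unfolding avg_def mass_def[symmetric] using q by (subst ennreal_divide_le_iff) auto
    show "avg Q (\<lambda>x. u x powr (- 1 / (p0 - 1))) \<le> ennreal (a * (b / c2) powr (- 1 / (p0 - 1)))" if "p0 \<noteq> 1"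
    proof -
      have p1: "1 < p0" using p0 that by simp
      have "mass (\<lambda>x. ennreal (u x powr (- 1 / (p0 - 1)))) Q \<le> mass (\<lambda>x. ennreal ((b / c2) powr (- 1 / (p0 - 1))) * H1 x) Q"
      proof (rule mass_mono_AE)
        show "AE x in lebesgue. x \<in> Q \<longrightarrow> ennreal (u x powr (- 1 / (p0 - 1))) \<le> ennreal ((b / c2) powr (- 1 / (p0 - 1))) * H1 x"
          using AE
        proof eventually_elim
          case (elim x)
          show ?case
          proof
            assume "x \<in> Q"
            with elim obtain r s where rs: "H1 x = ennreal r" "0 < r" "0 < s" "b / c2 \<le> s" "u x = r powr (1 - p0) * s"
              by blast
            have e: "(1 - p0) * (- 1 / (p0 - 1)) = 1" using p1 by (simp add: field_simps)
            have "u x powr (- 1 / (p0 - 1)) = r powr ((1 - p0) * (- 1 / (p0 - 1))) * s powr (- 1 / (p0 - 1))"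
              unfolding rs(5) using rs by (subst powr_mult) (auto simp only: powr_powr powr_ge_zero)
            also have "\<dots> = r * s powr (- 1 / (p0 - 1))" unfolding e using rs by simp
            also have "\<dots> \<le> r * (b / c2) powr (- 1 / (p0 - 1))"
              using rs ab c p1 by (intro mult_left_mono powr_mono2') auto
            finally show "ennreal (u x powr (- 1 / (p0 - 1))) \<le> ennreal ((b / c2) powr (- 1 / (p0 - 1))) * H1 x"
              using rs by (simp add: ennreal_mult[symmetric] ennreal_leI mult.commute)
          qed
        qed
      qed
      also have "\<dots> = ennreal ((b / c2) powr (- 1 / (p0 - 1))) * ennreal (a * q)"
        using ab(3) q by (subst mass_cmult) auto
      also have "\<dots> = ennreal (a * (b / c2) powr (- 1 / (p0 - 1))) * ?q"
        using ab q by (simp add: ennreal_mult[symmetric] ac_simps)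
      finally show ?thesis
        unfolding avg_def mass_def[symmetric] using q by (subst ennreal_divide_le_iff) auto
    qed
    show "esssup (lebesgue_on Q) (\<lambda>x. ennreal (inverse (u x))) \<le> ennreal (c2 / b)" if "p0 = 1"
    proof (rule esssup_I)
      show "(\<lambda>x. ennreal (inverse (u x))) \<in> borel_measurable (lebesgue_on Q)"
        by (intro measurable_restrict_space1) measurable
      have "AE x in lebesgue. x \<in> Q \<longrightarrow> ennreal (inverse (u x)) \<le> ennreal (c2 / b)"
        using AE
      proof eventually_elim
        case (elim x)
        show ?case
        proof
          assume "x \<in> Q"
          with elim obtain r s where rs: "0 < r" "0 < s" "b / c2 \<le> s" "u x = r powr (1 - p0) * s"
            by blast
          then have "u x = s" using that by simp
          then have "inverse (u x) \<le> inverse (b / c2)" using rs ab c by (intro le_imp_inverse_le) auto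
          then show "ennreal (inverse (u x)) \<le> ennreal (c2 / b)" by (intro ennreal_leI) simp
        qed
      qed
      then show "AE x in lebesgue_on Q. ennreal (inverse (u x)) \<le> ennreal (c2 / b)"
        by (subst AE_restrict_space_iff) auto
    qed
  qed
  have wt: "weight u"
    unfolding weight_def
  proof (intro conjI ballI um upos)
    fix Q :: "'a set" assume Q: "Q \<in> cubes"
    obtain a where a: "mass H1 Q = ennreal (a * enn2real (emeasure lebesgue Q))" "0 < a" "\<forall>x\<in>interior Q. H1 x < \<infinity> \<longrightarrow> a \<le> c1 * enn2real (H1 x)"
      using avg_fin[OF Q _ pos(1) fin(1) c(1) HL(1)] by auto
    obtain b where b: "mass H2 Q = ennreal (b * enn2real (emeasure lebesgue Q))" "0 < b" "\<forall>x\<in>interior Q. H2 x < \<infinity> \<longrightarrow> b \<le> c2 * enn2real (H2 x)"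
      using avg_fin[OF Q _ pos(2) fin(2) c(2) HL(2)] by auto
    have "avg Q u < \<infinity>"
      using cube_bound(1)[OF Q a(2) b(2) a(1) b(1) a(3) b(3)] by (rule le_less_trans) simp
    then show "(\<integral>\<^sup>+x\<in>Q. ennreal (u x) \<partial>lebesgue) < \<infinity>"
      using emeasure_cubes_finite[OF Q] by (auto simp: avg_def ennreal_top_divide less_top[symmetric])
  qed
  show const: "Ap_const p0 u \<le> ennreal (c1 powr (p0 - 1) * c2)"
  proof (cases "p0 = 1")
    case True
    have bd: "avg Q u * esssup (lebesgue_on Q) (\<lambda>x. ennreal (inverse (u x))) \<le> ennreal (c1 powr (p0 - 1) * c2)" if Q: "Q \<in> cubes" for Q
    proof -
      obtain a where a: "mass H1 Q = ennreal (a * enn2real (emeasure lebesgue Q))" "0 < a" "\<forall>x\<in>interior Q. H1 x < \<infinity> \<longrightarrow> a \<le> c1 * enn2real (H1 x)"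
        using avg_fin[OF Q _ pos(1) fin(1) c(1) HL(1)] by auto
      obtain b where b: "mass H2 Q = ennreal (b * enn2real (emeasure lebesgue Q))" "0 < b" "\<forall>x\<in>interior Q. H2 x < \<infinity> \<longrightarrow> b \<le> c2 * enn2real (H2 x)"
        using avg_fin[OF Q _ pos(2) fin(2) c(2) HL(2)] by auto
      note cb = cube_bound[OF Q a(2) b(2) a(1) b(1) a(3) b(3)]
      have bd: "avg Q u * esssup (lebesgue_on Q) (\<lambda>x. ennreal (inverse (u x))) \<le> ennreal (c1 powr (p0 - 1) * a powr (1 - p0) * b) * ennreal (c2 / b)"
        by (intro mult_mono cb(1) cb(3) True) auto
      also have "\<dots> = ennreal (c1 powr (p0 - 1) * c2)"
        using True a b c by (simp add: ennreal_mult[symmetric])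
      finally show ?thesis .
    qed
    have "(SUP Q\<in>cubes. avg Q u * esssup (lebesgue_on Q) (\<lambda>x. ennreal (inverse (u x)))) \<le> ennreal (c1 powr (p0 - 1) * c2)"
      by (rule SUP_least[OF bd])
    then show ?thesis using True by (simp only: Ap_const_def if_True simp_thms)
  next
    case False
    have bd: "avg Q u * epowr (avg Q (\<lambda>x. u x powr (- 1 / (p0 - 1)))) (p0 - 1) \<le> ennreal (c1 powr (p0 - 1) * c2)" if Q: "Q \<in> cubes" for Q
    proof -
      have p1: "1 < p0" using p0 False by simp
      obtain a where a: "mass H1 Q = ennreal (a * enn2real (emeasure lebesgue Q))" "0 < a" "\<forall>x\<in>interior Q. H1 x < \<infinity> \<longrightarrow> a \<le> c1 * enn2real (H1 x)"
        using avg_fin[OF Q _ pos(1) fin(1) c(1) HL(1)] by auto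
      obtain b where b: "mass H2 Q = ennreal (b * enn2real (emeasure lebesgue Q))" "0 < b" "\<forall>x\<in>interior Q. H2 x < \<infinity> \<longrightarrow> b \<le> c2 * enn2real (H2 x)"
        using avg_fin[OF Q _ pos(2) fin(2) c(2) HL(2)] by auto
      note cb = cube_bound[OF Q a(2) b(2) a(1) b(1) a(3) b(3)]
      have e: "- 1 / (p0 - 1) * (p0 - 1) = -1" using p1 by simp
      have "(a * (b / c2) powr (- 1 / (p0 - 1))) powr (p0 - 1) = a powr (p0 - 1) * (b / c2) powr (- 1 / (p0 - 1) * (p0 - 1))"
        using a by (subst powr_mult) (auto simp only: powr_powr powr_ge_zero less_imp_le)
      also have "\<dots> = a powr (p0 - 1) * (c2 / b)"
        unfolding e using b c by (simp add: powr_minus)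
      finally have pw: "epowr (ennreal (a * (b / c2) powr (- 1 / (p0 - 1)))) (p0 - 1) = ennreal (a powr (p0 - 1) * (c2 / b))"
        using a by (subst epowr_ennreal) auto
      have "avg Q u * epowr (avg Q (\<lambda>x. u x powr (- 1 / (p0 - 1)))) (p0 - 1) \<le>
        ennreal (c1 powr (p0 - 1) * a powr (1 - p0) * b) * epowr (ennreal (a * (b / c2) powr (- 1 / (p0 - 1)))) (p0 - 1)"
        using p1 by (intro mult_mono epowr_mono cb(1) cb(2) False) auto
      also have "\<dots> = ennreal (c1 powr (p0 - 1) * a powr (1 - p0) * b * (a powr (p0 - 1) * (c2 / b)))"
        unfolding pw using a b c by (intro ennreal_mult[symmetric]) auto
      \<comment> \<open>The averages \<open>a\<close> and \<open>b\<close> cancel, which makes the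
        bound independent of the cube.\<close>
      also have "c1 powr (p0 - 1) * a powr (1 - p0) * b * (a powr (p0 - 1) * (c2 / b)) = c1 powr (p0 - 1) * c2 * (a powr (1 - p0) * a powr (p0 - 1))"
        using b by (simp add: field_simps)
      also have "a powr (1 - p0) * a powr (p0 - 1) = 1" using a by (simp add: powr_add[symmetric])
      finally show ?thesis by simp
    qed
    have "(SUP Q\<in>cubes. avg Q u * epowr (avg Q (\<lambda>x. u x powr (- 1 / (p0 - 1)))) (p0 - 1)) \<le> ennreal (c1 powr (p0 - 1) * c2)"
      by (rule SUP_least[OF bd])
    then show ?thesis using False by (simp only: Ap_const_def if_False simp_thms)
  qed
  then show "u \<in> Ap p0" using wt by (auto simp: Ap_def intro: le_less_trans)
qed

section \<open>Weak type bounds by extrapolation\<close>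

lemma Lp_norm_weighted:
  fixes f :: "'a::euclidean_space \<Rightarrow> 'b::real_normed_vector"
  assumes [measurable]: "u \<in> borel_measurable lebesgue" "(\<lambda>x. norm (f x)) \<in> borel_measurable lebesgue"
  shows "Lp_norm p (weighted u) f = epowr (\<integral>\<^sup>+x. ennreal (u x) * epowr (ennreal (norm (f x))) p \<partial>lebesgue) (1 / p)"
  unfolding Lp_norm_def weighted_def by (subst nn_integral_density) (auto simp: epowr_ennreal)

lemma weak_Lp_norm_weighted:
  fixes g :: "'a::euclidean_space \<Rightarrow> 'b::real_normed_vector"
  assumes [measurable]: "u \<in> borel_measurable lebesgue" "(\<lambda>x. norm (g x)) \<in> borel_measurable lebesgue" and y: "0 < y"
  shows "ennreal y * epowr (mass (\<lambda>x. ennreal (u x)) {x. y < norm (g x)}) (1 / p) \<le> weak_Lp_norm p (weighted u) g"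
proof -
  have "{x \<in> space lebesgue. y < norm (g x)} \<in> sets lebesgue" by measurable
  then have "mass (\<lambda>x. ennreal (u x)) {x. y < norm (g x)} = emeasure (weighted u) {x \<in> space (weighted u). norm (g x) > y}"
    by (simp add: weighted_def mass_emeasure)
  then show ?thesis
    unfolding weak_Lp_norm_def using y by (intro SUP_upper2[of y]) auto
qed

context
  fixes p0 p K K0 C1 B1 B2 c1 c2 \<Phi> :: real and \<phi> :: "real \<Rightarrow> real"
    and D :: "('a::euclidean_space \<Rightarrow> 'b::{real_normed_field,second_countable_topology}) set"
    and T :: "('a \<Rightarrow> 'b) \<Rightarrow> ('a \<Rightarrow> 'b)"
    and W S :: "'a \<Rightarrow> ennreal" and f :: "'a \<Rightarrow> 'b"
    and H1 H2 :: "'a \<Rightarrow> ennreal" and E :: "'a set" and J :: ennreal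
  assumes p0: "1 \<le> p0"
    and sub: "sublinear_operator D T"
    and hyp: "\<And>u. u \<in> Ap p0 \<Longrightarrow>
           bounded_operator D T (Lp_norm p0 (weighted u)) (weak_Lp_norm p0 (weighted u))
             (\<phi> (enn2real (Ap_const p0 u)))"
    and ap: "Ap_pair p K W S"
    and c: "0 < c1" "0 < c2" "0 < B1" "0 < B2"
    and \<Phi>: "0 < \<Phi>" "\<And>t. 0 \<le> t \<Longrightarrow> t \<le> c1 powr (p0 - 1) * c2 \<Longrightarrow> \<phi> t \<le> \<Phi>"
    and fm[measurable]: "f \<in> borel_measurable lebesgue"
    and H1m[measurable]: "H1 \<in> borel_measurable lebesgue" and H2m[measurable]: "H2 \<in> borel_measurable lebesgue"
    and E[measurable]: "E \<in> sets lebesgue"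
    and m: "0 < mass W E" "mass W E < \<infinity>" and J: "J < \<infinity>"
    and H1: "\<And>x. HL H1 x \<le> ennreal c1 * H1 x" "\<not> (AE x in lebesgue. H1 x = 0)" "\<And>x. ennreal (norm (f x)) \<le> H1 x"
      "moment W p H1 \<le> ennreal B1 * J"
    and H2: "\<And>x. HL H2 x \<le> ennreal c2 * H2 x" "\<And>x. W x * indicator E x \<le> H2 x"
      "moment S (p / (p - 1)) H2 \<le> ennreal B2 * mass W E"
begin

text \<open>The extrapolation step for fixed majorants. The integral \<open>X\<close> of
  \<open>H1 x * H2 x\<close> bounds the \<open>p0\<close>-moment of \<open>f\<close> with respect to
  \<open>u\<close>, appears again when the mass of \<open>E\<close> is compared with its
  \<open>u\<close>-mass, and is itself bounded by Hoelder's inequality for the pair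
  \<open>W\<close>, \<open>S\<close>.\<close>

lemma extrapolation_aux:
  "f \<in> D \<and> (\<forall>y>0. E \<subseteq> {x. y < norm (T f x)} \<longrightarrow>
     ennreal (y powr p) * mass W E \<le> ennreal ((\<Phi> * B1 powr (1 / p) * B2 powr (1 - 1 / p)) powr p) * J)"
proof -
  note [measurable] = Ap_pair_measurable[OF ap]
  have p: "1 < p" by (rule Ap_pair_p[OF ap])
  define u where "u = (\<lambda>x. enn2real (H1 x) powr (1 - p0) * enn2real (H2 x))"
  have um[measurable]: "u \<in> borel_measurable lebesgue" unfolding u_def by measurable
  define X where "X = (\<integral>\<^sup>+x. H1 x * H2 x \<partial>lebesgue)"
  have fin1: "AE x in lebesgue. H1 x < \<infinity>"
  proof -
    have "moment W p H1 \<noteq> \<infinity>"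
      using H1(4) J c by (auto simp: ennreal_mult_eq_top_iff top_unique)
    then have "AE x in lebesgue. W x * epowr (H1 x) p \<noteq> \<infinity>"
      by (intro nn_integral_PInf_AE) auto
    then show ?thesis using Ap_pair_AE_pos[OF ap]
      by eventually_elim (auto simp: ennreal_mult_eq_top_iff less_top)
  qed
  have fin2: "AE x in lebesgue. H2 x < \<infinity>"
  proof -
    have "moment S (p / (p - 1)) H2 \<noteq> \<infinity>"
      using H2(3) m c by (auto simp: ennreal_mult_eq_top_iff top_unique)
    then have "AE x in lebesgue. S x * epowr (H2 x) (p / (p - 1)) \<noteq> \<infinity>"
      by (intro nn_integral_PInf_AE) auto
    then show ?thesis using Ap_pair_AE_pos[OF ap]
      by eventually_elim (auto simp: ennreal_mult_eq_top_iff less_top)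
  qed
  have pos1: "0 < H1 x" for x by (rule A1_pos[OF H1m H1(1,2)])
  have nz2: "\<not> (AE x in lebesgue. H2 x = 0)"
  proof
    assume "AE x in lebesgue. H2 x = 0"
    then have "mass W E = (\<integral>\<^sup>+x. 0 \<partial>(lebesgue :: 'a measure))"
      unfolding mass_def
    proof (intro nn_integral_cong_AE, eventually_elim)
      case (elim x)
      then show ?case using H2(2)[of x] by simp
    qed
    with m show False by simp
  qed
  have pos2: "0 < H2 x" for x by (rule A1_pos[OF H2m H2(1) nz2])
  have uAp: "u \<in> Ap p0" and uc: "Ap_const p0 u \<le> ennreal (c1 powr (p0 - 1) * c2)"
    using A1_factors_Ap[OF p0 H1m H2m pos1 pos2 fin1 fin2 c(1,2) H1(1) H2(1)] by (simp_all add: u_def)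
  have "enn2real (Ap_const p0 u) \<le> c1 powr (p0 - 1) * c2"
    using c by (intro enn2real_leI uc) auto
  then have \<phi>le: "\<phi> (enn2real (Ap_const p0 u)) \<le> \<Phi>" by (intro \<Phi>) auto
  have X_le: "X \<le> epowr (ennreal B1 * J) (1 / p) * epowr (ennreal B2 * mass W E) (1 - 1 / p)"
  proof -
    have "X = (\<integral>\<^sup>+x. epowr (W x * epowr (H1 x) p) (1 / p) * epowr (S x * epowr (H2 x) (p / (p - 1))) (1 - 1 / p) \<partial>lebesgue)"
      unfolding X_def
    proof (rule nn_integral_cong_AE)
      show "AE x in lebesgue. H1 x * H2 x = epowr (W x * epowr (H1 x) p) (1 / p) * epowr (S x * epowr (H2 x) (p / (p - 1))) (1 - 1 / p)"
        using Ap_pair_AE[OF ap]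
      proof eventually_elim
        case (elim x)
        have e: "p * (1 / p) = 1" "p / (p - 1) * (1 - 1 / p) = 1" "(p - 1) * (1 / p) = 1 - 1 / p"
          using p by (auto simp: field_simps)
        have "epowr (W x * epowr (S x) (p - 1)) (1 / p) = 1" using elim by simp
        then have 1: "epowr (W x) (1 / p) * epowr (S x) (1 - 1 / p) = 1"
          using p by (subst (asm) epowr_mult) (auto simp only: epowr_epowr e zero_less_divide_1_iff)
        have "epowr (W x * epowr (H1 x) p) (1 / p) * epowr (S x * epowr (H2 x) (p / (p - 1))) (1 - 1 / p) =
          (epowr (W x) (1 / p) * H1 x) * (epowr (S x) (1 - 1 / p) * H2 x)"
          using p by (simp add: epowr_mult epowr_epowr e del: times_divide_eq_left times_divide_eq_right)
        also have "\<dots> = (epowr (W x) (1 / p) * epowr (S x) (1 - 1 / p)) * (H1 x * H2 x)"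
          by (simp only: ac_simps)
        finally show ?case unfolding 1 by simp
      qed
    qed
    also have "\<dots> \<le> epowr (moment W p H1) (1 / p) * epowr (moment S (p / (p - 1)) H2) (1 - 1 / p)"
      using p by (intro nn_integral_Holder) auto
    also have "\<dots> \<le> epowr (ennreal B1 * J) (1 / p) * epowr (ennreal B2 * mass W E) (1 - 1 / p)"
      using p by (intro mult_mono epowr_mono H1(4) H2(3)) auto
    finally show ?thesis .
  qed
  have X_fin: "X < \<infinity>"
    using J m by (intro le_less_trans[OF X_le]) (auto simp: ennreal_mult_less_top)
  \<comment> \<open>As \<open>f\<close> is dominated by \<open>H1\<close>, its power
    \<open>p0\<close> times \<open>H1 powr (1 - p0)\<close> is at most \<open>H1\<close>.\<close>
  have J0: "(\<integral>\<^sup>+x. ennreal (u x) * epowr (ennreal (norm (f x))) p0 \<partial>lebesgue) \<le> X"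
    unfolding X_def
  proof (rule nn_integral_mono_AE)
    show "AE x in lebesgue. ennreal (u x) * epowr (ennreal (norm (f x))) p0 \<le> H1 x * H2 x"
      using fin1 fin2
    proof eventually_elim
      case (elim x)
      obtain r where r: "H1 x = ennreal r" "0 \<le> r" using elim by (cases "H1 x") auto
      obtain s where s: "H2 x = ennreal s" "0 \<le> s" using elim by (cases "H2 x") auto
      have "0 < r" using pos1[of x] r by simp
      have "norm (f x) \<le> r" using H1(3)[of x] r by (simp add: ennreal_le_iff)
      then have "norm (f x) powr p0 \<le> r powr p0" using p0 by (intro powr_mono2) auto
      then have "r powr (1 - p0) * s * norm (f x) powr p0 \<le> r powr (1 - p0) * s * r powr p0"
        using s by (intro mult_left_mono) auto
      also have "\<dots> = r * s" using \<open>0 < r\<close> by (simp add: powr_diff)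
      finally show ?case
        using r s by (simp add: u_def epowr_ennreal ennreal_mult[symmetric] ennreal_leI)
    qed
  qed
  have bo: "bounded_operator D T (Lp_norm p0 (weighted u)) (weak_Lp_norm p0 (weighted u)) (\<phi> (enn2real (Ap_const p0 u)))"
    by (rule hyp[OF uAp])
  have Lp: "Lp_norm p0 (weighted u) f \<le> epowr X (1 / p0)"
    using p0 J0 by (subst Lp_norm_weighted) (auto intro!: epowr_mono)
  also have "\<dots> < \<infinity>" using X_fin by simp
  finally have fD: "f \<in> D" and weak: "weak_Lp_norm p0 (weighted u) (T f) \<le> ennreal (\<phi> (enn2real (Ap_const p0 u))) * Lp_norm p0 (weighted u) f"
    using bo fm by (auto simp: bounded_operator_def)
  have Tm[measurable]: "T f \<in> borel_measurable lebesgue" using sub fD by (auto simp: sublinear_operator_def)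
  have "ennreal (y powr p) * mass W E \<le> ennreal ((\<Phi> * B1 powr (1 / p) * B2 powr (1 - 1 / p)) powr p) * J"
    if y: "0 < y" and EE: "E \<subseteq> {x. y < norm (T f x)}" for y
  proof -
    let ?U = "\<lambda>x. ennreal (u x)"
    have "ennreal y * epowr (mass ?U E) (1 / p0) \<le> ennreal y * epowr (mass ?U {x. y < norm (T f x)}) (1 / p0)"
      using p0 by (intro mult_left_mono epowr_mono mass_mono_set EE) auto
    also have "\<dots> \<le> weak_Lp_norm p0 (weighted u) (T f)"
      using y by (intro weak_Lp_norm_weighted) auto
    also have "\<dots> \<le> ennreal (\<phi> (enn2real (Ap_const p0 u))) * Lp_norm p0 (weighted u) f" by (rule weak)
    also have "\<dots> \<le> ennreal \<Phi> * epowr X (1 / p0)"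
      by (intro mult_mono ennreal_leI \<phi>le Lp) auto
    finally have yU: "ennreal y * epowr (mass ?U E) (1 / p0) \<le> ennreal \<Phi> * epowr X (1 / p0)" .
    have "mass W E \<le> mass H2 E"
      using H2(2) by (intro mass_mono_AE AE_I2) (metis indicator_simps(1) mult.right_neutral)
    also have "mass H2 E \<le> epowr (mass ?U E) (1 / p0) * epowr X (1 - 1 / p0)"
    proof (cases "p0 = 1")
      \<comment> \<open>Hoelder's inequality degenerates here: the second exponent is 0, and
        \<open>epowr X 0\<close> is 1 only because \<open>X\<close> is positive and finite.\<close>
      case True
      have "0 < X"
      proof (rule ccontr)
        assume "\<not> 0 < X"
        then have "AE x in lebesgue. H1 x * H2 x = 0"
          unfolding X_def zero_less_iff_neq_zero not_not by (subst (asm) nn_integral_0_iff_AE) auto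
        then have "AE x in lebesgue. H2 x = 0"
        proof eventually_elim
          case (elim x)
          then show ?case using pos1[of x] by auto
        qed
        with nz2 show False ..
      qed
      then have "epowr X 0 = 1" using X_fin
        by (cases X) (auto simp: epowr_ennreal)
      moreover have "mass H2 E = mass ?U E"
      proof (rule mass_cong_AE)
        show "AE x in lebesgue. x \<in> E \<longrightarrow> H2 x = ennreal (u x)"
          using fin1 fin2
        proof eventually_elim
          case (elim x)
          then show ?case using True pos1[of x] by (auto simp: u_def enn2real_eq_0_iff)
        qed
      qed
      ultimately show ?thesis using True by simp
    next
      case False
      then have p1: "1 < p0" using p0 by simp
      \<comment> \<open>The exponents are such that \<open>H1\<close> cancels:
        \<open>(1 - p0) / p0 + (1 - 1 / p0) = 0\<close>.\<close>
      have "mass H2 E = (\<integral>\<^sup>+x. epowr (?U x * indicator E x) (1 / p0) * epowr (H1 x * H2 x) (1 - 1 / p0) \<partial>lebesgue)"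
        unfolding mass_def
      proof (rule nn_integral_cong_AE)
        show "AE x in lebesgue. H2 x * indicator E x = epowr (?U x * indicator E x) (1 / p0) * epowr (H1 x * H2 x) (1 - 1 / p0)"
          using fin1 fin2
        proof eventually_elim
          case (elim x)
          obtain r where r: "H1 x = ennreal r" "0 \<le> r" using elim by (cases "H1 x") auto
          obtain s where s: "H2 x = ennreal s" "0 \<le> s" using elim by (cases "H2 x") auto
          have rs: "0 < r" "0 < s" using pos1[of x] pos2[of x] r s by auto
          have "(r powr (1 - p0) * s) powr (1 / p0) * (r * s) powr (1 - 1 / p0) =
            r powr ((1 - p0) * (1 / p0) + (1 - 1 / p0)) * s powr (1 / p0 + (1 - 1 / p0))"
            using rs by (simp only: powr_mult powr_powr powr_add powr_ge_zero less_imp_le ac_simps)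
          also have "(1 - p0) * (1 / p0) + (1 - 1 / p0) = 0" using p1 by (simp add: field_simps)
          finally have "(r powr (1 - p0) * s) powr (1 / p0) * (r * s) powr (1 - 1 / p0) = s"
            using rs by simp
          then show ?case
            using r s rs by (auto simp: u_def epowr_ennreal ennreal_mult[symmetric] indicator_def)
        qed
      qed
      also have "\<dots> \<le> epowr (mass ?U E) (1 / p0) * epowr X (1 - 1 / p0)"
        unfolding mass_def X_def using p1 by (intro nn_integral_Holder) auto
      finally show ?thesis .
    qed
    finally have "ennreal y * mass W E \<le> ennreal y * (epowr (mass ?U E) (1 / p0) * epowr X (1 - 1 / p0))"
      by (rule mult_left_mono) simp
    also have "\<dots> = (ennreal y * epowr (mass ?U E) (1 / p0)) * epowr X (1 - 1 / p0)"
      by (simp only: mult.assoc)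
    also have "\<dots> \<le> (ennreal \<Phi> * epowr X (1 / p0)) * epowr X (1 - 1 / p0)"
      by (rule mult_right_mono[OF yU]) simp
    also have "\<dots> = ennreal \<Phi> * X"
      by (simp add: mult.assoc epowr_add)
    also have "\<dots> \<le> ennreal \<Phi> * (epowr (ennreal B1 * J) (1 / p) * epowr (ennreal B2 * mass W E) (1 - 1 / p))"
      by (intro mult_left_mono X_le) simp
    also have "\<dots> = (ennreal (\<Phi> * B1 powr (1 / p) * B2 powr (1 - 1 / p)) * epowr J (1 / p)) * epowr (mass W E) (1 - 1 / p)"
      using p c \<Phi> by (simp add: epowr_mult epowr_ennreal ennreal_mult ac_simps)
    finally have 1: "ennreal y * mass W E \<le> (ennreal (\<Phi> * B1 powr (1 / p) * B2 powr (1 - 1 / p)) * epowr J (1 / p)) * epowr (mass W E) (1 - 1 / p)" .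
    \<comment> \<open>Splitting the mass on the left side allows division by its power
      \<open>1 - 1 / p\<close>; this is where it has to be positive and finite.\<close>
    have "mass W E = epowr (mass W E) (1 / p) * epowr (mass W E) (1 - 1 / p)"
      by (simp add: epowr_add)
    with 1 have "(ennreal y * epowr (mass W E) (1 / p)) * epowr (mass W E) (1 - 1 / p) \<le>
        (ennreal (\<Phi> * B1 powr (1 / p) * B2 powr (1 - 1 / p)) * epowr J (1 / p)) * epowr (mass W E) (1 - 1 / p)"
      by (metis mult.assoc)
    then have "ennreal y * epowr (mass W E) (1 / p) \<le> ennreal (\<Phi> * B1 powr (1 / p) * B2 powr (1 - 1 / p)) * epowr J (1 / p)"
      by (rule ennreal_mult_le_cancel) (use m in \<open>auto simp: zero_less_iff_neq_zero\<close>)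
    then have "epowr (ennreal y * epowr (mass W E) (1 / p)) p \<le> epowr (ennreal (\<Phi> * B1 powr (1 / p) * B2 powr (1 - 1 / p)) * epowr J (1 / p)) p"
      using p by (intro epowr_mono) auto
    then show ?thesis
      using p y \<Phi> c by (simp add: epowr_mult[of p] epowr_epowr epowr_ennreal)
  qed
  with fD show ?thesis by blast
qed

end

text \<open>The inequality is raised to the power \<open>p\<close> to avoid roots. Membership in
  \<open>D\<close> is included because the two parts of a function split in the interpolation must
  be in the domain of \<open>T\<close>.\<close>

definition weak_type ::
  "('a::euclidean_space \<Rightarrow> ennreal) \<Rightarrow> real \<Rightarrow> ('a \<Rightarrow> 'b::{real_normed_field,second_countable_topology}) set \<Rightarrow>
   (('a \<Rightarrow> 'b) \<Rightarrow> ('a \<Rightarrow> 'b)) \<Rightarrow> real \<Rightarrow> bool" where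
  "weak_type W p D T C \<longleftrightarrow> (\<forall>f\<in>borel_measurable lebesgue. moment W p (\<lambda>x. ennreal (norm (f x))) < \<infinity> \<longrightarrow>
     f \<in> D \<and> (\<forall>y>0. ennreal (y powr p) * mass W {x. y < norm (T f x)} \<le> ennreal C * moment W p (\<lambda>x. ennreal (norm (f x)))))"

text \<open>\<open>core\<close> proves the bound for sets \<open>E\<close> of positive finite mass
  with an error \<open>e\<close>, by a constant independent of both. Then \<open>e\<close> tends to
  0, and \<open>E\<close> runs through the parts of the level set in larger and larger
  cubes.\<close>

theorem extrapolation:
  fixes W S :: "'a::euclidean_space \<Rightarrow> ennreal"
    and T :: "('a \<Rightarrow> 'b::{real_normed_field,second_countable_topology}) \<Rightarrow> ('a \<Rightarrow> 'b)"
  assumes p0: "1 \<le> p0"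
    and sub: "sublinear_operator D T"
    and lb: "locally_bounded \<phi>"
    and hyp: "\<And>u. u \<in> Ap p0 \<Longrightarrow>
           bounded_operator D T (Lp_norm p0 (weighted u)) (weak_Lp_norm p0 (weighted u))
             (\<phi> (enn2real (Ap_const p0 u)))"
    and ap: "Ap_pair p K W S"
  obtains C where "0 < C" "weak_type W p D T C"
proof -
  note [measurable] = Ap_pair_measurable[OF ap]
  have p: "1 < p" by (rule Ap_pair_p[OF ap])
  obtain B1 c1 where B1: "0 < B1" "0 < c1" "\<And>h. h \<in> borel_measurable lebesgue \<Longrightarrow>
    \<exists>H\<in>borel_measurable lebesgue. (\<forall>x. h x \<le> H x) \<and> (\<forall>x. HL H x \<le> ennreal c1 * H x) \<and>
      moment W p H \<le> ennreal B1 * moment W p h"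
    using Rubio_de_Francia[OF ap] by blast
  obtain B2 c2 where B2: "0 < B2" "0 < c2" "\<And>h. h \<in> borel_measurable lebesgue \<Longrightarrow>
    \<exists>H\<in>borel_measurable lebesgue. (\<forall>x. h x \<le> H x) \<and> (\<forall>x. HL H x \<le> ennreal c2 * H x) \<and>
      moment S (p / (p - 1)) H \<le> ennreal B2 * moment S (p / (p - 1)) h"
    using Rubio_de_Francia[OF Ap_pair_dual[OF ap]] by blast
  obtain \<Phi> where \<Phi>: "0 < \<Phi>" "\<And>t. 0 \<le> t \<Longrightarrow> t \<le> c1 powr (p0 - 1) * c2 \<Longrightarrow> \<phi> t \<le> \<Phi>"
    using locally_bounded_bound[OF lb, where K="c1 powr (p0 - 1) * c2"] by blast
  define C1 where "C1 = (\<Phi> * B1 powr (1 / p) * B2 powr (1 - 1 / p)) powr p"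
  have C1: "0 < C1" using \<Phi> B1 B2 by (simp add: C1_def)
  define Q where "Q n = cb (- (real n + 1) *\<^sub>R One :: 'a, 2 * (real n + 1))" for n :: nat
  have Q: "Q n \<in> cubes" for n unfolding Q_def by (rule cb_in_cubes) simp
  note Qs[measurable] = cubes_sets[OF Q]
  have core: "f \<in> D \<and> (\<forall>y>0. E \<subseteq> {x. y < norm (T f x)} \<longrightarrow>
     ennreal (y powr p) * mass W E \<le> ennreal (C1 * 2 powr p) * (moment W p (\<lambda>x. ennreal (norm (f x))) + ennreal e))"
    if fm[measurable]: "f \<in> borel_measurable lebesgue" and fin: "moment W p (\<lambda>x. ennreal (norm (f x))) < \<infinity>"
      and E[measurable]: "E \<in> sets lebesgue" and m: "0 < mass W E" "mass W E < \<infinity>" and e: "0 < e" for f E e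
  proof -
    obtain M where M: "mass W (Q 0) = ennreal M" "0 < M"
      using Ap_pair_pos(1)[OF ap Q[of 0]] Ap_pair_finite(1)[OF ap Q[of 0]] by (cases "mass W (Q 0)") auto
    \<comment> \<open>Added to the modulus of \<open>f\<close> to keep the majorant from vanishing
      even if \<open>f = 0\<close>. The height is chosen such that the moment of \<open>k\<close> is
      exactly \<open>e\<close>.\<close>
    define k where "k = (\<lambda>x. ennreal ((e / M) powr (1 / p)) * indicator (Q 0) x)"
    have [measurable]: "k \<in> borel_measurable lebesgue" unfolding k_def by measurable
    have ke: "moment W p k = ennreal e"
    proof -
      have "moment W p k = (\<integral>\<^sup>+x. ennreal (e / M) * (W x * indicator (Q 0) x) \<partial>lebesgue)"
        using p e M by (intro nn_integral_cong) (auto simp: k_def epowr_mult epowr_ennreal powr_powr indicator_def mult.commute)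
      also have "\<dots> = ennreal (e / M) * mass W (Q 0)"
        unfolding mass_def by (intro nn_integral_cmult) measurable
      also have "\<dots> = ennreal e" using e M by (simp add: ennreal_mult[symmetric])
      finally show ?thesis .
    qed
    define J where "J = moment W p (\<lambda>x. ennreal (norm (f x)) + k x)"
    have "J \<le> (\<integral>\<^sup>+x. ennreal (2 powr p) * (W x * epowr (ennreal (norm (f x))) p + W x * epowr (k x) p) \<partial>lebesgue)"
      unfolding J_def
    proof (intro nn_integral_mono)
      fix x
      have "W x * epowr (ennreal (norm (f x)) + k x) p \<le> W x * (ennreal (2 powr p) * (epowr (ennreal (norm (f x))) p + epowr (k x) p))"
        using p by (intro mult_left_mono epowr_add_le) auto
      then show "W x * epowr (ennreal (norm (f x)) + k x) p \<le> ennreal (2 powr p) * (W x * epowr (ennreal (norm (f x))) p + W x * epowr (k x) p)"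
        by (simp only: mult.left_commute distrib_left)
    qed
    also have "\<dots> = ennreal (2 powr p) * (moment W p (\<lambda>x. ennreal (norm (f x))) + ennreal e)"
      unfolding ke[symmetric] by (subst nn_integral_cmult, measurable, subst nn_integral_add) auto
    finally have J: "J \<le> \<dots>" .
    have Jfin: "J < \<infinity>" using fin by (intro le_less_trans[OF J]) (auto simp: ennreal_mult_less_top)
    obtain H1 where H1: "H1 \<in> borel_measurable lebesgue" "\<And>x. ennreal (norm (f x)) + k x \<le> H1 x" "\<And>x. HL H1 x \<le> ennreal c1 * H1 x"
      "moment W p H1 \<le> ennreal B1 * J"
      using B1(3)[of "\<lambda>x. ennreal (norm (f x)) + k x"] unfolding J_def by auto
    obtain H2 where H2: "H2 \<in> borel_measurable lebesgue" "\<And>x. W x * indicator E x \<le> H2 x" "\<And>x. HL H2 x \<le> ennreal c2 * H2 x"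
      "moment S (p / (p - 1)) H2 \<le> ennreal B2 * moment S (p / (p - 1)) (\<lambda>x. W x * indicator E x)"
      using B2(3)[of "\<lambda>x. W x * indicator E x"] by auto
    \<comment> \<open>The moment of \<open>W\<close> cut off to \<open>E\<close> in the dual space
      is just the mass of \<open>E\<close>, as
      \<open>S x * epowr (W x) (p / (p - 1)) = W x\<close>.\<close>
    have SW: "moment S (p / (p - 1)) (\<lambda>x. W x * indicator E x) = mass W E"
      unfolding mass_def
    proof (rule nn_integral_cong_AE)
      show "AE x in lebesgue. S x * epowr (W x * indicator E x) (p / (p - 1)) = W x * indicator E x"
        using Ap_pair_AE_dual[OF ap]
      proof eventually_elim
        case (elim x)
        have "p / (p - 1) = 1 / (p - 1) + 1" using p by (simp add: field_simps)
        then have "epowr (W x) (p / (p - 1)) = epowr (W x) (1 / (p - 1)) * W x"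
          using epowr_add[of "W x" "1 / (p - 1)" 1] by simp
        then have "S x * epowr (W x) (p / (p - 1)) = W x"
          using elim by (simp add: mult.assoc[symmetric])
        then show ?case by (auto simp: indicator_def)
      qed
    qed
    have nz: "\<not> (AE x in lebesgue. H1 x = 0)"
    proof
      assume "AE x in lebesgue. H1 x = 0"
      then have "moment W p k = (\<integral>\<^sup>+x. 0 \<partial>(lebesgue :: 'a measure))"
      proof (intro nn_integral_cong_AE, eventually_elim)
        case (elim x)
        then show ?case using H1(2)[of x] by simp
      qed
      with ke e show False by simp
    qed
    have fH1: "ennreal (norm (f x)) \<le> H1 x" for x
      using H1(2)[of x] by (rule order_trans[rotated]) simp
    note aux = extrapolation_aux[OF p0 sub hyp ap B1(2) B2(2) B1(1) B2(1) \<Phi> fm H1(1) H2(1) E m Jfin H1(3) nz fH1 H1(4) H2(3) H2(2) H2(4)[unfolded SW], folded C1_def]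
    have "ennreal C1 * J \<le> ennreal C1 * (ennreal (2 powr p) * (moment W p (\<lambda>x. ennreal (norm (f x))) + ennreal e))"
      by (intro mult_left_mono J) simp
    also have "\<dots> = ennreal (C1 * 2 powr p) * (moment W p (\<lambda>x. ennreal (norm (f x))) + ennreal e)"
      using C1 by (simp add: ennreal_mult mult.assoc)
    finally show ?thesis using aux by (meson order_trans)
  qed
  show ?thesis
  proof (rule that[of "C1 * 2 powr p"])
    show "0 < C1 * 2 powr p" using C1 by simp
    show "weak_type W p D T (C1 * 2 powr p)"
      unfolding weak_type_def
    proof (intro ballI impI)
      fix f :: "'a \<Rightarrow> 'b"
      let ?J = "\<integral>\<^sup>+x. W x * epowr (ennreal (norm (f x))) p \<partial>lebesgue"
      assume fm[measurable]: "f \<in> borel_measurable lebesgue" and fin: "?J < \<infinity>"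
      \<comment> \<open>Membership in \<open>D\<close> does not involve the level set, so any
        admissible \<open>E\<close>, here a cube, can be inserted.\<close>
      have fD: "f \<in> D"
        using core[OF fm fin Qs Ap_pair_pos(1)[OF ap Q] Ap_pair_finite(1)[OF ap Q], of 1] by simp
      have [measurable]: "T f \<in> borel_measurable lebesgue" using sub fD by (auto simp: sublinear_operator_def)
      have "ennreal (y powr p) * mass W {x. y < norm (T f x)} \<le> ennreal (C1 * 2 powr p) * ?J" if y: "0 < y" for y
      proof -
        define E where "E n = {x. y < norm (T f x)} \<inter> Q n" for n
        have Em[measurable]: "E n \<in> sets lebesgue" for n unfolding E_def by measurable
        have Efin: "mass W (E n) < \<infinity>" for n
          by (rule le_less_trans[OF mass_mono_set Ap_pair_finite(1)[OF ap Q[of n]]]) (auto simp: E_def)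
        have le: "ennreal (y powr p) * mass W (E n) \<le> ennreal (C1 * 2 powr p) * ?J" for n
        proof (cases "mass W (E n) = 0")
          case False
          have "ennreal (y powr p) * mass W (E n) \<le> ennreal (C1 * 2 powr p) * ?J + ennreal d" if d: "0 < d" for d
          proof -
            let ?e = "d / (C1 * 2 powr p)"
            have "0 < ?e" using d C1 by simp
            then have "ennreal (y powr p) * mass W (E n) \<le> ennreal (C1 * 2 powr p) * (?J + ennreal ?e)"
              using core[OF fm fin Em _ Efin, where e="?e"] False y by (auto simp: E_def zero_less_iff_neq_zero)
            also have "\<dots> = ennreal (C1 * 2 powr p) * ?J + ennreal d"
              using C1 d by (simp add: distrib_left ennreal_mult[symmetric])
            finally show ?thesis .
          qed
          then show ?thesis by (rule ennreal_le_epsilon)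
        qed simp
        have un: "{x. y < norm (T f x)} = (\<Union>n. E n)"
        proof -
          have "\<exists>n. x \<in> Q n" for x
          proof -
            obtain n where n: "norm x \<le> real n" using real_arch_simple by blast
            have "x \<in> Q n"
              unfolding Q_def cb_def mem_box
            proof
              fix b :: 'a assume b: "b \<in> Basis"
              have "\<bar>x \<bullet> b\<bar> \<le> real n" using Basis_le_norm[OF b, of x] n by linarith
              then show "fst (- (real n + 1) *\<^sub>R One, 2 * (real n + 1)) \<bullet> b \<le> x \<bullet> b \<and>
                x \<bullet> b \<le> (fst (- (real n + 1) *\<^sub>R One, 2 * (real n + 1)) + snd (- (real n + 1) *\<^sub>R One :: 'a, 2 * (real n + 1)) *\<^sub>R One) \<bullet> b"
                using b by (simp add: inner_simps abs_le_iff algebra_simps)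
            qed
            then show ?thesis ..
          qed
          then show ?thesis by (auto simp: E_def)
        qed
        have inc: "incseq E"
        proof (rule incseq_SucI)
          fix n
          have "Q n \<subseteq> Q (Suc n)"
            unfolding Q_def by (subst cb_subset_cb_iff) (auto simp: inner_simps)
          then show "E n \<le> E (Suc n)" by (auto simp: E_def)
        qed
        have "mass W {x. y < norm (T f x)} = (SUP n. mass W (E n))"
          unfolding un using inc by (simp add: mass_emeasure SUP_emeasure_incseq image_subset_iff sets.countable_UN)
        then have "ennreal (y powr p) * mass W {x. y < norm (T f x)} = (SUP n. ennreal (y powr p) * mass W (E n))"
          by (simp add: SUP_mult_left_ennreal)
        also have "\<dots> \<le> ennreal (C1 * 2 powr p) * ?J" by (intro SUP_least le)
        finally show ?thesis .
      qed
      with fD show "f \<in> D \<and> (\<forall>y>0. ennreal (y powr p) * mass W {x. y < norm (T f x)} \<le> ennreal (C1 * 2 powr p) * ?J)"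
        by blast
    qed
  qed
qed

subsection \<open>Boyd interpolation\<close>

lemma distribution_antimono: "f \<in> borel_measurable M \<Longrightarrow> s \<le> s' \<Longrightarrow> distribution M f s' \<le> distribution M f s"
  unfolding distribution_def by (intro emeasure_mono) (auto intro: le_less_trans)

lemma rearrangement_antimono: "t \<le> t' \<Longrightarrow> rearrangement M f t' \<le> rearrangement M f t"
  unfolding rearrangement_def by (intro Inf_superset_mono) (auto intro: order_trans ennreal_leI)

lemma rearrangement_le: "distribution M f s \<le> ennreal t \<Longrightarrow> rearrangement M f t \<le> s"
  unfolding rearrangement_def by (intro Inf_lower) simp

text \<open>The infimum that defines the rearrangement is attained, because the distribution
  function is continuous from the right.\<close>

lemma distribution_rearrangement_le:
  assumes [measurable]: "f \<in> borel_measurable M"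
  shows "distribution M f (rearrangement M f t) \<le> ennreal t"
proof (rule ccontr)
  define s where "s = rearrangement M f t"
  assume "\<not> distribution M f (rearrangement M f t) \<le> ennreal t"
  then have gt: "ennreal t < distribution M f s" by (simp add: s_def not_le)
  define A where "A n = {x \<in> space M. s + ennreal (inverse (real (Suc n))) < f x}" for n
  have un: "{x \<in> space M. s < f x} = (\<Union>n. A n)"
  proof
    show "(\<Union>n. A n) \<subseteq> {x \<in> space M. s < f x}"
      by (auto simp: A_def intro: le_less_trans[rotated])
    show "{x \<in> space M. s < f x} \<subseteq> (\<Union>n. A n)"
    proof safe
      fix x assume x: "x \<in> space M" "s < f x"
      then obtain r where r: "s = ennreal r" "0 \<le> r" by (cases s) auto
      have "\<exists>n. s + ennreal (inverse (real (Suc n))) < f x"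
      proof (cases "f x")
        case (real q)
        then have "0 < q - r" using x r by (simp add: ennreal_less_iff)
        then obtain n where "inverse (real (Suc n)) < q - r" using reals_Archimedean by blast
        then have "ennreal (r + inverse (real (Suc n))) < ennreal q" using r \<open>0 < q - r\<close> by (intro ennreal_lessI) auto
        then show ?thesis using real r by (intro exI[of _ n]) simp
      qed (use r in auto)
      then show "x \<in> (\<Union>n. A n)" using x by (auto simp: A_def)
    qed
  qed
  have "incseq A"
  proof (rule incseq_SucI)
    fix n
    have "ennreal (inverse (real (Suc (Suc n)))) \<le> ennreal (inverse (real (Suc n)))"
      by (intro ennreal_leI le_imp_inverse_le) auto
    then show "A n \<le> A (Suc n)"
      by (auto simp: A_def intro: le_less_trans[rotated] add_left_mono)
  qed
  moreover have "A n \<in> sets M" for n unfolding A_def by measurable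
  ultimately have "distribution M f s = (SUP n. emeasure M (A n))"
    unfolding distribution_def un by (intro SUP_emeasure_incseq[symmetric]) auto
  with gt obtain n where n: "ennreal t < emeasure M (A n)" by (auto simp: less_SUP_iff)
  let ?s = "s + ennreal (inverse (real (Suc n)))"
  \<comment> \<open>At \<open>?s\<close> the distribution still exceeds \<open>t\<close>, so every
    admissible level lies above \<open>?s\<close>, and so does their infimum
    \<open>s\<close>.\<close>
  have "?s \<le> s"
    unfolding s_def rearrangement_def[of M f t]
  proof (rule Inf_greatest)
    fix z assume "z \<in> {s. distribution M f s \<le> ennreal t}"
    then have "distribution M f z < distribution M f ?s"
      using n by (auto simp: distribution_def A_def intro: le_less_trans)
    then have "\<not> z \<le> ?s" using distribution_antimono[OF assms, of z ?s] by auto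
    then show "Inf {s. distribution M f s \<le> ennreal t} + ennreal (inverse (real (Suc n))) \<le> z"
      by (simp add: s_def rearrangement_def not_le)
  qed
  moreover have "s < top"
    using gt by (cases "s = top") (auto simp: distribution_def less_top)
  ultimately show False
    using ennreal_add_left_cancel_le[of s "ennreal (inverse (real (Suc n)))" 0] by auto
qed

lemma antimono_borel_measurable:
  fixes g :: "real \<Rightarrow> ennreal"
  assumes "antimono g" shows "g \<in> borel_measurable borel"
proof (rule borel_measurableI_greater)
  fix y
  have "is_interval {x. y < g x}"
    using assms by (auto simp: is_interval_1 antimono_def intro: less_le_trans)
  then show "{x \<in> space borel. y < g x} \<in> sets borel"
    by (simp add: real_interval_borel_measurable)
qed

lemma borel_half_line: "f \<in> borel_measurable borel \<Longrightarrow> f \<in> borel_measurable half_line"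
  by (intro measurable_restrict_space1 measurable_completion) simp

text \<open>One factor \<open>b k\<close> is kept and the remaining power is bounded by that of the
  whole sum.\<close>

lemma suminf_epowr_le:
  assumes p: "1 \<le> p"
  shows "(\<Sum>k. epowr (b k) p) \<le> epowr (\<Sum>k. b k) p"
proof -
  let ?s = "\<Sum>k. b k"
  have split: "epowr x p = x * epowr x (p - 1)" for x
    using epowr_add[of x 1 "p - 1"] by simp
  have bs: "b k \<le> ?s" for k by (rule ennreal_le_suminf)
  have "(\<Sum>k. epowr (b k) p) \<le> (\<Sum>k. b k * epowr ?s (p - 1))"
    unfolding split[of "b _"] using p by (intro suminf_le mult_left_mono epowr_mono bs summableI) auto
  also have "\<dots> = epowr ?s p" by (simp add: split)
  finally show ?thesis .
qed

context ri_banach_function_norm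
begin

text \<open>Finite subadditivity, carried to the limit by the Fatou property.\<close>

lemma suminf_le_suminf:
  assumes [measurable]: "\<And>k. f k \<in> borel_measurable M"
  shows "\<rho> (\<lambda>x. \<Sum>k. f k x) \<le> (\<Sum>k. \<rho> (f k))"
proof -
  have z: "\<rho> (\<lambda>x. 0) = 0" by (subst zero_iff) auto
  have fin: "\<rho> (\<lambda>x. \<Sum>k<n. f k x) \<le> (\<Sum>k<n. \<rho> (f k))" for n
  proof (induction n)
    case (Suc n)
    have "\<rho> (\<lambda>x. (\<Sum>k<n. f k x) + f n x) \<le> \<rho> (\<lambda>x. \<Sum>k<n. f k x) + \<rho> (f n)"
      by (intro triangle) measurable
    also have "\<dots> \<le> (\<Sum>k<n. \<rho> (f k)) + \<rho> (f n)" by (intro add_right_mono Suc)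
    finally show ?case by simp
  qed (simp add: z)
  have "(\<lambda>n. \<rho> (\<lambda>x. \<Sum>k<n. f k x)) \<longlonglongrightarrow> \<rho> (\<lambda>x. \<Sum>k. f k x)"
  proof (rule fatou[THEN conjunct2])
    show "AE x in M. incseq (\<lambda>n. \<Sum>k<n. f k x) \<and> (\<lambda>n. \<Sum>k<n. f k x) \<longlonglongrightarrow> (\<Sum>k. f k x)"
      by (intro AE_I2 conjI incseq_SucI summable_LIMSEQ summableI) simp
  qed measurable
  moreover have "\<rho> (\<lambda>x. \<Sum>k<n. f k x) \<le> (\<Sum>k. \<rho> (f k))" for n
    by (rule order_trans[OF fin]) (intro sum_le_suminf summableI, auto)
  ultimately show ?thesis by (intro LIMSEQ_le_const2) auto
qed

end

section \<open>Dilations and Boyd indices\<close>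

lemma dilation_le:
  assumes \<sigma>: "ri_banach_function_norm half_line \<sigma>" and f[measurable]: "f \<in> borel_measurable borel"
    and fin: "\<sigma> f < \<infinity>" and c: "dilation_norm \<sigma> t \<le> ennreal c" and c0: "0 \<le> c"
  shows "\<sigma> (\<lambda>s. f (s / t)) \<le> ennreal c * \<sigma> f"
proof -
  interpret ri_banach_function_norm half_line \<sigma> by fact
  have fm: "f \<in> borel_measurable half_line" by (rule borel_half_line[OF f])
  have "(\<lambda>s. f (s / t)) \<in> borel_measurable borel" by measurable
  then have Df: "(\<lambda>s. f (s / t)) \<in> borel_measurable half_line" by (rule borel_half_line)
  have scaled: "ennreal a * \<sigma> (\<lambda>s. f (s / t)) \<le> ennreal c" if a: "0 \<le> a" "ennreal a * \<sigma> f \<le> 1" for a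
  proof -
    have "(\<lambda>s. ennreal a * f s) \<in> {f \<in> borel_measurable half_line. \<sigma> f \<le> 1}"
      using a scale[OF fm a(1)] fm by simp
    then have "\<sigma> (\<lambda>s. ennreal a * f (s / t)) \<le> dilation_norm \<sigma> t"
      unfolding dilation_norm_def by (intro SUP_upper2[of "\<lambda>s. ennreal a * f s"]) auto
    also have "\<sigma> (\<lambda>s. ennreal a * f (s / t)) = ennreal a * \<sigma> (\<lambda>s. f (s / t))"
      by (rule scale[OF Df a(1)])
    finally show ?thesis using c by (rule order_trans)
  qed
  obtain r where r: "\<sigma> f = ennreal r" "0 \<le> r" using fin by (cases "\<sigma> f") auto
  show ?thesis
  proof (cases "r = 0")
    case False
    then have r0: "0 < r" using r by simp
    have "ennreal (1 / r) * \<sigma> (\<lambda>s. f (s / t)) \<le> ennreal c"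
      using r0 r by (intro scaled) (auto simp: ennreal_mult[symmetric])
    then have "ennreal r * (ennreal (1 / r) * \<sigma> (\<lambda>s. f (s / t))) \<le> ennreal r * ennreal c"
      by (rule mult_left_mono) simp
    then show ?thesis using r0 r by (simp add: mult.assoc[symmetric] ennreal_mult[symmetric] mult.commute)
  next
    case True
    \<comment> \<open>If the norm of \<open>f\<close> is 0, all multiples of \<open>f\<close> lie in
      the unit ball, so all multiples of the norm of the dilated function stay below
      \<open>c\<close>.\<close>
    then have *: "ennreal a * \<sigma> (\<lambda>s. f (s / t)) \<le> ennreal c" if "0 \<le> a" for a
      using r by (intro scaled that) simp
    have "\<sigma> (\<lambda>s. f (s / t)) = 0"
    proof (cases "\<sigma> (\<lambda>s. f (s / t))")
      case (real q)
      show ?thesis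
      proof (rule ccontr)
        assume "\<sigma> (\<lambda>s. f (s / t)) \<noteq> 0"
        with real have q: "0 < q" by auto
        have "ennreal ((c + 1) / q) * \<sigma> (\<lambda>s. f (s / t)) \<le> ennreal c"
          using q c0 by (intro *) auto
        then have "ennreal (c + 1) \<le> ennreal c" using real q c0 by (simp add: ennreal_mult[symmetric] del: ennreal_plus)
        then show False using c0 by (simp add: ennreal_le_iff del: ennreal_plus)
      qed
    next
      case top
      then show ?thesis using *[of 1] by (simp add: top_unique)
    qed
    then show ?thesis by simp
  qed
qed

lemma lower_boyd_dilation_norm:
  assumes "has_lower_boyd_index \<sigma> p" "r < p" "0 < r"
  obtains T where "\<And>t. T \<le> t \<Longrightarrow> dilation_norm \<sigma> t \<le> ennreal (t powr (1 / r))"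
proof -
  have "eventually (\<lambda>t. r < ln t / ln (enn2real (dilation_norm \<sigma> t)) \<and> 1 < t) at_top"
    using assms unfolding has_lower_boyd_index_def
    by (intro eventually_conj order_tendstoD(1)[where y=p] eventually_gt_at_top)
  then obtain T where T: "\<And>t. T \<le> t \<Longrightarrow> r < ln t / ln (enn2real (dilation_norm \<sigma> t)) \<and> 1 < t"
    by (auto simp: eventually_at_top_linorder)
  have "dilation_norm \<sigma> t \<le> ennreal (t powr (1 / r))" if "T \<le> t" for t
  proof -
    let ?h = "enn2real (dilation_norm \<sigma> t)"
    have t: "r < ln t / ln ?h" "1 < t" using T[OF that] by auto
    have lt: "0 < ln t" using t by simp
    have lh: "0 < ln ?h"
      using t lt assms(3) by (metis less_trans zero_less_divide_iff not_less_iff_gr_or_eq)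
    \<comment> \<open>A nonzero \<open>?h\<close> also excludes an infinite dilation norm, which
      \<open>enn2real\<close> would turn into 0.\<close>
    then have h: "0 < ?h" using enn2real_nonneg[of "dilation_norm \<sigma> t"] by (cases "?h = 0") auto
    have "r * ln ?h < ln t" using t(1) lh by (simp add: pos_less_divide_eq)
    then have "ln ?h \<le> ln (t powr (1 / r))" using assms(3) t by (simp add: ln_powr field_simps)
    then have "?h \<le> t powr (1 / r)" using h t by (subst (asm) ln_le_cancel_iff) auto
    moreover have "dilation_norm \<sigma> t = ennreal ?h" using h by (cases "dilation_norm \<sigma> t") auto
    ultimately show ?thesis by (metis ennreal_leI)
  qed
  then show ?thesis using that by blast
qed

text \<open>As for the lower index, but for \<open>t\<close> below 1 both logarithms are negative.
  The quotient is therefore also kept positive, which fixes the sign of the denominator.\<close>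

lemma upper_boyd_dilation_norm:
  assumes "has_upper_boyd_index \<sigma> q" "0 < q" "q < r"
  obtains T where "0 < T" "\<And>t. 0 < t \<Longrightarrow> t < T \<Longrightarrow> dilation_norm \<sigma> t \<le> ennreal (t powr (1 / r))"
proof -
  have "eventually (\<lambda>t. 0 < ln t / ln (enn2real (dilation_norm \<sigma> t)) \<and> ln t / ln (enn2real (dilation_norm \<sigma> t)) < r) (at_right 0)"
    using assms unfolding has_upper_boyd_index_def
    by (intro eventually_conj order_tendstoD(1)[where y=q] order_tendstoD(2)[where y=q])
  then obtain T where T: "0 < T" "\<And>t. 0 < t \<Longrightarrow> t < T \<Longrightarrow>
      0 < ln t / ln (enn2real (dilation_norm \<sigma> t)) \<and> ln t / ln (enn2real (dilation_norm \<sigma> t)) < r"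
    by (auto simp: eventually_at_right_field)
  have "dilation_norm \<sigma> t \<le> ennreal (t powr (1 / r))" if "0 < t" "t < min T 1" for t
  proof -
    let ?h = "enn2real (dilation_norm \<sigma> t)"
    have t: "0 < ln t / ln ?h" "ln t / ln ?h < r" using T(2)[of t] that by auto
    have lt: "ln t < 0" using that by simp
    have lh: "ln ?h < 0" using t(1) lt by (simp add: zero_less_divide_iff)
    have "?h \<noteq> 0"
    proof
      assume "?h = 0"
      with lh show False by simp
    qed
    then have h: "0 < ?h" using enn2real_nonneg[of "dilation_norm \<sigma> t"] by linarith
    have "r * ln ?h < ln t" using t(2) lh by (simp add: neg_divide_less_eq)
    then have "ln ?h \<le> ln (t powr (1 / r))" using assms that by (simp add: ln_powr field_simps)
    then have "?h \<le> t powr (1 / r)" using h that by (subst (asm) ln_le_cancel_iff) auto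
    moreover have "dilation_norm \<sigma> t = ennreal ?h" using h by (cases "dilation_norm \<sigma> t") auto
    ultimately show ?thesis by (metis ennreal_leI)
  qed
  then show ?thesis using T(1) that[of "min T 1"] by auto
qed

text \<open>The index controls only dilations by large factors. For a decreasing \<open>g\<close>
  one may dilate by a further factor \<open>2 ^ N\<close>, which enlarges \<open>g\<close> and costs
  a constant, to cover all \<open>j\<close>.\<close>

lemma dilate_up_le:
  assumes \<sigma>: "ri_banach_function_norm half_line \<sigma>" and low: "has_lower_boyd_index \<sigma> p" "0 < r" "r < p"
  obtains C where "0 < C" "\<And>g j. antimono g \<Longrightarrow> \<sigma> g < \<infinity> \<Longrightarrow> \<sigma> (\<lambda>s. g (s / 2 ^ j)) \<le> ennreal (C * (2 powr (1 / r)) ^ j) * \<sigma> g"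
proof -
  interpret ri_banach_function_norm half_line \<sigma> by fact
  obtain T where T: "\<And>t. T \<le> t \<Longrightarrow> dilation_norm \<sigma> t \<le> ennreal (t powr (1 / r))"
    using lower_boyd_dilation_norm[OF low(1,3,2)] by blast
  obtain N where N: "T < 2 ^ N" using real_arch_pow[of 2 T] by auto
  let ?b = "2 powr (1 / r)"
  have b: "1 \<le> ?b" using low by (simp add: ge_one_powr_ge_zero)
  have "\<sigma> (\<lambda>s. g (s / 2 ^ j)) \<le> ennreal (?b ^ N * ?b ^ j) * \<sigma> g" if g: "antimono g" "\<sigma> g < \<infinity>" for g j
  proof -
    have gm[measurable]: "g \<in> borel_measurable borel" by (rule antimono_borel_measurable[OF g(1)])
    have "\<sigma> (\<lambda>s. g (s / 2 ^ j)) \<le> \<sigma> (\<lambda>s. g (s / 2 ^ (N + j)))"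
    proof (intro lattice borel_half_line)
      have "g (s / 2 ^ j) \<le> g (s / 2 ^ (N + j))" if "0 < s" for s :: real
      proof (rule antimonoD[OF g(1)])
        show "s / 2 ^ (N + j) \<le> s / 2 ^ j" using that by (intro divide_left_mono power_increasing) auto
      qed
      then show "AE s in half_line. g (s / 2 ^ j) \<le> g (s / 2 ^ (N + j))"
        by (intro AE_I2) (simp add: space_restrict_space)
    qed measurable
    also have "\<dots> \<le> ennreal ((2 ^ (N + j)) powr (1 / r)) * \<sigma> g"
    proof (rule dilation_le[OF \<sigma> gm g(2) T])
      have "(2::real) ^ N \<le> 2 ^ (N + j)" by (intro power_increasing) auto
      then show "T \<le> 2 ^ (N + j)" using N by linarith
    qed simp
    also have "(2 ^ (N + j)) powr (1 / r) = ?b ^ N * ?b ^ j"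
    proof -
      have "(2 ^ (N + j)) powr (1 / r) = ?b ^ (N + j)"
        by (simp add: powr_realpow[symmetric] powr_powr powr_power mult.commute)
      then show ?thesis by (simp only: power_add)
    qed
    finally show ?thesis .
  qed
  then show ?thesis using b by (intro that[of "?b ^ N"]) auto
qed

text \<open>The index applies as soon as \<open>(1/2) ^ j\<close> is small. For the finitely many
  other \<open>j\<close> the compressed function is at most \<open>g\<close>, and \<open>C\<close>
  makes up for the factor.\<close>

lemma dilate_down_le:
  assumes \<sigma>: "ri_banach_function_norm half_line \<sigma>" and up: "has_upper_boyd_index \<sigma> q" "0 < q" "q < r"
  obtains C where "0 < C" "\<And>g j. antimono g \<Longrightarrow> \<sigma> g < \<infinity> \<Longrightarrow> \<sigma> (\<lambda>s. g (s * 2 ^ j)) \<le> ennreal (C * ((1/2) powr (1 / r)) ^ j) * \<sigma> g"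
proof -
  interpret ri_banach_function_norm half_line \<sigma> by fact
  obtain T where T: "0 < T" "\<And>t. 0 < t \<Longrightarrow> t < T \<Longrightarrow> dilation_norm \<sigma> t \<le> ennreal (t powr (1 / r))"
    using upper_boyd_dilation_norm[OF up] by blast
  obtain N where N: "(1/2) ^ N < T" using real_arch_pow_inv[of T "1/2"] T by auto
  let ?b = "(1/2) powr (1 / r)"
  have b: "0 < ?b" "?b \<le> 1" using up by (auto simp: powr_le1)
  define C where "C = 1 / ?b ^ N"
  have C: "1 \<le> C" using b by (simp add: C_def power_le_one)
  have "\<sigma> (\<lambda>s. g (s * 2 ^ j)) \<le> ennreal (C * ?b ^ j) * \<sigma> g" if g: "antimono g" "\<sigma> g < \<infinity>" for g j
  proof (cases "N \<le> j")
    case True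
    have gm: "g \<in> borel_measurable borel" by (rule antimono_borel_measurable[OF g(1)])
    have "(1/2 :: real) ^ j \<le> (1/2) ^ N" using True by (intro power_decreasing) auto
    then have "(1/2 :: real) ^ j < T" using N by linarith
    then have "\<sigma> (\<lambda>s. g (s / (1/2) ^ j)) \<le> ennreal (((1/2) ^ j) powr (1 / r)) * \<sigma> g"
      by (intro dilation_le[OF \<sigma> gm g(2) T(2)]) auto
    also have "((1/2) ^ j) powr (1 / r) = ?b ^ j"
      by (simp add: powr_realpow[symmetric] powr_powr powr_power mult.commute)
    also have "ennreal (?b ^ j) * \<sigma> g \<le> ennreal (C * ?b ^ j) * \<sigma> g"
      using C b by (intro mult_right_mono ennreal_leI) (auto simp: mult_le_cancel_right1)
    finally show ?thesis by (simp add: power_one_over)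
  next
    case False
    have gm[measurable]: "g \<in> borel_measurable borel" by (rule antimono_borel_measurable[OF g(1)])
    have "\<sigma> (\<lambda>s. g (s * 2 ^ j)) \<le> \<sigma> g"
    proof (intro lattice borel_half_line)
      have "g (s * 2 ^ j) \<le> g s" if "0 < s" for s :: real
        by (rule antimonoD[OF g(1)]) (use that in simp)
      then show "AE s in half_line. g (s * 2 ^ j) \<le> g s"
        by (intro AE_I2) (simp add: space_restrict_space)
    qed measurable
    also have "\<dots> = ennreal 1 * \<sigma> g" by simp
    also have "\<dots> \<le> ennreal (C * ?b ^ j) * \<sigma> g"
    proof (intro mult_right_mono ennreal_leI)
      have "?b ^ N \<le> ?b ^ j" using False b by (intro power_decreasing) auto
      then show "1 \<le> C * ?b ^ j" using b by (simp add: C_def pos_le_divide_eq)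
    qed simp
    finally show ?thesis .
  qed
  then show ?thesis using C by (intro that[of C]) auto
qed

text \<open>The Calderon operator, discretized so that countable subadditivity of the norm replaces
  Minkowski's integral inequality.\<close>
definition calderon :: "real \<Rightarrow> real \<Rightarrow> (real \<Rightarrow> ennreal) \<Rightarrow> real \<Rightarrow> ennreal" where
  "calderon p1 p2 g t = (\<Sum>k. ennreal (((1/2) powr (1 / p1)) ^ k) * g (t / 2 ^ (k + 1))) +
     (\<Sum>k. ennreal ((2 powr (1 / p2)) ^ k) * g (t * 2 ^ k))"

text \<open>The auxiliary exponents \<open>r1\<close> and \<open>r2\<close> lie strictly between
  those of the operator and the indices. The norms of the terms then decay geometrically with ratios
  \<open>2 powr (1 / r1 - 1 / p1)\<close> and \<open>2 powr (1 / p2 - 1 / r2)\<close>.\<close>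

lemma calderon_bounded:
  assumes \<sigma>: "ri_banach_function_norm half_line \<sigma>" and low: "has_lower_boyd_index \<sigma> p" and up: "has_upper_boyd_index \<sigma> q"
    and p: "0 < p1" "p1 < p" "0 < q" "q < p2"
  obtains C where "0 < C" "\<And>g. antimono g \<Longrightarrow> \<sigma> g < \<infinity> \<Longrightarrow> \<sigma> (calderon p1 p2 g) \<le> ennreal C * \<sigma> g"
proof -
  interpret ri_banach_function_norm half_line \<sigma> by fact
  define r1 where "r1 = (p1 + p) / 2"
  define r2 where "r2 = (q + p2) / 2"
  have r: "p1 < r1" "r1 < p" "q < r2" "r2 < p2" "0 < r1" "0 < r2" using p by (auto simp: r1_def r2_def)
  obtain C1 where C1: "0 < C1" "\<And>g j. antimono g \<Longrightarrow> \<sigma> g < \<infinity> \<Longrightarrow> \<sigma> (\<lambda>s. g (s / 2 ^ j)) \<le> ennreal (C1 * (2 powr (1 / r1)) ^ j) * \<sigma> g"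
    using dilate_up_le[OF \<sigma> low r(5,2)] by blast
  obtain C2 where C2: "0 < C2" "\<And>g j. antimono g \<Longrightarrow> \<sigma> g < \<infinity> \<Longrightarrow> \<sigma> (\<lambda>s. g (s * 2 ^ j)) \<le> ennreal (C2 * ((1/2) powr (1 / r2)) ^ j) * \<sigma> g"
    using dilate_down_le[OF \<sigma> up p(3) r(3)] by blast
  define a1 where "a1 = (1/2) powr (1 / p1)" define b1 where "b1 = 2 powr (1 / r1)"
  define a2 where "a2 = 2 powr (1 / p2)" define b2 where "b2 = (1/2) powr (1 / r2)"
  have pos: "0 < a1" "0 < b1" "0 < a2" "0 < b2" by (auto simp: a1_def b1_def a2_def b2_def)
  have ab1: "a1 * b1 < 1"
  proof -
    have "a1 * b1 = 2 powr (1 / r1 - 1 / p1)" by (simp add: a1_def b1_def powr_divide powr_diff)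
    also have "\<dots> < 2 powr 0" using r p by (intro powr_less_mono) (auto simp: field_simps)
    finally show ?thesis by simp
  qed
  have ab2: "a2 * b2 < 1"
  proof -
    have "a2 * b2 = 2 powr (1 / p2 - 1 / r2)" by (simp add: a2_def b2_def powr_divide powr_diff)
    also have "\<dots> < 2 powr 0" using r p by (intro powr_less_mono) (auto simp: field_simps)
    finally show ?thesis by simp
  qed
  have geo: "(\<Sum>k. ennreal (c * x ^ k)) = ennreal (c * (1 / (1 - x)))" if "0 < c" "0 < x" "x < 1" for c x :: real
  proof -
    have "summable (\<lambda>k. c * x ^ k)" using that by (intro summable_mult summable_geometric) auto
    then have "(\<Sum>k. ennreal (c * x ^ k)) = ennreal (\<Sum>k. c * x ^ k)"
      using that by (intro suminf_ennreal2) auto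
    also have "(\<Sum>k. c * x ^ k) = c * (1 / (1 - x))"
      using that by (subst suminf_mult) (auto simp: suminf_geometric intro: summable_geometric)
    finally show ?thesis .
  qed
  define C where "C = C1 * b1 * (1 / (1 - a1 * b1)) + C2 * (1 / (1 - a2 * b2))"
  have Cp: "0 < C1 * b1 * (1 / (1 - a1 * b1))" "0 < C2 * (1 / (1 - a2 * b2))"
    using C1 C2 pos ab1 ab2 by auto
  have "\<sigma> (calderon p1 p2 g) \<le> ennreal C * \<sigma> g" if g: "antimono g" "\<sigma> g < \<infinity>" for g
  proof -
    have gm[measurable]: "g \<in> borel_measurable borel" by (rule antimono_borel_measurable[OF g(1)])
    define F1 where "F1 k t = ennreal (a1 ^ k) * g (t / 2 ^ (k + 1))" for k t
    define F2 where "F2 k t = ennreal (a2 ^ k) * g (t * 2 ^ k)" for k t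
    have m0: "(\<lambda>t. g (t / 2 ^ (k + 1))) \<in> borel_measurable half_line" "(\<lambda>t. g (t * 2 ^ k)) \<in> borel_measurable half_line" for k
      by (rule borel_half_line, measurable)+
    have m1[measurable]: "F1 k \<in> borel_measurable half_line" "F2 k \<in> borel_measurable half_line" for k
      using m0[of k] unfolding F1_def F2_def by auto
    have "\<sigma> (calderon p1 p2 g) = \<sigma> (\<lambda>t. (\<Sum>k. F1 k t) + (\<Sum>k. F2 k t))"
      by (simp add: calderon_def[abs_def] F1_def F2_def a1_def a2_def)
    also have "\<dots> \<le> \<sigma> (\<lambda>t. \<Sum>k. F1 k t) + \<sigma> (\<lambda>t. \<Sum>k. F2 k t)"
      by (intro triangle) measurable
    also have "\<dots> \<le> (\<Sum>k. \<sigma> (F1 k)) + (\<Sum>k. \<sigma> (F2 k))"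
      by (intro add_mono suminf_le_suminf m1)
    also have "(\<Sum>k. \<sigma> (F1 k)) \<le> (\<Sum>k. ennreal (C1 * b1 * (a1 * b1) ^ k) * \<sigma> g)"
    proof (intro suminf_le summableI)
      fix k
      have "\<sigma> (F1 k) = ennreal (a1 ^ k) * \<sigma> (\<lambda>t. g (t / 2 ^ (k + 1)))"
        unfolding F1_def using pos by (intro scale m0) auto
      also have "\<dots> \<le> ennreal (a1 ^ k) * (ennreal (C1 * b1 ^ (k + 1)) * \<sigma> g)"
        unfolding b1_def by (intro mult_left_mono C1 g) simp
      also have "\<dots> = ennreal (a1 ^ k * (C1 * b1 ^ (k + 1))) * \<sigma> g"
        using pos C1 by (subst ennreal_mult) (auto simp: mult.assoc)
      also have "a1 ^ k * (C1 * b1 ^ (k + 1)) = C1 * b1 * (a1 * b1) ^ k"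
        by (simp add: power_mult_distrib)
      finally show "\<sigma> (F1 k) \<le> ennreal (C1 * b1 * (a1 * b1) ^ k) * \<sigma> g" .
    qed
    also have "\<dots> = ennreal (C1 * b1 * (1 / (1 - a1 * b1))) * \<sigma> g"
      using pos C1 ab1 by (subst ennreal_suminf_multc, subst geo) auto
    also have "(\<Sum>k. \<sigma> (F2 k)) \<le> (\<Sum>k. ennreal (C2 * (a2 * b2) ^ k) * \<sigma> g)"
    proof (intro suminf_le summableI)
      fix k
      have "\<sigma> (F2 k) = ennreal (a2 ^ k) * \<sigma> (\<lambda>t. g (t * 2 ^ k))"
        unfolding F2_def using pos by (intro scale m0) auto
      also have "\<dots> \<le> ennreal (a2 ^ k) * (ennreal (C2 * b2 ^ k) * \<sigma> g)"
        unfolding b2_def by (intro mult_left_mono C2 g) simp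
      also have "\<dots> = ennreal (a2 ^ k * (C2 * b2 ^ k)) * \<sigma> g"
        using pos C2 by (subst ennreal_mult) (auto simp: mult.assoc)
      also have "a2 ^ k * (C2 * b2 ^ k) = C2 * (a2 * b2) ^ k"
        by (simp add: power_mult_distrib)
      finally show "\<sigma> (F2 k) \<le> ennreal (C2 * (a2 * b2) ^ k) * \<sigma> g" .
    qed
    also have "\<dots> = ennreal (C2 * (1 / (1 - a2 * b2))) * \<sigma> g"
      using pos C2 ab2 by (subst ennreal_suminf_multc, subst geo) auto
    also have "ennreal (C1 * b1 * (1 / (1 - a1 * b1))) * \<sigma> g + ennreal (C2 * (1 / (1 - a2 * b2))) * \<sigma> g = ennreal C * \<sigma> g"
      unfolding C_def using Cp by (subst ennreal_plus) (auto simp: distrib_right)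
    finally show ?thesis by (simp add: add_left_mono add_right_mono)
  qed
  moreover have "0 < C" unfolding C_def using Cp by (rule add_pos_pos)
  ultimately show ?thesis using that by blast
qed

lemma antimono_calderon:
  assumes g: "antimono g" shows "antimono (calderon p1 p2 g)"
proof (rule antimonoI)
  fix x y :: real assume "x \<le> y"
  then have "g (y / 2 ^ (k + 1)) \<le> g (x / 2 ^ (k + 1))" "g (y * 2 ^ k) \<le> g (x * 2 ^ k)" for k
    by (intro antimonoD[OF g] divide_right_mono mult_right_mono; simp)+
  then show "calderon p1 p2 g y \<le> calderon p1 p2 g x"
    unfolding calderon_def by (intro add_mono suminf_le mult_left_mono summableI) auto
qed

section \<open>Pointwise bound by the Calderon operator\<close>

lemma distribution_density:
  assumes "W \<in> borel_measurable lebesgue" "F \<in> borel_measurable lebesgue"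
  shows "distribution (density lebesgue W) F s = mass W {x. s < F x}"
proof -
  have "{x \<in> space lebesgue. s < F x} \<in> sets lebesgue" using assms(2) by measurable
  then show ?thesis using assms(1) by (simp add: distribution_def mass_emeasure)
qed

context
  fixes W F :: "'a::euclidean_space \<Rightarrow> ennreal" and p t :: real
  assumes Wm[measurable]: "W \<in> borel_measurable lebesgue" and Fm[measurable]: "F \<in> borel_measurable lebesgue"
    and p: "1 \<le> p" and t: "0 < t"
begin

abbreviation (input) "g \<equiv> rearrangement (density lebesgue W) F"

lemma mass_rearrangement_le: "mass W {x. g s < F x} \<le> ennreal s"
proof -
  have "F \<in> borel_measurable (density lebesgue W)" by simp
  from distribution_rearrangement_le[OF this, of s] show ?thesis
    by (simp add: distribution_density Wm Fm)
qed

text \<open>Integrates a function dominated by a sum over level sets; as \<open>p\<close> is at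
  least 1, the resulting sum of powers is at most the power of the sum that occurs in the Calderon
  operator.\<close>

lemma weighted_suminf_le:
  assumes b: "\<And>k. 0 \<le> b k" and A: "\<And>k. A k \<in> sets lebesgue" "\<And>k. mass W (A k) \<le> ennreal (c * b k powr p)" and c: "0 \<le> c"
  shows "(\<integral>\<^sup>+x. W x * (\<Sum>k. epowr (G k) p * indicator (A k) x) \<partial>lebesgue) \<le> ennreal c * epowr (\<Sum>k. ennreal (b k) * G k) p"
proof -
  note [measurable] = A(1)
  have "(\<integral>\<^sup>+x. W x * (\<Sum>k. epowr (G k) p * indicator (A k) x) \<partial>lebesgue) = (\<integral>\<^sup>+x. (\<Sum>k. epowr (G k) p * (W x * indicator (A k) x)) \<partial>lebesgue)"
    by (intro nn_integral_cong) (simp add: ennreal_suminf_cmult[symmetric] mult.left_commute del: ennreal_suminf_cmult)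
  also have "\<dots> = (\<Sum>k. \<integral>\<^sup>+x. epowr (G k) p * (W x * indicator (A k) x) \<partial>lebesgue)"
    by (intro nn_integral_suminf) measurable
  also have "\<dots> = (\<Sum>k. epowr (G k) p * mass W (A k))"
    unfolding mass_def by (simp add: nn_integral_cmult)
  also have "\<dots> \<le> (\<Sum>k. ennreal c * epowr (ennreal (b k) * G k) p)"
  proof (intro suminf_le summableI)
    fix k
    have "epowr (G k) p * mass W (A k) \<le> epowr (G k) p * ennreal (c * b k powr p)"
      by (intro mult_left_mono A) simp
    also have "\<dots> = ennreal c * epowr (ennreal (b k) * G k) p"
      using p c b by (simp add: epowr_mult epowr_ennreal ennreal_mult ac_simps)
    finally show "epowr (G k) p * mass W (A k) \<le> ennreal c * epowr (ennreal (b k) * G k) p" .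
  qed
  also have "\<dots> \<le> ennreal c * epowr (\<Sum>k. ennreal (b k) * G k) p"
    unfolding ennreal_suminf_cmult by (intro mult_left_mono suminf_epowr_le p) simp
  finally show ?thesis .
qed

text \<open>Slice the set by the heights \<open>g (t / 2 ^ k)\<close>: the superlevel set
  \<open>A k\<close> has mass at most \<open>t / 2 ^ k\<close>, and on
  \<open>A k - A (k + 1)\<close> the function is at most \<open>g (t / 2 ^ (k + 1))\<close>. What
  lies in all \<open>A k\<close> has mass 0.\<close>

lemma upper_part_le:
  "(\<integral>\<^sup>+x. W x * (epowr (F x) p * indicator {x. g t < F x} x) \<partial>lebesgue)
     \<le> ennreal t * epowr (\<Sum>k. ennreal (((1/2) powr (1 / p)) ^ k) * g (t / 2 ^ (k + 1))) p"
proof -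
  define A where "A k = {x. g (t / 2 ^ k) < F x}" for k :: nat
  have Am[measurable]: "A k \<in> sets lebesgue" for k
  proof -
    have "{x \<in> space lebesgue. g (t / 2 ^ k) < F x} \<in> sets lebesgue" by measurable
    then show ?thesis by (simp add: A_def)
  qed
  define N where "N = (\<Inter>k. A k)"
  have [measurable]: "N \<in> sets lebesgue" unfolding N_def by measurable
  have "mass W N \<le> 0 + ennreal e" if e: "0 < e" for e
  proof -
    obtain k where k: "(1/2) ^ k < e / t" using real_arch_pow_inv[of "e / t" "1/2"] e t by auto
    have "mass W N \<le> mass W (A k)" by (intro mass_mono_set) (auto simp: N_def)
    also have "\<dots> \<le> ennreal (t / 2 ^ k)" unfolding A_def by (rule mass_rearrangement_le)
    also have "\<dots> \<le> ennreal e" using k t by (intro ennreal_leI) (simp add: field_simps power_one_over)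
    finally show ?thesis by simp
  qed
  then have "mass W N \<le> 0" by (rule ennreal_le_epsilon)
  then have "AE x in lebesgue. W x * indicator N x = 0"
    unfolding mass_def by (simp add: nn_integral_0_iff_AE)
  then have "AE x in lebesgue. W x * (epowr (F x) p * indicator {x. g t < F x} x) \<le>
      W x * (\<Sum>k. epowr (g (t / 2 ^ (k + 1))) p * indicator (A k) x)"
  proof eventually_elim
    case (elim x)
    show ?case
    proof (cases "x \<in> N \<or> \<not> g t < F x")
      case True
      then show ?thesis using elim by auto
    next
      case False
      then have ex: "\<exists>k. x \<notin> A k" and gt: "g t < F x" by (auto simp: N_def)
      define n where "n = (LEAST k. x \<notin> A k)"
      have n: "x \<notin> A n" unfolding n_def by (rule LeastI_ex[OF ex])
      have "n \<noteq> 0" using n gt by (intro notI) (simp add: A_def)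
      then obtain k where k: "n = Suc k" by (cases n) auto
      have kA: "x \<in> A k" using not_less_Least[of k "\<lambda>k. x \<notin> A k"] k by (auto simp: n_def)
      have "F x \<le> g (t / 2 ^ (k + 1))" using n k by (simp add: A_def not_less)
      then have "epowr (F x) p * indicator {x. g t < F x} x \<le> epowr (g (t / 2 ^ (k + 1))) p * indicator (A k) x"
        using p kA gt by (simp add: epowr_mono)
      also have "\<dots> \<le> (\<Sum>k. epowr (g (t / 2 ^ (k + 1))) p * indicator (A k) x)"
        by (rule ennreal_le_suminf)
      finally show ?thesis by (rule mult_left_mono) simp
    qed
  qed
  then have "(\<integral>\<^sup>+x. W x * (epowr (F x) p * indicator {x. g t < F x} x) \<partial>lebesgue) \<le>
     (\<integral>\<^sup>+x. W x * (\<Sum>k. epowr (g (t / 2 ^ (k + 1))) p * indicator (A k) x) \<partial>lebesgue)"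
    by (rule nn_integral_mono_AE)
  also have "\<dots> \<le> ennreal t * epowr (\<Sum>k. ennreal (((1/2) powr (1 / p)) ^ k) * g (t / 2 ^ (k + 1))) p"
  proof (rule weighted_suminf_le[OF _ Am])
    fix k
    have "(((1/2) powr (1 / p)) ^ k) powr p = (1/2) ^ k"
      using p by (simp add: powr_realpow[symmetric] powr_powr powr_power)
    then show "mass W (A k) \<le> ennreal (t * (((1/2) powr (1 / p)) ^ k) powr p)"
      using mass_rearrangement_le[of "t / 2 ^ k"] by (simp add: A_def power_one_over)
  qed (use t in auto)
  finally show ?thesis .
qed

text \<open>Slice by the heights \<open>g (t * 2 ^ k)\<close>. The slice with \<open>F\<close> at
  most \<open>g (t * 2 ^ k)\<close> lies in the superlevel set of the next height, of mass at most
  \<open>t * 2 ^ (k + 1)\<close>; this shift causes the factor 2.\<close>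

lemma lower_part_le:
  assumes fin: "(\<Sum>k. ennreal ((2 powr (1 / p)) ^ k) * g (t * 2 ^ k)) < \<infinity>"
  shows "(\<integral>\<^sup>+x. W x * (epowr (F x) p * indicator {x. F x \<le> g t} x) \<partial>lebesgue)
     \<le> ennreal (2 * t) * epowr (\<Sum>k. ennreal ((2 powr (1 / p)) ^ k) * g (t * 2 ^ k)) p"
proof -
  define A where "A k = {x. g (t * 2 ^ (k + 1)) < F x}" for k :: nat
  have Am[measurable]: "A k \<in> sets lebesgue" for k
  proof -
    have "{x \<in> space lebesgue. g (t * 2 ^ (k + 1)) < F x} \<in> sets lebesgue" by measurable
    then show ?thesis by (simp add: A_def)
  qed
  have "W x * (epowr (F x) p * indicator {x. F x \<le> g t} x) \<le> W x * (\<Sum>k. epowr (g (t * 2 ^ k)) p * indicator (A k) x)" for x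
  proof (cases "\<exists>k. x \<in> A k")
    case False
    \<comment> \<open>A positive value below all the heights would make every term of the series at
      least \<open>F x\<close>, against its finiteness.\<close>
    have "F x = 0 \<or> \<not> F x \<le> g t"
    proof (rule ccontr)
      assume "\<not> (F x = 0 \<or> \<not> F x \<le> g t)"
      then have F: "0 < F x" "F x \<le> g t" by (auto simp: zero_less_iff_neq_zero)
      have Fg: "F x \<le> g (t * 2 ^ k)" for k
        using False F by (cases k) (auto simp: A_def not_less)
      have ge: "ennreal ((2 powr (1 / p)) ^ k) \<ge> 1" for k
        using p by (simp add: ge_one_powr_ge_zero one_le_power)
      have "(\<Sum>k::nat. F x) \<le> (\<Sum>k. ennreal ((2 powr (1 / p)) ^ k) * g (t * 2 ^ k))"
      proof (intro suminf_le summableI)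
        fix k
        have "1 * F x \<le> ennreal ((2 powr (1 / p)) ^ k) * g (t * 2 ^ k)"
          by (intro mult_mono ge Fg) auto
        then show "F x \<le> ennreal ((2 powr (1 / p)) ^ k) * g (t * 2 ^ k)" by simp
      qed
      then have lt: "(\<Sum>k::nat. F x) < \<infinity>" using fin by (rule le_less_trans)
      have "of_nat n * F x \<le> (\<Sum>k::nat. F x)" for n
        using sum_le_suminf[of "\<lambda>k::nat. F x" "{..<n}"] by (simp add: summableI)
      moreover obtain r where r: "(\<Sum>k::nat. F x) = ennreal r" "0 \<le> r" using lt by (cases "\<Sum>k::nat. F x") auto
      ultimately have nF: "of_nat n * F x \<le> ennreal r" for n by simp
      obtain q where q: "F x = ennreal q" "0 < q"
        using F nF[of 1] by (cases "F x") (auto simp: top_unique)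
      obtain n where n: "r / q < real n" using reals_Archimedean2 by blast
      have "ennreal (real n * q) \<le> ennreal r"
        using nF[of n] q by (simp add: ennreal_mult ennreal_of_nat_eq_real_of_nat)
      then have "real n * q \<le> r" using r by (simp add: ennreal_le_iff)
      with n q show False by (simp add: field_simps)
    qed
    then show ?thesis by auto
  next
    case True
    define k where "k = (LEAST k. x \<in> A k)"
    have kA: "x \<in> A k" unfolding k_def by (rule LeastI_ex[OF True])
    have "epowr (F x) p * indicator {x. F x \<le> g t} x \<le> epowr (g (t * 2 ^ k)) p * indicator (A k) x"
    proof (cases "F x \<le> g t")
      case le: True
      have "F x \<le> g (t * 2 ^ k)"
      proof (cases k)
        case (Suc j)
        then have "x \<notin> A j" using not_less_Least[of j "\<lambda>k. x \<in> A k"] by (simp add: k_def)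
        then show ?thesis using Suc by (simp add: A_def not_less)
      qed (use le in simp)
      then show ?thesis using p kA le by (simp add: epowr_mono)
    qed simp
    also have "\<dots> \<le> (\<Sum>k. epowr (g (t * 2 ^ k)) p * indicator (A k) x)"
      by (rule ennreal_le_suminf)
    finally show ?thesis by (rule mult_left_mono) simp
  qed
  then have "(\<integral>\<^sup>+x. W x * (epowr (F x) p * indicator {x. F x \<le> g t} x) \<partial>lebesgue) \<le>
     (\<integral>\<^sup>+x. W x * (\<Sum>k. epowr (g (t * 2 ^ k)) p * indicator (A k) x) \<partial>lebesgue)"
    by (rule nn_integral_mono)
  also have "\<dots> \<le> ennreal (2 * t) * epowr (\<Sum>k. ennreal ((2 powr (1 / p)) ^ k) * g (t * 2 ^ k)) p"
  proof (rule weighted_suminf_le[OF _ Am])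
    fix k
    have "((2 powr (1 / p)) ^ k) powr p = 2 ^ k"
      using p by (simp add: powr_realpow[symmetric] powr_powr powr_power)
    then show "mass W (A k) \<le> ennreal (2 * t * ((2 powr (1 / p)) ^ k) powr p)"
      using mass_rearrangement_le[of "t * 2 ^ (k + 1)"] by (simp add: A_def ac_simps)
  qed (use t in auto)
  finally show ?thesis .
qed

end

text \<open>Above the height \<open>(C * r) powr (1 / p) * s\<close> the factor
  \<open>y powr p\<close> absorbs everything in the weak type bound except \<open>t\<close>.\<close>

lemma weak_type_level:
  assumes "ennreal (y powr p) * m \<le> ennreal C * I" "I \<le> ennreal (r * t) * epowr (ennreal s) p" "0 < y" "(C * r) powr (1 / p) * s \<le> y"
    and "0 < C" "0 < r" "0 \<le> s" "0 < t" "1 \<le> p"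
  shows "m \<le> ennreal t"
proof -
  have "C * r * s powr p = ((C * r) powr (1 / p) * s) powr p"
    using assms(5-9) by (subst powr_mult) (auto simp: powr_powr)
  also have "\<dots> \<le> y powr p" using assms(4-9) by (intro powr_mono2) auto
  finally have le: "t * (C * r * s powr p) \<le> t * y powr p" using assms(8) by simp
  have "ennreal (y powr p) * m \<le> ennreal C * (ennreal (r * t) * epowr (ennreal s) p)"
    by (rule order_trans[OF assms(1) mult_left_mono[OF assms(2)]]) simp
  also have "\<dots> = ennreal (t * (C * r * s powr p))"
    using assms(5-9) by (simp add: epowr_ennreal ennreal_mult[symmetric] ac_simps)
  also have "\<dots> \<le> ennreal (t * y powr p)" by (rule ennreal_leI[OF le])
  also have "\<dots> = ennreal t * ennreal (y powr p)" using assms(8) by (simp add: ennreal_mult)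
  finally have "m * ennreal (y powr p) \<le> ennreal t * ennreal (y powr p)" by (simp add: mult.commute)
  then show ?thesis by (rule ennreal_mult_le_cancel) (use assms(3) in auto)
qed

text \<open>The function is split at the height \<open>f\<^sup>*(t)\<close>.\<close>
lemma rearrangement_le_calderon:
  fixes W :: "'a::euclidean_space \<Rightarrow> ennreal" and T :: "('a \<Rightarrow> 'b::{real_normed_field,second_countable_topology}) \<Rightarrow> ('a \<Rightarrow> 'b)"
  assumes Wm[measurable]: "W \<in> borel_measurable lebesgue" and sub: "sublinear_operator D T"
    and p: "1 \<le> p1" "1 \<le> p2" and C: "0 < C1" "0 < C2"
    and weak1: "weak_type W p1 D T C1"
    and weak2: "weak_type W p2 D T C2"
    and fm[measurable]: "f \<in> borel_measurable lebesgue" and t: "0 < t"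
    and fin: "calderon p1 p2 (rearrangement (density lebesgue W) (\<lambda>x. ennreal (norm (f x)))) t < \<infinity>"
  shows "f \<in> D" "rearrangement (density lebesgue W) (\<lambda>x. ennreal (norm (T f x))) (2 * t) \<le>
     ennreal (2 * max (C1 powr (1 / p1)) ((2 * C2) powr (1 / p2))) *
     calderon p1 p2 (rearrangement (density lebesgue W) (\<lambda>x. ennreal (norm (f x)))) t"
proof -
  define F where "F x = ennreal (norm (f x))" for x
  have Fm[measurable]: "F \<in> borel_measurable lebesgue" unfolding F_def by measurable
  define g where "g = rearrangement (density lebesgue W) F"
  \<comment> \<open>The thresholds of \<open>weak_type_level\<close> for the two parts, with
    \<open>r = 1\<close> for the upper and \<open>r = 2\<close> for the lower one.\<close>
  define c where "c = max (C1 powr (1 / p1)) ((2 * C2) powr (1 / p2))"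
  have c0: "0 < c" using C by (simp add: c_def less_max_iff_disj)
  have F_eq: "(\<lambda>x. ennreal (norm (f x))) = F" by (simp add: F_def fun_eq_iff)
  have finS: "calderon p1 p2 g t < \<infinity>" using fin by (simp add: F_eq g_def)
  then obtain s where s: "calderon p1 p2 g t = ennreal s" "0 \<le> s" by (cases "calderon p1 p2 g t") auto
  have S1: "(\<Sum>k. ennreal (((1/2) powr (1 / p1)) ^ k) * g (t / 2 ^ (k + 1))) \<le> ennreal s"
    and S2: "(\<Sum>k. ennreal ((2 powr (1 / p2)) ^ k) * g (t * 2 ^ k)) \<le> ennreal s"
    unfolding s(1)[symmetric] calderon_def by simp_all
  define f1 where "f1 x = (if g t < F x then f x else 0)" for x
  define f2 where "f2 x = (if g t < F x then 0 else f x)" for x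
  have [measurable]: "f1 \<in> borel_measurable lebesgue" "f2 \<in> borel_measurable lebesgue"
    unfolding f1_def f2_def by measurable
  have "moment W p1 (\<lambda>x. ennreal (norm (f1 x))) = (\<integral>\<^sup>+x. W x * (epowr (F x) p1 * indicator {x. g t < F x} x) \<partial>lebesgue)"
    by (intro nn_integral_cong) (auto simp: f1_def F_def)
  also have "\<dots> \<le> ennreal t * epowr (\<Sum>k. ennreal (((1/2) powr (1 / p1)) ^ k) * g (t / 2 ^ (k + 1))) p1"
    unfolding g_def by (rule upper_part_le[OF Wm Fm p(1) t])
  also have "\<dots> \<le> ennreal t * epowr (ennreal s) p1"
    using p by (intro mult_left_mono epowr_mono S1) auto
  finally have I1: "moment W p1 (\<lambda>x. ennreal (norm (f1 x))) \<le> ennreal t * epowr (ennreal s) p1" .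
  have "moment W p2 (\<lambda>x. ennreal (norm (f2 x))) = (\<integral>\<^sup>+x. W x * (epowr (F x) p2 * indicator {x. F x \<le> g t} x) \<partial>lebesgue)"
    by (intro nn_integral_cong) (auto simp: f2_def F_def)
  also have "\<dots> \<le> ennreal (2 * t) * epowr (\<Sum>k. ennreal ((2 powr (1 / p2)) ^ k) * g (t * 2 ^ k)) p2"
    unfolding g_def by (rule lower_part_le[OF Wm Fm p(2) t]) (use S2 in \<open>simp add: g_def le_less_trans\<close>)
  also have "\<dots> \<le> ennreal (2 * t) * epowr (ennreal s) p2"
    using p by (intro mult_left_mono epowr_mono S2) auto
  finally have I2: "moment W p2 (\<lambda>x. ennreal (norm (f2 x))) \<le> ennreal (2 * t) * epowr (ennreal s) p2" .
  have f1D: "f1 \<in> D" and w1: "\<And>y. 0 < y \<Longrightarrow> ennreal (y powr p1) * mass W {x. y < norm (T f1 x)} \<le> ennreal C1 * moment W p1 (\<lambda>x. ennreal (norm (f1 x)))"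
    using weak1[unfolded weak_type_def, THEN bspec, of f1] le_less_trans[OF I1] by (auto simp: ennreal_mult_less_top)
  have f2D: "f2 \<in> D" and w2: "\<And>y. 0 < y \<Longrightarrow> ennreal (y powr p2) * mass W {x. y < norm (T f2 x)} \<le> ennreal C2 * moment W p2 (\<lambda>x. ennreal (norm (f2 x)))"
    using weak2[unfolded weak_type_def, THEN bspec, of f2] le_less_trans[OF I2] by (auto simp: ennreal_mult_less_top)
  have f_eq: "(\<lambda>x. f1 x + f2 x) = f" by (auto simp: f1_def f2_def fun_eq_iff)
  have "(\<lambda>x. f1 x + f2 x) \<in> D" using sub f1D f2D unfolding sublinear_operator_def by blast
  then show fD: "f \<in> D" unfolding f_eq .
  have "AE x in lebesgue. norm (T (\<lambda>x. f1 x + f2 x) x) \<le> norm (T f1 x) + norm (T f2 x)"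
    using sub f1D f2D unfolding sublinear_operator_def by blast
  then have subadd: "AE x in lebesgue. norm (T f x) \<le> norm (T f1 x) + norm (T f2 x)" unfolding f_eq .
  have Tm[measurable]: "T f \<in> borel_measurable lebesgue" "T f1 \<in> borel_measurable lebesgue" "T f2 \<in> borel_measurable lebesgue"
    using sub fD f1D f2D unfolding sublinear_operator_def by blast+
  \<comment> \<open>Each part exceeds \<open>y\<close> on a set of mass at most \<open>t\<close>, so
    their sum exceeds \<open>2 * y\<close> on a set of mass at most \<open>2 * t\<close>. Positivity
    of \<open>y\<close> is assumed because \<open>c * s\<close> may be 0; a limit removes it
    afterwards.\<close>
  have key: "rearrangement (density lebesgue W) (\<lambda>x. ennreal (norm (T f x))) (2 * t) \<le> ennreal (2 * y)"
    if y: "0 < y" "c * s \<le> y" for y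
  proof (rule rearrangement_le)
    have m1: "mass W {x. y < norm (T f1 x)} \<le> ennreal t"
    proof (rule weak_type_level[OF w1[OF y(1)], where r=1 and s=s])
      have "C1 powr (1 / p1) * s \<le> c * s" using s by (intro mult_right_mono) (auto simp: c_def)
      then show "(C1 * 1) powr (1 / p1) * s \<le> y" using y by simp
    qed (use y(1) C s(2) t p I1 in auto)
    have m2: "mass W {x. y < norm (T f2 x)} \<le> ennreal t"
    proof (rule weak_type_level[OF w2[OF y(1)], where r=2 and s=s])
      have "(2 * C2) powr (1 / p2) * s \<le> c * s" using s by (intro mult_right_mono) (auto simp: c_def)
      then show "(C2 * 2) powr (1 / p2) * s \<le> y" using y by (simp add: mult.commute)
    qed (use y(1) C s(2) t p I2 in auto)
    have "mass W {x. 2 * y < norm (T f x)} \<le> mass W ({x. y < norm (T f1 x)} \<union> {x. y < norm (T f2 x)})"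
    proof (rule mass_mono_set_AE)
      show "AE x in lebesgue. x \<in> {x. 2 * y < norm (T f x)} \<longrightarrow> x \<in> {x. y < norm (T f1 x)} \<union> {x. y < norm (T f2 x)}"
        using subadd by eventually_elim auto
    qed
    also have "\<dots> \<le> mass W {x. y < norm (T f1 x)} + mass W {x. y < norm (T f2 x)}"
    proof -
      have "{x \<in> space lebesgue. y < norm (T f1 x)} \<in> sets lebesgue" "{x \<in> space lebesgue. y < norm (T f2 x)} \<in> sets lebesgue"
        by measurable
      then show ?thesis by (simp add: mass_emeasure emeasure_subadditive sets.Un)
    qed
    also have "\<dots> \<le> ennreal t + ennreal t" by (intro add_mono m1 m2)
    also have "\<dots> = ennreal (2 * t)" using t by (simp add: ennreal_plus[symmetric] del: ennreal_plus)
    finally have "mass W {x. 2 * y < norm (T f x)} \<le> ennreal (2 * t)" .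
    moreover have "{x. ennreal (2 * y) < ennreal (norm (T f x))} = {x. 2 * y < norm (T f x)}"
      using y by (auto simp: ennreal_less_iff)
    ultimately show "distribution (density lebesgue W) (\<lambda>x. ennreal (norm (T f x))) (ennreal (2 * y)) \<le> ennreal (2 * t)"
      by (subst distribution_density) auto
  qed
  have "rearrangement (density lebesgue W) (\<lambda>x. ennreal (norm (T f x))) (2 * t) \<le> ennreal (2 * c * s) + ennreal e" if e: "0 < e" for e
  proof -
    have "rearrangement (density lebesgue W) (\<lambda>x. ennreal (norm (T f x))) (2 * t) \<le> ennreal (2 * (c * s + e / 2))"
      using e c0 s by (intro key) (auto simp: add_nonneg_pos)
    also have "\<dots> = ennreal (2 * c * s) + ennreal e"
      using e c0 s by (subst ennreal_plus[symmetric]) (auto simp: algebra_simps)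
    finally show ?thesis .
  qed
  then have "rearrangement (density lebesgue W) (\<lambda>x. ennreal (norm (T f x))) (2 * t) \<le> ennreal (2 * c * s)"
    by (rule ennreal_le_epsilon)
  also have "\<dots> = ennreal (2 * c) * calderon p1 p2 g t"
    using c0 s by (simp add: ennreal_mult)
  finally show "rearrangement (density lebesgue W) (\<lambda>x. ennreal (norm (T f x))) (2 * t) \<le>
     ennreal (2 * max (C1 powr (1 / p1)) ((2 * C2) powr (1 / p2))) *
     calderon p1 p2 (rearrangement (density lebesgue W) (\<lambda>x. ennreal (norm (f x)))) t"
    unfolding F_eq c_def g_def .
qed

text \<open>The rearrangement of \<open>T f\<close> at \<open>2 * t\<close> is dominated by a
  multiple of the Calderon operator at \<open>t\<close>. It remains to undo the dilation by 2, which
  the lower index allows since the Calderon operator again yields a decreasing function.\<close>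

theorem boyd_interpolation:
  fixes W :: "'a::euclidean_space \<Rightarrow> ennreal" and T :: "('a \<Rightarrow> 'b::{real_normed_field,second_countable_topology}) \<Rightarrow> ('a \<Rightarrow> 'b)"
  assumes Wm: "W \<in> borel_measurable lebesgue" and sub: "sublinear_operator D T"
    and \<sigma>: "ri_banach_function_norm half_line \<sigma>" and low: "has_lower_boyd_index \<sigma> p" and up: "has_upper_boyd_index \<sigma> q"
    and p: "1 \<le> p1" "p1 < p" "0 < q" "q < p2" "1 \<le> p2" and C: "0 < C1" "0 < C2"
    and weak1: "weak_type W p1 D T C1"
    and weak2: "weak_type W p2 D T C2"
  shows "\<exists>C\<ge>0. \<forall>f\<in>borel_measurable lebesgue. \<sigma> (rearrangement (density lebesgue W) (\<lambda>x. ennreal (norm (f x)))) < \<infinity> \<longrightarrow>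
     f \<in> D \<and> \<sigma> (rearrangement (density lebesgue W) (\<lambda>x. ennreal (norm (T f x)))) \<le>
       ennreal C * \<sigma> (rearrangement (density lebesgue W) (\<lambda>x. ennreal (norm (f x))))"
proof -
  interpret ri_banach_function_norm half_line \<sigma> by fact
  have p10: "0 < p1" "0 < p" using p by auto
  obtain A where A: "0 < A" "\<And>g. antimono g \<Longrightarrow> \<sigma> g < \<infinity> \<Longrightarrow> \<sigma> (calderon p1 p2 g) \<le> ennreal A * \<sigma> g"
    using calderon_bounded[OF \<sigma> low up p10(1) p(2,3,4)] by blast
  obtain B where B: "0 < B" "\<And>g j. antimono g \<Longrightarrow> \<sigma> g < \<infinity> \<Longrightarrow> \<sigma> (\<lambda>s. g (s / 2 ^ j)) \<le> ennreal (B * (2 powr (1 / p1)) ^ j) * \<sigma> g"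
    using dilate_up_le[OF \<sigma> low p10(1) p(2)] by blast
  define c where "c = 2 * max (C1 powr (1 / p1)) ((2 * C2) powr (1 / p2))"
  have c0: "0 < c" using C by (simp add: c_def less_max_iff_disj)
  \<comment> \<open>Pointwise constant, dilation by 2 and norm bound of the Calderon
    operator.\<close>
  define E where "E = c * (B * 2 powr (1 / p1) * A)"
  have E0: "0 \<le> E" using c0 A B by (simp add: E_def)
  have "f \<in> D \<and> \<sigma> (rearrangement (density lebesgue W) (\<lambda>x. ennreal (norm (T f x)))) \<le>
       ennreal E * \<sigma> (rearrangement (density lebesgue W) (\<lambda>x. ennreal (norm (f x))))"
    if f: "f \<in> borel_measurable lebesgue" "\<sigma> (rearrangement (density lebesgue W) (\<lambda>x. ennreal (norm (f x)))) < \<infinity>" for f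
  proof -
    define g where "g = rearrangement (density lebesgue W) (\<lambda>x. ennreal (norm (f x)))"
    have ga: "antimono g" unfolding g_def by (intro antimonoI rearrangement_antimono)
    have gf: "\<sigma> g < \<infinity>" using f by (simp add: g_def)
    let ?S = "calderon p1 p2 g"
    have Sa: "antimono ?S" by (rule antimono_calderon[OF ga])
    have Sb[measurable]: "?S \<in> borel_measurable borel" by (rule antimono_borel_measurable[OF Sa])
    have S_le: "\<sigma> ?S \<le> ennreal A * \<sigma> g" by (rule A(2)[OF ga gf])
    also have "\<dots> < \<infinity>" using gf by (simp add: ennreal_mult_less_top)
    finally have Sf: "\<sigma> ?S < \<infinity>" .
    have pt: "f \<in> D" "rearrangement (density lebesgue W) (\<lambda>x. ennreal (norm (T f x))) (2 * t) \<le> ennreal c * ?S t"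
      if t: "0 < t" "?S t < \<infinity>" for t
      using rearrangement_le_calderon[OF Wm sub p(1,5) C weak1 weak2 f(1) t[unfolded g_def]]
      unfolding c_def g_def .
    \<comment> \<open>One finite value is enough to split \<open>f\<close> and to place it in
      \<open>D\<close>. Otherwise \<open>?S\<close> would be infinite on an interval of finite
      measure, although functions of finite norm are locally integrable.\<close>
    have "\<exists>t>0. ?S t < \<infinity>"
    proof (rule ccontr)
      assume "\<not> (\<exists>t>0. ?S t < \<infinity>)"
      then have top: "?S t = top" if "0 < t" for t
        using that by (metis infinity_ennreal_def top.not_eq_extremum)
      have I: "{0<..<1::real} \<in> sets half_line" by (auto simp: sets_restrict_space_iff)
      have e: "emeasure half_line {0<..<1::real} = 1"
        by (subst emeasure_restrict_space) (auto simp: emeasure_completion)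
      obtain C where C: "0 < C" "\<And>h. h \<in> borel_measurable half_line \<Longrightarrow> (\<integral>\<^sup>+x\<in>{0<..<1}. h x \<partial>half_line) \<le> ennreal C * \<sigma> h"
        using local_integrable[OF I] e by auto
      have "(\<integral>\<^sup>+x\<in>{0<..<1}. ?S x \<partial>half_line) = (\<integral>\<^sup>+x\<in>{0<..<1}. top \<partial>half_line)"
        by (intro nn_integral_cong) (auto simp: top indicator_def)
      also have "\<dots> = top" using I e by (subst nn_integral_cmult_indicator) (auto simp: ennreal_mult_top)
      finally have "(\<integral>\<^sup>+x\<in>{0<..<1}. ?S x \<partial>half_line) = top" .
      with C(2)[OF borel_half_line[OF Sb]] Sf show False
        by (auto simp: top_unique ennreal_mult_eq_top_iff)
    qed
    then obtain t where "0 < t" "?S t < \<infinity>" by blast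
    then have fD: "f \<in> D" by (rule pt(1))
    have Tle: "rearrangement (density lebesgue W) (\<lambda>x. ennreal (norm (T f x))) t \<le> ennreal c * ?S (t / 2)" if "0 < t" for t
    proof (cases "?S (t / 2) < \<infinity>")
      case True
      then show ?thesis using pt(2)[of "t / 2"] that by simp
    next
      case False
      then have "ennreal c * ?S (t / 2) = top" using c0 by (simp add: less_top[symmetric] ennreal_mult_top)
      then show ?thesis by simp
    qed
    have m: "rearrangement (density lebesgue W) (\<lambda>x. ennreal (norm (T f x))) \<in> borel_measurable half_line"
      by (intro borel_half_line antimono_borel_measurable antimonoI rearrangement_antimono)
    have m2: "(\<lambda>t. ?S (t / 2)) \<in> borel_measurable half_line" by (rule borel_half_line) measurable
    have "\<sigma> (rearrangement (density lebesgue W) (\<lambda>x. ennreal (norm (T f x)))) \<le> \<sigma> (\<lambda>t. ennreal c * ?S (t / 2))"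
    proof (rule lattice[OF _ m])
      show "(\<lambda>t. ennreal c * ?S (t / 2)) \<in> borel_measurable half_line" using m2 by measurable
      show "AE t in half_line. rearrangement (density lebesgue W) (\<lambda>x. ennreal (norm (T f x))) t \<le> ennreal c * ?S (t / 2)"
        by (intro AE_I2 Tle) (simp add: space_restrict_space)
    qed
    also have "\<dots> = ennreal c * \<sigma> (\<lambda>t. ?S (t / 2))" using c0 by (intro scale m2) simp
    also have "\<dots> \<le> ennreal c * (ennreal (B * 2 powr (1 / p1)) * (ennreal A * \<sigma> g))"
    proof (intro mult_left_mono)
      have "\<sigma> (\<lambda>t. ?S (t / 2)) \<le> ennreal (B * 2 powr (1 / p1)) * \<sigma> ?S"
        using B(2)[OF Sa Sf, of 1] by simp
      also have "\<dots> \<le> ennreal (B * 2 powr (1 / p1)) * (ennreal A * \<sigma> g)"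
        by (intro mult_left_mono S_le) simp
      finally show "\<sigma> (\<lambda>t. ?S (t / 2)) \<le> ennreal (B * 2 powr (1 / p1)) * (ennreal A * \<sigma> g)" .
    qed simp
    also have "\<dots> = ennreal E * \<sigma> g"
      using c0 A B by (simp add: E_def ennreal_mult mult.assoc)
    finally show ?thesis using fD by (simp add: g_def)
  qed
  then show ?thesis using E0 by blast
qed

theorem theorem3p20:
  fixes p0 :: real
    and D :: "('a::euclidean_space \<Rightarrow> 'b::{real_normed_field,second_countable_topology}) set"
    and T :: "('a \<Rightarrow> 'b) \<Rightarrow> ('a \<Rightarrow> 'b)"
    and \<phi> :: "real \<Rightarrow> real"
    and \<rho> :: "('a \<Rightarrow> ennreal) \<Rightarrow> ennreal"
    and \<sigma> :: "(real \<Rightarrow> ennreal) \<Rightarrow> ennreal"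
    and pX qX :: real
    and w :: "'a \<Rightarrow> real"
  assumes "1 \<le> p0"
    and "sublinear_operator D T"
    and "locally_bounded \<phi>"
    and "\<And>u. u \<in> Ap p0 \<Longrightarrow>
           bounded_operator D T (Lp_norm p0 (weighted u)) (weak_Lp_norm p0 (weighted u))
             (\<phi> (enn2real (Ap_const p0 u)))"
    and "ri_banach_function_norm lebesgue \<rho>"
    and "represents \<sigma> \<rho>"
    and "has_lower_boyd_index \<sigma> pX"
    and "has_upper_boyd_index \<sigma> qX"
    and "1 < pX" and "pX \<le> qX"
    and "w \<in> Ap pX"
  shows "\<exists>C. bounded_operator D T (weighted_ri_norm \<sigma> w) (weighted_ri_norm \<sigma> w) C"
proof -
  let ?W = "\<lambda>x. ennreal (w x)"
  have \<sigma>: "ri_banach_function_norm half_line \<sigma>"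
    using \<open>represents \<sigma> \<rho>\<close> by (simp add: represents_def)
  obtain K S where ap: "Ap_pair pX K ?W S"
    using Ap_pair_of_Ap[OF \<open>1 < pX\<close> \<open>w \<in> Ap pX\<close>] by blast
  have Wm: "?W \<in> borel_measurable lebesgue" by (rule Ap_pair_measurable(1)[OF ap])
  obtain r K' S' where r: "1 < r" "r < pX" and ap1: "Ap_pair r K' ?W S'"
    using Ap_pair_open[OF ap] by blast
  \<comment> \<open>The upper exponent only has to exceed \<open>qX\<close>. It then exceeds
    \<open>pX\<close> too, so \<open>Ap_pair_mono\<close> applies.\<close>
  have q: "0 < qX" "qX < qX + 1" "1 \<le> qX + 1" "pX < qX + 1"
    using \<open>1 < pX\<close> \<open>pX \<le> qX\<close> by auto
  obtain C1 where C1: "0 < C1" "weak_type ?W r D T C1"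
    using extrapolation[OF assms(1-4) ap1] by blast
  obtain C2 where C2: "0 < C2" "weak_type ?W (qX + 1) D T C2"
    using extrapolation[OF assms(1-4) Ap_pair_mono[OF ap q(4)]] by blast
  have "\<exists>C\<ge>0. \<forall>f\<in>borel_measurable lebesgue.
      \<sigma> (rearrangement (density lebesgue ?W) (\<lambda>x. ennreal (norm (f x)))) < \<infinity> \<longrightarrow>
      f \<in> D \<and> \<sigma> (rearrangement (density lebesgue ?W) (\<lambda>x. ennreal (norm (T f x)))) \<le>
        ennreal C * \<sigma> (rearrangement (density lebesgue ?W) (\<lambda>x. ennreal (norm (f x))))"
    using boyd_interpolation[OF Wm \<open>sublinear_operator D T\<close> \<sigma> \<open>has_lower_boyd_index \<sigma> pX\<close>
        \<open>has_upper_boyd_index \<sigma> qX\<close> less_imp_le[OF r(1)] r(2) q(1-3) C1(1) C2(1) C1(2) C2(2)]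
    by blast
  then show ?thesis
    unfolding bounded_operator_def weighted_ri_norm_def weighted_def by blast
qed

end
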